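(* Let $G$ be a locally compact group with neutral element $e$, let $d\in\mathbb{N}$ and let $f:[-1,1]\times G\to\mathbb{C}$ be a continuous function. Then $f$ belongs to $\mathcal{P}(\mathbb{S}^d,G)$ if and only if there exists a sequence $(\varphi_{n,d})_{n\ge 0}$ of functions from $\mathcal{P}(G)$ with $\sum_{n=0}^\infty \varphi_{n,d}(e)<\infty$ such that $$f(\cos\theta,u)=\sum_{n=0}^\infty \varphi_{n,d}(u)\,c_n(d,\cos\theta),\qquad \theta\in[0,\pi],\ u\in G.$$ Moreover, this expansion is uniformly convergent for $(\theta,u)\in[0,\pi]\times G$, and $$\varphi_{n,d}(u)=\frac{N_n(d)\,\sigma_{d-1}}{\sigma_d}\int_{-1}^1 f(x,u)\,c_n(d,x)\,(1-x^2)^{d/2-1}\,dx,\qquad n\ge 0,\ u\in G.$$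
   Context: $\mathbb{N}=\{1,2,\ldots\}$. A function $\varphi:G\to\mathbb{C}$ is positive definite if for all $n\in\mathbb{N}$ and $u_1,\ldots,u_n\in G$ the matrix $[\varphi(u_k^{-1}u_l)]_{k,l=1}^n$ is (hermitian) positive semidefinite; $\mathcal{P}(G)$ is the set of continuous positive definite functions on $G$. $\mathbb{S}^d$ is the unit sphere of $\mathbb{R}^{d+1}$ and $\xi\cdot\eta$ is the Euclidean scalar product. $\mathcal{P}(\mathbb{S}^d,G)$ is the set of continuous functions $f:[-1,1]\times G\to\mathbb{C}$ such that for all $n\in\mathbb{N}$ and all $(\xi_1,u_1),\ldots,(\xi_n,u_n)\in\mathbb{S}^d\times G$ the matrix $[f(\xi_k\cdot\xi_l,u_k^{-1}u_l)]_{k,l=1}^n$ is positive semidefinite, i.e. $\sum_{k,l=1}^n f(\xi_k\cdot\xi_l,u_k^{-1}u_l)a_k\overline{a_l}\ge 0$ for all $(a_1,\ldots,a_n)\in\mathbb{C}^n$. For $\lambda>0$ the Gegenbauer polynomials $C_n^{(\lambda)}$ are given by $(1-2xr+r^2)^{-\lambda}=\sum_{n=0}^\infty C_n^{(\lambda)}(x)r^n$, $|r|<1$. The normalized polynomials are $c_n(d,x)=C_n^{((d-1)/2)}(x)/C_n^{((d-1)/2)}(1)$ for $d\ge 2$, and $c_n(1,x)=T_n(x)=\cos(n\arccos x)$ (Chebyshev polynomials) for $d=1$. $N_n(d)=\frac{(d)_{n-1}}{n!}(2n+d-1)$ for $n\ge1$, $N_0(d)=1$, where $(a)_n=a(a+1)\cdots(a+n-1)$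 for $n\ge 1$ and $(a)_0=1$. $\sigma_d=\frac{2\pi^{(d+1)/2}}{\Gamma((d+1)/2)}$ is the total surface measure of $\mathbb{S}^d$, and $\sigma_0=2$. *)

theory Defs
  imports "HOL-Complex_Analysis.Complex_Analysis"
begin

(* Groups are written additively: the library class topological_group_add does not assume
   commutativity, 0 is the neutral element e, and - u + v stands for u^(-1) v. *)

(* An n x n matrix is given by its entries A k l for k, l < n. The form being real and
   nonnegative for all complex vectors forces A to be hermitian. *)
definition pos_semidef :: "nat \<Rightarrow> (nat \<Rightarrow> nat \<Rightarrow> complex) \<Rightarrow> bool" where
  "pos_semidef n A \<longleftrightarrow>
     (\<forall>a :: nat \<Rightarrow> complex. (\<Sum>k<n. \<Sum>l<n. A k l * a k * cnj (a l)) \<in> \<real>\<^sub>\<ge>\<^sub>0)"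

definition pos_def_funs :: "('g::topological_group_add \<Rightarrow> complex) set" where
  "pos_def_funs = {\<phi>. continuous_on UNIV \<phi> \<and>
     (\<forall>n\<ge>1. \<forall>u :: nat \<Rightarrow> 'g. pos_semidef n (\<lambda>k l. \<phi> (- u k + u l)))}"

(* The sphere is the unit sphere of real ^ 'n, so its dimension is CARD('n) - 1.
   Values of f outside {-1..1} \<times> UNIV are irrelevant. *)
definition pos_def_sphere_funs ::
    "'n::finite itself \<Rightarrow> (real \<times> 'g::topological_group_add \<Rightarrow> complex) set" where
  "pos_def_sphere_funs _ = {f. continuous_on ({-1..1} \<times> UNIV) f \<and>
     (\<forall>n\<ge>1. \<forall>(\<xi> :: nat \<Rightarrow> real ^ 'n) (u :: nat \<Rightarrow> 'g).
        (\<forall>k<n. \<xi> k \<in> sphere 0 1) \<longrightarrow>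
        pos_semidef n (\<lambda>k l. f (\<xi> k \<bullet> \<xi> l, - u k + u l)))}"

(* Coefficient of r^n in (1 - 2 x r + r^2)^(-\<alpha>), read as a formal power series in r: the
   binomial series (1 + X)^(-\<alpha>) composed with - 2 x X + X^2. The analytic identity on |r| < 1
   is gegenbauer_generating_function below. *)
definition gegenbauer :: "real \<Rightarrow> nat \<Rightarrow> real \<Rightarrow> real" where
  "gegenbauer \<alpha> n x =
     fps_nth (fps_compose (fps_binomial (- \<alpha>))
       (fps_const (- 2 * x) * fps_X + fps_X ^ 2)) n"

(* For d = 1 this is the Chebyshev polynomial T_n, restricted to {-1..1}. *)
definition normalized_gegenbauer :: "nat \<Rightarrow> nat \<Rightarrow> real \<Rightarrow> real" where
  "normalized_gegenbauer d n x =
     (if d = 1 then cos (real n * arccos x)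
      else gegenbauer ((real d - 1) / 2) n x / gegenbauer ((real d - 1) / 2) n 1)"

definition harmonic_dim :: "nat \<Rightarrow> nat \<Rightarrow> real" where
  "harmonic_dim d n =
     (if n = 0 then 1
      else pochhammer (real d) (n - 1) / fact n * (2 * real n + real d - 1))"

definition sphere_area :: "nat \<Rightarrow> real" where
  "sphere_area d = 2 * pi powr ((real d + 1) / 2) / Gamma ((real d + 1) / 2)"

lemma sphere_area_0: "sphere_area 0 = 2"
  by (simp add: sphere_area_def Gamma_one_half_real powr_half_sqrt)

definition schoenberg_expansion ::
    "nat \<Rightarrow> (real \<times> 'g::topological_group_add \<Rightarrow> complex) \<Rightarrow> (nat \<Rightarrow> 'g \<Rightarrow> complex) \<Rightarrow> bool" where
  "schoenberg_expansion d f \<phi> \<longleftrightarrow>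
     (\<forall>n. \<phi> n \<in> pos_def_funs) \<and> summable (\<lambda>n. \<phi> n 0) \<and>
     (\<forall>\<theta>\<in>{0..pi}. \<forall>u.
        (\<lambda>n. \<phi> n u * of_real (normalized_gegenbauer d n (cos \<theta>))) sums f (cos \<theta>, u))"

lemma fps_nth_power_of_real:
  fixes H :: "real fps" and K :: "complex fps"
  assumes "\<And>n. fps_nth K n = of_real (fps_nth H n)"
  shows "fps_nth (K ^ i) n = of_real (fps_nth (H ^ i) n)"
proof (induction i arbitrary: n)
  case 0
  show ?case by simp
next
  case (Suc i)
  show ?case by (simp add: fps_mult_nth assms Suc.IH)
qed

lemma gegenbauer_generating_function:
  fixes \<alpha> x r :: real
  assumes x: "\<bar>x\<bar> \<le> 1" and r: "\<bar>r\<bar> < 1"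
  shows "(\<lambda>n. gegenbauer \<alpha> n x * r ^ n) sums ((1 - 2 * x * r + r\<^sup>2) powr (- \<alpha>))"
proof -
  define H :: "real fps" where "H = fps_const (- 2 * x) * fps_X + fps_X ^ 2"
  define K :: "complex fps" where "K = fps_const (- 2 * of_real x) * fps_X + fps_X ^ 2"
  define h :: "complex \<Rightarrow> complex" where "h = (\<lambda>z. - 2 * of_real x * z + z ^ 2)"
  define f where "f = (\<lambda>z. (1 + h z) powr (- of_real \<alpha>))"
  have KH: "fps_nth K n = of_real (fps_nth H n)" for n
    by (simp add: K_def H_def fps_X_power_nth)
  have binom: "(of_real a gchoose n) = (of_real (a gchoose n) :: complex)" for a n
    by (simp add: gbinomial_prod_rev)
  have coeff: "fps_nth (fps_compose (fps_binomial (- of_real \<alpha>)) K) n = of_real (gegenbauer \<alpha> n x)" for n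
    unfolding gegenbauer_def fps_compose_nth H_def[symmetric] of_real_sum of_real_mult
      fps_nth_power_of_real[OF KH, symmetric] fps_binomial_nth binom[symmetric]
    by simp
  have hK: "h has_fps_expansion K"
    unfolding h_def K_def
    by (intro has_fps_expansion_add has_fps_expansion_cmult_left has_fps_expansion_fps_X
        has_fps_expansion_fps_X_power)
  have "((\<lambda>z. (1 + z) powr (- of_real \<alpha>)) \<circ> h) has_fps_expansion
          (fps_compose (fps_binomial (- of_real \<alpha>)) K)"
    by (rule has_fps_expansion_compose[OF has_fps_expansion_binomial_complex hK])
       (simp add: K_def)
  hence f: "f has_fps_expansion (fps_compose (fps_binomial (- of_real \<alpha>)) K)"
    by (simp add: f_def o_def)
  have nonpos: "1 + h z \<notin> \<real>\<^sub>\<le>\<^sub>0" if z: "norm z < 1" for z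
  proof
    assume "1 + h z \<in> \<real>\<^sub>\<le>\<^sub>0"
    then obtain t where t: "1 + h z = of_real t" "t \<le> 0"
      by (auto elim: nonpos_Reals_cases)
    define w where "w = Complex x (sqrt (1 - x\<^sup>2))"
    have x2: "x\<^sup>2 \<le> 1"
      using x by (simp add: abs_square_le_1)
    have nw: "norm w = 1"
      using x2 by (simp add: w_def cmod_def)
    have sumw: "w + cnj w = 2 * of_real x" and prodw: "w * cnj w = 1"
      using nw by (simp_all add: w_def complex_eq_iff complex_norm_square[symmetric] x2
          flip: power2_eq_square)
    define a b where "a = 1 - z * w" and "b = 1 - z * cnj w"
    have "a * b = 1 - z * (w + cnj w) + z\<^sup>2 * (w * cnj w)"
      by (simp add: a_def b_def algebra_simps power2_eq_square)
    hence ab: "a * b = of_real t"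
      using t by (simp add: sumw prodw h_def algebra_simps)
    have "Re (z * v) < 1" if "norm v = 1" for v
      using complex_Re_le_cmod[of "z * v"] z that by (simp add: norm_mult)
    hence pos: "Re a > 0" "Re b > 0"
      using nw by (auto simp: a_def b_def simp del: times_complex.sel)
    have "a * of_real ((norm b)\<^sup>2) = a * b * cnj b"
      by (simp only: complex_norm_square mult.assoc)
    hence "Re (a * of_real ((norm b)\<^sup>2)) = Re (of_real t * cnj b)"
      by (simp only: ab)
    hence "Re a * (norm b)\<^sup>2 = t * Re b"
      by (simp only: times_complex.sel Re_complex_of_real Im_complex_of_real cnj.sel)
    moreover have "Re a * (norm b)\<^sup>2 > 0"
      using pos by (intro mult_pos_pos) auto
    moreover have "t * Re b \<le> 0"
      using pos t by (simp add: mult_nonpos_nonneg)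
    ultimately show False by simp
  qed
  have "f holomorphic_on eball 0 1"
    unfolding f_def using nonpos
    by (intro holomorphic_intros) (auto simp: h_def intro!: holomorphic_intros)
  hence "(\<lambda>n. of_real (gegenbauer \<alpha> n x) * of_real r ^ n) sums f (of_real r)"
    using has_fps_expansion_imp_sums_complex[OF f, of 1 "of_real r"] r by (simp add: coeff)
  moreover have "f (of_real r) = of_real ((1 - 2 * x * r + r\<^sup>2) powr (- \<alpha>))"
  proof -
    have eq: "1 + h (of_real r) = of_real (1 - 2 * x * r + r\<^sup>2)"
      by (simp add: h_def)
    have "1 - 2 * x * r + r\<^sup>2 \<ge> 0"
    proof (rule ccontr)
      assume "\<not> ?thesis"
      hence "1 + h (of_real r) \<in> \<real>\<^sub>\<le>\<^sub>0"
        unfolding eq by (subst nonpos_Reals_of_real_iff) linarith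
      with nonpos[of "of_real r"] r show False by simp
    qed
    thus ?thesis
      unfolding f_def eq by (metis of_real_minus powr_of_real)
  qed
  ultimately have "(\<lambda>n. complex_of_real (gegenbauer \<alpha> n x * r ^ n)) sums
      of_real ((1 - 2 * x * r + r\<^sup>2) powr (- \<alpha>))"
    by simp
  thus ?thesis
    by (simp only: sums_of_real_iff)
qed

end

(* Convolution of zonal polynomials over the sphere preserves degrees, so orthogonality forces
   c_n * c_n to be a positive multiple of c_n. Hence c_n(d, xi . eta) is a Gram kernel, and
   multiplication by it preserves positive definiteness (Schur). This gives sufficiency. For
   necessity, the weighted integral of a positive definite zonal kernel is nonnegative, so the
   coefficient functions of f are positive definite; they are summable at e by testing f( . , e)
   against the kernels (1 + x)^m, which have nonnegative coefficients and concentrate at x = 1.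
   The sum of the resulting uniformly convergent series has the same coefficients as f, hence
   equals f by the Weierstrass approximation theorem.

   The surface measure is the image of Lebesgue measure on the ball under normalization; its zonal
   marginals are identified with the weight (1 - x^2)^(d/2 - 1) through their moments, using only
   that the integral of (v . x)^m over the sphere depends on v through |v|. *)
theory Submission
  imports Defs
begin

text \<open>The classical route expands zonal kernels in spherical harmonics and invokes the
  addition theorem. No harmonics are constructed here; their part is played by the identity N_n (c_n
  * c_n) = c_n, where * is convolution over the sphere with total mass 1. The same identity yields
  |c_n| \<le> 1 on [-1,1], hence the uniform convergence.

  In the necessity part the obstacle is that the coefficients are known to be nonnegative before
  anything is known about convergence. The test kernels must therefore have finite expansions, so
  that every interchange of sum and integral is trivial. The powers (1 + x)^m qualify because the
  recurrence expresses x c_n through its neighbours with positive coefficients.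

  The case d = 1 shapes many details: the Gegenbauer quotient degenerates at exponent 0, and the
  weight (1 - x^2)^(-1/2) is unbounded at the endpoints. Polynomials defined by a recurrence valid
  for all d \<ge> 1, and an additional factor 1 - x^2 wherever the weight has to be tamed, avoid a
  separate treatment.\<close>

section \<open>Normalized ultraspherical polynomials\<close>

text \<open>The recurrence of the Gegenbauer polynomials with exponent (d - 1)/2 after division by
  their values at 1. In this form it also makes sense for d = 1, where the quotient becomes 0/0 for
  n \<ge> 1, and it then produces the Chebyshev polynomials.\<close>

fun ultraspherical :: "nat \<Rightarrow> nat \<Rightarrow> real poly" where
  "ultraspherical d 0 = 1"
| "ultraspherical d (Suc 0) = [:0, 1:]"
| "ultraspherical d (Suc (Suc n)) =
     smult ((2 * real n + real d + 1) / (real n + real d)) (pCons 0 (ultraspherical d (Suc n))) -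
     smult ((real n + 1) / (real n + real d)) (ultraspherical d n)"

lemma poly_ultraspherical_recurrence:
  assumes "d \<ge> 1"
  shows "(real n + real d) * poly (ultraspherical d (Suc (Suc n))) x =
    (2 * real n + real d + 1) * x * poly (ultraspherical d (Suc n)) x -
    (real n + 1) * poly (ultraspherical d n) x"
proof -
  define D where "D = real n + real d"
  have "D \<noteq> 0" using assms by (simp add: D_def)
  thus ?thesis unfolding ultraspherical.simps D_def[symmetric] by (simp add: field_simps)
qed

lemma poly_ultraspherical_1:
  assumes "d \<ge> 1"
  shows "poly (ultraspherical d n) 1 = 1"
proof -
  have "poly (ultraspherical d n) 1 = 1 \<and> poly (ultraspherical d (Suc n)) 1 = 1"
  proof (induction n)
    case (Suc n)
    have "(real n + real d) * poly (ultraspherical d (Suc (Suc n))) 1 = real n + real d"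
      using poly_ultraspherical_recurrence[OF assms, of n 1] Suc by simp
    moreover have "real n + real d \<noteq> 0" using assms by linarith
    ultimately show ?case using Suc by simp
  qed auto
  thus ?thesis by blast
qed

lemma degree_ultraspherical:
  assumes "d \<ge> 1"
  shows "degree (ultraspherical d n) = n"
proof -
  have "degree (ultraspherical d n) = n \<and> degree (ultraspherical d (Suc n)) = Suc n"
  proof (induction n)
    case (Suc n)
    define p q where "p = smult ((2 * real n + real d + 1) / (real n + real d)) (pCons 0 (ultraspherical d (Suc n)))"
      and "q = smult ((real n + 1) / (real n + real d)) (ultraspherical d n)"
    have nz: "ultraspherical d (Suc n) \<noteq> 0" using Suc by auto
    have "(2 * real n + real d + 1) / (real n + real d) \<noteq> 0" using assms by (simp add: add_eq_0_iff)
    hence "degree p = Suc (Suc n)" unfolding p_def using Suc nz by (simp add: degree_pCons_eq)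
    moreover have "degree q \<le> n" unfolding q_def using Suc degree_smult_le[of "(real n + 1) / (real n + real d)" "ultraspherical d n"] by simp
    ultimately have "degree (p - q) = Suc (Suc n)"
      using degree_add_eq_left[of "-q" p] by simp
    thus ?case using Suc by (simp add: p_def q_def)
  qed auto
  thus ?thesis by blast
qed

lemma ultraspherical_basis:
  fixes p :: "real poly"
  assumes d: "d \<ge> 1" and "degree p \<le> n"
  obtains b where "p = (\<Sum>k\<le>n. smult (b k) (ultraspherical d k))"
proof -
  have "\<exists>b. p = (\<Sum>k\<le>n. smult (b k) (ultraspherical d k))" using \<open>degree p \<le> n\<close>
  proof (induction n arbitrary: p)
    case 0
    then obtain a where "p = [:a:]" using degree_eq_zeroE by blast
    thus ?case by (intro exI[of _ "\<lambda>_. a"]) (simp add: one_pCons)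
  next
    case (Suc n)
    define u where "u = ultraspherical d (Suc n)"
    have du: "degree u = Suc n" and lu: "coeff u (Suc n) \<noteq> 0"
      using degree_ultraspherical[OF d, of "Suc n"] unfolding u_def
      by (auto simp: coeff_eq_0 dest: leading_coeff_neq_0 simp del: ultraspherical.simps)
         (metis Zero_not_Suc degree_0 leading_coeff_neq_0)
    define c where "c = coeff p (Suc n) / coeff u (Suc n)"
    have "degree (p - smult c u) \<le> n"
    proof (rule degree_le, intro allI impI)
      fix i assume "n < i"
      show "coeff (p - smult c u) i = 0"
      proof (cases "i = Suc n")
        case True thus ?thesis using lu by (simp add: c_def)
      next
        case False
        hence "i > Suc n" using \<open>n < i\<close> by simp
        thus ?thesis using du Suc.prems by (simp add: coeff_eq_0)
      qed
    qed
    from Suc.IH[OF this] obtain b where b: "p - smult c u = (\<Sum>k\<le>n. smult (b k) (ultraspherical d k))" by blast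
    have "p = (\<Sum>k\<le>Suc n. smult ((b(Suc n := c)) k) (ultraspherical d k))"
      using b by (simp add: u_def algebra_simps del: ultraspherical.simps)
    thus ?case by blast
  qed
  thus ?thesis using that by blast
qed

text \<open>Solved for x c_(j+1), the recurrence has positive coefficients, so multiplication by 1 +
  x preserves the cone of nonnegative combinations. \<open>P m\<close> is that cone in degrees up to
  m.\<close>

lemma ultraspherical_one_plus_x_power:
  assumes d: "d \<ge> 1"
  obtains b where "\<And>k. b k \<ge> 0" "[:1, 1:] ^ m = (\<Sum>k\<le>m. smult (b k) (ultraspherical d k))"
proof -
  define P where "P = (\<lambda>m p. \<exists>b. (\<forall>k. b k \<ge> 0) \<and> p = (\<Sum>k\<le>m. smult (b k :: real) (ultraspherical d k)))"
  have add: "P m (p + q)" if "P m p" "P m q" for m p q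
  proof -
    from that obtain b b' where "\<forall>k. b k \<ge> 0" "p = (\<Sum>k\<le>m. smult (b k) (ultraspherical d k))"
      "\<forall>k. b' k \<ge> 0" "q = (\<Sum>k\<le>m. smult (b' k) (ultraspherical d k))" unfolding P_def by blast
    thus ?thesis unfolding P_def by (intro exI[of _ "\<lambda>k. b k + b' k"]) (simp add: smult_add_left sum.distrib)
  qed
  have smult: "P m (smult c p)" if "P m p" "c \<ge> 0" for m c p
  proof -
    from that obtain b where "\<forall>k. b k \<ge> 0" "p = (\<Sum>k\<le>m. smult (b k) (ultraspherical d k))" unfolding P_def by blast
    thus ?thesis unfolding P_def using that by (intro exI[of _ "\<lambda>k. c * b k"]) (simp add: sum_comp_morphism[of "smult c", symmetric] smult_add_right o_def)
  qed
  have base: "P m (ultraspherical d k)" if "k \<le> m" for m k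
    unfolding P_def using that
    by (intro exI[of _ "\<lambda>j. if j = k then 1 else 0"]) (simp add: if_distrib[of "\<lambda>c. smult c _"] sum.delta cong: if_cong)
  have sum: "P m (sum g A)" if "\<And>k. k \<in> A \<Longrightarrow> P m (g k)" "finite A" for m g and A :: "nat set"
    using that(2,1)
  proof (induction rule: finite_induct)
    case empty
    show ?case unfolding P_def by (intro exI[of _ "\<lambda>_. 0"]) simp
  qed (auto intro: add)
  have mult: "P (Suc m) ([:1, 1:] * ultraspherical d k)" if k: "k \<le> m" for m k
  proof -
    have "P (Suc m) (pCons 0 (ultraspherical d k))"
    proof (cases k)
      case 0
      thus ?thesis using base[of 1 "Suc m"] by (simp add: one_pCons)
    next
      case (Suc j)
      define A B where "A = 2 * real j + real d + 1" and "B = real j + real d"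
      have A: "A \<noteq> 0" using d unfolding A_def by linarith
      have "A * (x * poly (ultraspherical d (Suc j)) x) =
         B * poly (ultraspherical d (Suc (Suc j))) x + (real j + 1) * poly (ultraspherical d j) x" for x
        unfolding A_def B_def poly_ultraspherical_recurrence[OF d] by (simp add: algebra_simps)
      hence "pCons 0 (ultraspherical d k) =
        smult (B / A) (ultraspherical d (Suc (Suc j))) + smult ((real j + 1) / A) (ultraspherical d j)"
        unfolding poly_eq_poly_eq_iff[symmetric] using A unfolding Suc
        by (intro ext) (simp add: field_simps del: ultraspherical.simps)
      also have "P (Suc m) \<dots>" using k Suc by (intro add smult base) (auto simp: A_def B_def)
      finally show ?thesis .
    qed
    moreover have "P (Suc m) (ultraspherical d k)" using k by (intro base) auto
    ultimately show ?thesis using add by simp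
  qed
  have "P m ([:1, 1:] ^ m)"
  proof (induction m)
    case 0
    show ?case using base[of 0 0] by simp
  next
    case (Suc m)
    then obtain b where b: "\<forall>k. b k \<ge> 0" "[:1, 1:] ^ m = (\<Sum>k\<le>m. smult (b k) (ultraspherical d k))" unfolding P_def by blast
    have "[:1, 1:] ^ Suc m = (\<Sum>k\<le>m. smult (b k) ([:1, 1:] * ultraspherical d k))"
      unfolding power_Suc b(2) sum_distrib_left by (simp only: mult_smult_right)
    also have "P (Suc m) \<dots>" using b(1) by (intro sum smult mult) auto
    finally show ?case .
  qed
  thus ?thesis using that unfolding P_def by blast
qed

text \<open>The two relations need each other in the induction. The second at n + 1 is the first at
  n rewritten by the recurrence; the first at n + 1 comes from the differentiated recurrence, in
  which both relations at n eliminate the derivatives.\<close>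

lemma pderiv_ultraspherical:
  assumes d: "d \<ge> 1"
  shows "(1 - x\<^sup>2) * poly (pderiv (ultraspherical d (Suc n))) x =
    (real n + 1) * (poly (ultraspherical d n) x - x * poly (ultraspherical d (Suc n)) x)"
    and "(1 - x\<^sup>2) * poly (pderiv (ultraspherical d n)) x =
    (real n + real d - 1) * (x * poly (ultraspherical d n) x - poly (ultraspherical d (Suc n)) x)"
proof -
  define y z where "y = (\<lambda>n. poly (ultraspherical d n) x)" and "z = (\<lambda>n. poly (pderiv (ultraspherical d n)) x)"
  have rec: "(real n + real d) * y (Suc (Suc n)) = (2 * real n + real d + 1) * x * y (Suc n) - (real n + 1) * y n" for n
    unfolding y_def by (rule poly_ultraspherical_recurrence[OF d])
  have rec': "(real n + real d) * z (Suc (Suc n)) =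
     (2 * real n + real d + 1) * (y (Suc n) + x * z (Suc n)) - (real n + 1) * z n" for n
  proof -
    define D where "D = real n + real d"
    have "D \<noteq> 0" using d by (simp add: D_def)
    thus ?thesis unfolding y_def z_def ultraspherical.simps D_def[symmetric]
      by (simp add: pderiv_diff pderiv_smult pderiv_pCons field_simps)
  qed
  have "(1 - x\<^sup>2) * z (Suc n) = (real n + 1) * (y n - x * y (Suc n)) \<and>
     (1 - x\<^sup>2) * z n = (real n + real d - 1) * (x * y n - y (Suc n))" for n
  proof (induction n)
    case 0
    show ?case by (simp add: y_def z_def power2_eq_square pderiv_pCons)
  next
    case (Suc n)
    have b: "(1 - x\<^sup>2) * z (Suc n) = (real (Suc n) + real d - 1) * (x * y (Suc n) - y (Suc (Suc n)))"
      using Suc rec[of n] by (simp add: algebra_simps)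
    have "(real n + real d) * ((1 - x\<^sup>2) * z (Suc (Suc n))) = (1 - x\<^sup>2) * ((real n + real d) * z (Suc (Suc n)))"
      by simp
    also have "\<dots> = (2 * real n + real d + 1) * ((1 - x\<^sup>2) * y (Suc n) + x * ((1 - x\<^sup>2) * z (Suc n)))
       - (real n + 1) * ((1 - x\<^sup>2) * z n)" unfolding rec' by (simp add: algebra_simps)
    also have "\<dots> = (2 * real n + real d + 1) * ((1 - x\<^sup>2) * y (Suc n) + x * ((real n + 1) * (y n - x * y (Suc n))))
       - (real n + 1) * ((real n + real d - 1) * (x * y n - y (Suc n)))" using Suc by simp
    also have "\<dots> = (real n + 2) * ((real n + real d) * y (Suc n) - x * ((2 * real n + real d + 1) * x * y (Suc n) - (real n + 1) * y n))"
      by (simp add: algebra_simps power2_eq_square)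
    also have "\<dots> = (real n + real d) * ((real n + 2) * (y (Suc n) - x * y (Suc (Suc n))))"
      unfolding rec[symmetric] by (simp add: algebra_simps)
    finally have "(real n + real d) * ((1 - x\<^sup>2) * z (Suc (Suc n))) = (real n + real d) * ((real n + 2) * (y (Suc n) - x * y (Suc (Suc n))))" .
    moreover have "real n + real d \<noteq> 0" using d by linarith
    ultimately show ?case using b by simp
  qed
  from this[of n] show "(1 - x\<^sup>2) * poly (pderiv (ultraspherical d (Suc n))) x =
    (real n + 1) * (poly (ultraspherical d n) x - x * poly (ultraspherical d (Suc n)) x)"
    "(1 - x\<^sup>2) * poly (pderiv (ultraspherical d n)) x =
    (real n + real d - 1) * (x * poly (ultraspherical d n) x - poly (ultraspherical d (Suc n)) x)"
    unfolding y_def z_def by blast+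
qed

lemma ultraspherical_ODE:
  assumes d: "d \<ge> 1"
  shows "(1 - x\<^sup>2) * poly (pderiv (pderiv (ultraspherical d n))) x =
    real d * x * poly (pderiv (ultraspherical d n)) x
    - real n * (real n + real d - 1) * poly (ultraspherical d n) x"
proof (cases n)
  case 0
  thus ?thesis by simp
next
  case (Suc m)
  define p q where "p = ultraspherical d (Suc m)" and "q = ultraspherical d m"
  define k where "k = real m + 1"
  have 1: "[:1, 0, -1:] * pderiv p = smult k (q - pCons 0 p)"
    unfolding poly_eq_poly_eq_iff[symmetric] using pderiv_ultraspherical(1)[OF d, of _ m]
    by (intro ext) (simp add: p_def q_def k_def power2_eq_square algebra_simps del: ultraspherical.simps)
  have 2: "[:1, 0, -1:] * pderiv q = smult (k + real d - 2) (pCons 0 q - p)"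
    unfolding poly_eq_poly_eq_iff[symmetric] using pderiv_ultraspherical(2)[OF d, of _ m]
    by (intro ext) (simp add: p_def q_def k_def power2_eq_square algebra_simps del: ultraspherical.simps)
  have "pderiv ([:1, 0, -1:] * pderiv p) = pderiv (smult k (q - pCons 0 p))" by (simp only: 1)
  hence 3: "[:1, 0, -1:] * pderiv (pderiv p) + pderiv p * [:0, -2:] = smult k (pderiv q - (p + pCons 0 (pderiv p)))"
    by (simp only: pderiv_mult pderiv_smult pderiv_diff pderiv_pCons) (simp add: pderiv_pCons)
  have p1: "(1 - y\<^sup>2) * poly (pderiv p) y = k * (poly q y - y * poly p y)" for y
    using arg_cong[OF 1, of "\<lambda>r. poly r y"] by (simp add: power2_eq_square algebra_simps)
  have p2: "(1 - y\<^sup>2) * poly (pderiv q) y = (k + real d - 2) * (y * poly q y - poly p y)" for y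
    using arg_cong[OF 2, of "\<lambda>r. poly r y"] by (simp add: power2_eq_square algebra_simps)
  have p3: "(1 - y\<^sup>2) * poly (pderiv (pderiv p)) y = 2 * y * poly (pderiv p) y + k * (poly (pderiv q) y - poly p y - y * poly (pderiv p) y)" for y
    using arg_cong[OF 3, of "\<lambda>r. poly r y"] by (simp add: power2_eq_square algebra_simps)
  \<comment> \<open>\<open>r\<close> is the defect of the differential equation. Multiplied by 1 -
    y^2 it can be evaluated, since \<open>p1\<close> and \<open>p2\<close> then remove all
    derivatives. The factor is cancelled among polynomials, so the equation also holds at the
    endpoints.\<close>
  define r where "r = [:1, 0, -1:] * pderiv (pderiv p) - (smult (real d) (pCons 0 (pderiv p)) - smult (k * (k + real d - 1)) p)"
  have "[:1, 0, -1:] * r = 0"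
  proof -
    have "(1 - y\<^sup>2) * poly r y = 0" for y
    proof -
      have "(1 - y\<^sup>2) * poly r y = (1 - y\<^sup>2) * ((1 - y\<^sup>2) * poly (pderiv (pderiv p)) y)
         - real d * y * ((1 - y\<^sup>2) * poly (pderiv p) y) + k * (k + real d - 1) * (1 - y\<^sup>2) * poly p y"
        by (simp add: r_def power2_eq_square algebra_simps)
      also have "(1 - y\<^sup>2) * ((1 - y\<^sup>2) * poly (pderiv (pderiv p)) y) =
        2 * y * ((1 - y\<^sup>2) * poly (pderiv p) y) + k * ((1 - y\<^sup>2) * poly (pderiv q) y - (1 - y\<^sup>2) * poly p y - y * ((1 - y\<^sup>2) * poly (pderiv p) y))"
        unfolding p3 by (simp add: algebra_simps)
      finally show ?thesis unfolding p1 p2 by (simp add: algebra_simps power2_eq_square)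
    qed
    thus ?thesis unfolding poly_eq_poly_eq_iff[symmetric] by (intro ext) (simp add: power2_eq_square algebra_simps)
  qed
  hence "r = 0" by (metis mult_eq_0_iff pCons_eq_0_iff zero_neq_one)
  hence "poly r x = 0" by simp
  thus ?thesis unfolding Suc p_def[symmetric]
    by (simp add: r_def k_def p_def[symmetric] power2_eq_square algebra_simps)
qed

section \<open>Identification with the Gegenbauer and Chebyshev polynomials\<close>

lemma gegenbauer_0: "gegenbauer \<alpha> 0 x = 1"
  by (simp add: gegenbauer_def fps_compose_nth)

text \<open>The generating function G = (1 + H)^(-\<alpha>) with H = -2 x X + X^2 satisfies (1 + H)
  G' = -\<alpha> H' G; both claims compare coefficients in this equation.\<close>

lemma gegenbauer_ODE_coeffs:
  shows "gegenbauer \<alpha> 1 x = 2 * \<alpha> * x"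
    and "(real n + 2) * gegenbauer \<alpha> (Suc (Suc n)) x =
      2 * (real n + 1 + \<alpha>) * x * gegenbauer \<alpha> (Suc n) x - (real n + 2 * \<alpha>) * gegenbauer \<alpha> n x"
proof -
  define H :: "real fps" where "H = fps_const (- 2 * x) * fps_X + fps_X ^ 2"
  define B where "B = fps_binomial (- \<alpha>)"
  define G where "G = fps_compose B H"
  have H0: "fps_nth H 0 = 0" by (simp add: H_def)
  have "fps_deriv B = fps_const (- \<alpha>) * B / (1 + fps_X)"
    using fps_binomial_ODE_unique'[of B "-\<alpha>"] by (simp add: B_def)
  hence "(1 + fps_X) * fps_deriv B = fps_const (- \<alpha>) * B"
    using inverse_mult_eq_1'[of "1 + fps_X :: real fps"]
    by (simp add: fps_divide_unit mult.left_commute[of "1 + fps_X"])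
  hence "fps_compose ((1 + fps_X) * fps_deriv B) H = fps_compose (fps_const (- \<alpha>) * B) H"
    by (rule arg_cong)
  hence 1: "(1 + H) * fps_compose (fps_deriv B) H = fps_const (- \<alpha>) * G"
    by (simp add: fps_compose_mult_distrib[OF H0] fps_compose_add_distrib H0 G_def)
  have H': "fps_deriv H = fps_const (- 2 * x) + 2 * fps_X"
    by (simp add: H_def fps_deriv_power)
  have *: "(1 + H) * fps_deriv G = fps_const (- \<alpha>) * G * (fps_const (- 2 * x) + 2 * fps_X)"
    unfolding G_def fps_compose_deriv[OF H0] H'[symmetric] by (simp only: 1[unfolded G_def] mult.assoc[symmetric])
  have c1: "fps_const (2 * \<alpha> * x) = fps_const (- \<alpha>) * fps_const (- 2 * x)" by simp
  have c2: "fps_const (- 2 * \<alpha>) = fps_const (- \<alpha>) * 2" by (simp add: numeral_fps_const)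
  from * have eq: "fps_deriv G + fps_const (- 2 * x) * (fps_X * fps_deriv G) + fps_X ^ 2 * fps_deriv G =
     fps_const (2 * \<alpha> * x) * G + fps_const (- 2 * \<alpha>) * (fps_X * G)"
    unfolding c1 c2 by (simp add: H_def algebra_simps del: fps_const_mult)
  have G: "gegenbauer \<alpha> n x = fps_nth G n" for n by (simp add: gegenbauer_def G_def B_def H_def)
  show "gegenbauer \<alpha> 1 x = 2 * \<alpha> * x"
    using arg_cong[OF eq, of "\<lambda>F. fps_nth F 0"] gegenbauer_0[of \<alpha> x]
    by (simp add: G fps_X_power_mult_nth power2_eq_square mult.assoc)
  show "(real n + 2) * gegenbauer \<alpha> (Suc (Suc n)) x =
      2 * (real n + 1 + \<alpha>) * x * gegenbauer \<alpha> (Suc n) x - (real n + 2 * \<alpha>) * gegenbauer \<alpha> n x"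
    using arg_cong[OF eq, of "\<lambda>F. fps_nth F (Suc n)"]
    by (cases n) (simp_all add: G fps_X_power_mult_nth fps_X_power_mult_right_nth algebra_simps)
qed

text \<open>At x = 1 the generating function is (1 - r)^(-2\<alpha>), whose binomial coefficients
  have this ratio.\<close>

lemma gegenbauer_1_Suc:
  "(real n + 1) * gegenbauer \<alpha> (Suc n) 1 = (real n + 2 * \<alpha>) * gegenbauer \<alpha> n 1"
proof (induction n)
  case 0
  show ?case using gegenbauer_ODE_coeffs(1)[of \<alpha> 1] by (simp add: gegenbauer_0)
next
  case (Suc n)
  thus ?case using gegenbauer_ODE_coeffs(2)[of n \<alpha> 1] by (simp add: algebra_simps)
qed

lemma gegenbauer_1_pos:
  assumes "\<alpha> > 0"
  shows "gegenbauer \<alpha> n 1 > 0"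
proof (induction n)
  case (Suc n)
  have "(real n + 1) * gegenbauer \<alpha> (Suc n) 1 > 0"
    unfolding gegenbauer_1_Suc using assms Suc by (intro mult_pos_pos) auto
  thus ?case by (simp add: zero_less_mult_iff)
qed (simp add: gegenbauer_0)

text \<open>Both sides have the same first two values and obey the same recurrence: for d = 1 by the
  addition theorem of the cosine, for larger d because \<open>gegenbauer_1_Suc\<close> supplies the
  ratios of the normalizing values.\<close>

lemma normalized_gegenbauer_eq_poly:
  assumes d: "d \<ge> 1" and x: "x \<in> {-1..1}"
  shows "normalized_gegenbauer d n x = poly (ultraspherical d n) x"
proof -
  have "normalized_gegenbauer d n x = poly (ultraspherical d n) x \<and>
    normalized_gegenbauer d (Suc n) x = poly (ultraspherical d (Suc n)) x"
  proof (induction n)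
    case 0
    show ?case
    proof (cases "d = 1")
      case True
      thus ?thesis using x by (simp add: normalized_gegenbauer_def)
    next
      case False
      have "gegenbauer a (Suc 0) y = 2 * a * y" for a y
        using gegenbauer_ODE_coeffs(1)[of a y] by simp
      thus ?thesis using False d by (simp add: normalized_gegenbauer_def gegenbauer_0)
    qed
  next
    case (Suc n)
    have "(real n + real d) * normalized_gegenbauer d (Suc (Suc n)) x =
      (2 * real n + real d + 1) * x * normalized_gegenbauer d (Suc n) x -
      (real n + 1) * normalized_gegenbauer d n x"
    proof (cases "d = 1")
      case True
      define t where "t = arccos x"
      have "cos (real (Suc (Suc n)) * t) + cos (real n * t) = 2 * cos t * cos (real (Suc n) * t)"
        using cos_add[of "real (Suc n) * t" t] cos_diff[of "real (Suc n) * t" t] by (simp add: algebra_simps)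
      moreover have "cos t = x" using x by (simp add: t_def)
      ultimately have "cos (real (Suc (Suc n)) * t) = 2 * x * cos (real (Suc n) * t) - cos (real n * t)" by simp
      hence "(real n + 1) * cos (real (Suc (Suc n)) * t) = (real n + 1) * (2 * x * cos (real (Suc n) * t) - cos (real n * t))" by simp
      thus ?thesis using True by (simp add: normalized_gegenbauer_def t_def[symmetric] algebra_simps)
    next
      case False
      define a where "a = (real d - 1) / 2"
      have a: "a > 0" "real d = 2 * a + 1" using False d by (auto simp: a_def field_simps)
      define e where "e = gegenbauer a n 1"
      have e: "e > 0" using a(1) by (simp add: e_def gegenbauer_1_pos)
      have pos: "real n + 1 > 0" "real n + 2 > 0" "real n + 2 * a > 0" "real n + 1 + 2 * a > 0" using a by auto
      have e1: "gegenbauer a (Suc n) 1 = (real n + 2 * a) / (real n + 1) * e"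
        using gegenbauer_1_Suc[of n a] pos by (simp add: e_def field_simps)
      have e2: "gegenbauer a (Suc (Suc n)) 1 = (real n + 1 + 2 * a) / (real n + 2) * ((real n + 2 * a) / (real n + 1) * e)"
      proof -
        have "gegenbauer a (Suc (Suc n)) 1 = (real n + 1 + 2 * a) * gegenbauer a (Suc n) 1 / (real n + 2)"
          using gegenbauer_1_Suc[of "Suc n" a] pos by (simp add: field_simps)
        thus ?thesis unfolding e1 by simp
      qed
      have r: "gegenbauer a (Suc (Suc n)) x = (2 * (real n + 1 + a) * x * gegenbauer a (Suc n) x - (real n + 2 * a) * gegenbauer a n x) / (real n + 2)"
        using gegenbauer_ODE_coeffs(2)[of n a x] pos by (simp add: field_simps)
      define g0 g1 where "g0 = gegenbauer a n x" and "g1 = gegenbauer a (Suc n) x"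
      have "(real n + (2 * a + 1)) * (((2 * (real n + 1 + a) * x * g1 - (real n + 2 * a) * g0) / (real n + 2)) /
          ((real n + 1 + 2 * a) / (real n + 2) * ((real n + 2 * a) / (real n + 1) * e))) =
          (2 * (real n + 1 + a) * x * g1 - (real n + 2 * a) * g0) * (real n + 1) / ((real n + 2 * a) * e)"
        using pos e by (simp add: divide_simps)
      also have "\<dots> = (2 * real n + (2 * a + 1) + 1) * x * (g1 / ((real n + 2 * a) / (real n + 1) * e)) - (real n + 1) * (g0 / e)"
        using pos e by (simp add: divide_simps) (simp add: algebra_simps)
      finally show ?thesis using False unfolding normalized_gegenbauer_def a_def[symmetric] a(2)
        by (simp add: e1 e2 r e_def[symmetric] g0_def g1_def)
    qed
    hence "(real n + real d) * normalized_gegenbauer d (Suc (Suc n)) x = (real n + real d) * poly (ultraspherical d (Suc (Suc n))) x"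
      unfolding poly_ultraspherical_recurrence[OF d] using Suc by simp
    moreover have "real n + real d \<noteq> 0" using d by linarith
    ultimately show ?case using Suc by simp
  qed
  thus ?thesis by blast
qed

section \<open>The ultraspherical weight\<close>

text \<open>Restricting the space, and not only the density, makes pointwise side conditions refer
  to [-1,1] alone, where the bounds on the polynomials hold.\<close>

definition ultraspherical_measure :: "nat \<Rightarrow> real measure" where
  "ultraspherical_measure d =
     density (restrict_space lborel {-1..1}) (\<lambda>x. ennreal ((1 - x\<^sup>2) powr (real d / 2 - 1)))"

lemma space_ultraspherical_measure [simp]: "space (ultraspherical_measure d) = {-1..1}"
  by (simp add: ultraspherical_measure_def)

lemma sets_ultraspherical_measure [simp, measurable_cong]:
  "sets (ultraspherical_measure d) = sets (restrict_space borel {-1..1})"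
  by (simp add: ultraspherical_measure_def sets_restrict_space)

lemma ultraspherical_weight_measurable:
  "(\<lambda>x. (1 - x\<^sup>2) powr (real d / 2 - 1)) \<in> borel_measurable (restrict_space lborel {-1..1})"
  by (intro measurable_restrict_space1) measurable

text \<open>The substitution t = (x + 1)/2 leads to the Beta integral B(d/2, d/2), and Legendre
  duplication turns its Gamma factors into the quotient of sphere areas.\<close>

lemma ultraspherical_weight_has_integral:
  assumes d: "d \<ge> 1"
  shows "((\<lambda>x. (1 - x\<^sup>2) powr (real d / 2 - 1)) has_integral (sphere_area d / sphere_area (d - 1))) {-1..1}"
proof -
  define a where "a = real d / 2"
  have a: "a > 0" using d by (simp add: a_def)
  have "((\<lambda>t. t powr (a - 1) * (1 - t) powr (a - 1)) has_integral Beta a a) (cbox 0 1)"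
    using has_integral_Beta_real[OF a a] by simp
  from has_integral_affinity'[OF this, of "1/2" "1/2"]
  have "((\<lambda>x. ((x + 1) / 2) powr (a - 1) * ((1 - x) / 2) powr (a - 1)) has_integral (2 * Beta a a)) {-1..1}"
    by (simp add: field_simps)
  hence "((\<lambda>x. (1 - x\<^sup>2) powr (a - 1) * (1 / 4) powr (a - 1)) has_integral (2 * Beta a a)) {-1..1}"
  proof (rule has_integral_eq[rotated])
    fix x :: real assume x: "x \<in> {-1..1}"
    have "(1 - x\<^sup>2) = (1 + x) * (1 - x)" by (simp add: power2_eq_square algebra_simps)
    moreover have "((x + 1) / 2) powr (a - 1) * ((1 - x) / 2) powr (a - 1) = (((x + 1) / 2) * ((1 - x) / 2)) powr (a - 1)"
      using x by (subst powr_mult) auto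
    moreover have "((x + 1) / 2) * ((1 - x) / 2) = (1 - x\<^sup>2) * (1 / 4)" by (simp add: power2_eq_square field_simps)
    moreover have "((1 - x\<^sup>2) * (1 / 4)) powr (a - 1) = (1 - x\<^sup>2) powr (a - 1) * (1 / 4) powr (a - 1)"
      using x by (intro powr_mult)
    ultimately show "((x + 1) / 2) powr (a - 1) * ((1 - x) / 2) powr (a - 1) = (1 - x\<^sup>2) powr (a - 1) * (1 / 4) powr (a - 1)"
      by metis
  qed
  from has_integral_mult_left[OF this, of "4 powr (a - 1)"]
  have "((\<lambda>x. (1 - x\<^sup>2) powr (a - 1)) has_integral (2 * Beta a a * 4 powr (a - 1))) {-1..1}"
    using powr_mult[of "1 / 4" 4 "a - 1"] by (simp only: mult.assoc) simp
  moreover have "2 * Beta a a * 4 powr (a - 1) = sphere_area d / sphere_area (d - 1)"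
  proof -
    have "complex_of_real a \<notin> \<int>\<^sub>\<le>\<^sub>0" "complex_of_real a + 1 / 2 \<notin> \<int>\<^sub>\<le>\<^sub>0"
    proof -
      have "complex_of_real a + 1 / 2 = complex_of_real (a + 1 / 2)" by simp
      thus "complex_of_real a + 1 / 2 \<notin> \<int>\<^sub>\<le>\<^sub>0" "complex_of_real a \<notin> \<int>\<^sub>\<le>\<^sub>0"
        using a by (auto simp only: of_real_in_nonpos_Ints_iff elim!: nonpos_Ints_cases)
    qed
    from Gamma_legendre_duplication[OF this]
    have "complex_of_real (Gamma a * Gamma (a + 1/2)) =
      exp ((1 - 2 * of_real a) * of_real (ln 2)) * of_real (sqrt pi) * of_real (Gamma (2 * a))"
      by (simp flip: Gamma_complex_of_real)
    also have "\<dots> = complex_of_real (exp ((1 - 2 * a) * ln 2) * sqrt pi * Gamma (2 * a))"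
      by (simp flip: exp_of_real)
    finally have dup: "Gamma a * Gamma (a + 1/2) = exp ((1 - 2 * a) * ln 2) * sqrt pi * Gamma (2 * a)"
      by (simp only: of_real_eq_iff)
    have pos: "Gamma a > 0" "Gamma (a + 1/2) > 0" "Gamma (2 * a) > 0" using a by (auto intro: Gamma_real_pos)
    have "2 * 4 powr (a - 1) = exp ((2 * a - 1) * ln (2 :: real))"
    proof -
      have l4: "ln (4::real) = 2 * ln 2" using ln_realpow[of 2 2] by simp
      have "2 * 4 powr (a - 1) = exp (ln 2) * exp ((a - 1) * ln (4::real))" by (simp add: powr_def)
      also have "\<dots> = exp (ln 2 + (a - 1) * (2 * ln 2))" by (simp only: exp_add l4)
      also have "ln 2 + (a - 1) * (2 * ln 2) = (2 * a - 1) * ln (2 :: real)" by (simp add: algebra_simps)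
      finally show ?thesis .
    qed
    hence "2 * Beta a a * 4 powr (a - 1) = exp ((2 * a - 1) * ln 2) * (Gamma a * Gamma a / Gamma (2 * a))"
      by (simp add: Beta_def)
    also have "\<dots> = exp ((2 * a - 1) * ln 2) * (Gamma a * (exp ((1 - 2 * a) * ln 2) * sqrt pi * Gamma (2 * a))) / (Gamma (2 * a) * Gamma (a + 1/2))"
      unfolding dup[symmetric] using pos by simp
    also have "\<dots> = (exp ((2 * a - 1) * ln 2) * exp ((1 - 2 * a) * ln 2)) * (Gamma a * sqrt pi / Gamma (a + 1/2))"
      using pos by simp
    also have "exp ((2 * a - 1) * ln 2) * exp ((1 - 2 * a) * ln 2) = (1::real)"
      by (simp add: algebra_simps flip: exp_add)
    finally have "2 * Beta a a * 4 powr (a - 1) = Gamma a * sqrt pi / Gamma (a + 1/2)" by simp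
    moreover have "sphere_area d = 2 * (pi powr a * sqrt pi) / Gamma (a + 1/2)"
      by (simp add: sphere_area_def a_def add_divide_distrib powr_add powr_half_sqrt)
    moreover have "sphere_area (d - 1) = 2 * pi powr a / Gamma a"
      using d by (simp add: sphere_area_def a_def of_nat_diff)
    ultimately show ?thesis using pos by simp
  qed
  ultimately show ?thesis by (simp add: a_def)
qed

lemma sphere_area_pos: "sphere_area d > 0"
  by (simp add: sphere_area_def Gamma_real_pos)

lemma emeasure_ultraspherical:
  assumes d: "d \<ge> 1"
  shows "emeasure (ultraspherical_measure d) {-1..1} = ennreal (sphere_area d / sphere_area (d - 1))"
proof -
  have "emeasure (ultraspherical_measure d) {-1..1} =
    (\<integral>\<^sup>+x. ennreal ((1 - x\<^sup>2) powr (real d / 2 - 1)) * indicator {-1..1} x \<partial>restrict_space lborel {-1..1})"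
    unfolding ultraspherical_measure_def
    by (intro emeasure_density) (use ultraspherical_weight_measurable in \<open>auto simp: sets_restrict_space\<close>)
  also have "\<dots> = (\<integral>\<^sup>+x. ennreal ((1 - x\<^sup>2) powr (real d / 2 - 1)) * indicator {-1..1} x \<partial>lborel)"
    by (subst nn_integral_restrict_space) (auto simp: indicator_def intro!: nn_integral_cong)
  also have "\<dots> = ennreal (sphere_area d / sphere_area (d - 1))"
    by (intro nn_integral_has_integral_lebesgue' ultraspherical_weight_has_integral d) auto
  finally show ?thesis .
qed

lemma finite_measure_ultraspherical: "d \<ge> 1 \<Longrightarrow> finite_measure (ultraspherical_measure d)"
  by (intro finite_measureI) (simp add: emeasure_ultraspherical)

lemma measure_ultraspherical:
  "d \<ge> 1 \<Longrightarrow> measure (ultraspherical_measure d) {-1..1} = sphere_area d / sphere_area (d - 1)"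
  using sphere_area_pos[of d] sphere_area_pos[of "d - 1"]
  by (simp add: measure_def emeasure_ultraspherical)

lemma measurable_ultraspherical:
  fixes h :: "real \<Rightarrow> 'b::topological_space"
  assumes "continuous_on {-1..1} h"
  shows "h \<in> borel_measurable (ultraspherical_measure d)"
  using borel_measurable_continuous_on_restrict[OF assms]
  by (simp cong: measurable_cong_sets)

lemma integrable_ultraspherical:
  fixes h :: "real \<Rightarrow> 'b::{banach, second_countable_topology}"
  assumes d: "d \<ge> 1" and h: "continuous_on {-1..1} h"
  shows "integrable (ultraspherical_measure d) h"
proof -
  interpret finite_measure "ultraspherical_measure d" by (rule finite_measure_ultraspherical[OF d])
  have "bounded (h ` {-1..1})" using h by (intro compact_imp_bounded compact_continuous_image) auto
  then obtain B where "\<And>x. x \<in> {-1..1} \<Longrightarrow> norm (h x) \<le> B" unfolding bounded_iff by blast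
  thus ?thesis using measurable_ultraspherical[OF h] by (intro integrable_const_bound[of _ B] AE_I2) auto
qed

lemma integral_ultraspherical:
  fixes h :: "real \<Rightarrow> 'b::{banach, second_countable_topology}"
  assumes h: "continuous_on {-1..1} h"
  shows "integral\<^sup>L (ultraspherical_measure d) h =
    (LINT x:{-1..1}|lborel. (1 - x\<^sup>2) powr (real d / 2 - 1) *\<^sub>R h x)"
proof -
  have "h \<in> borel_measurable (restrict_space lborel {-1..1})"
    using measurable_ultraspherical[OF h, of d] by (simp cong: measurable_cong_sets add: sets_restrict_space)
  hence "integral\<^sup>L (ultraspherical_measure d) h = integral\<^sup>L (restrict_space lborel {-1..1}) (\<lambda>x. (1 - x\<^sup>2) powr (real d / 2 - 1) *\<^sub>R h x)"
    unfolding ultraspherical_measure_def by (intro integral_density ultraspherical_weight_measurable) auto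
  thus ?thesis by (simp add: integral_restrict_space set_lebesgue_integral_def)
qed

text \<open>Makes results about \<open>has_integral\<close> applicable to
  \<open>ultraspherical_measure\<close>: the fundamental theorem of calculus with derivatives only
  in the interior, and the vanishing of a continuous nonnegative function with integral 0.\<close>

lemma integral_ultraspherical_eq_HK:
  fixes h :: "real \<Rightarrow> real"
  assumes d: "d \<ge> 1" and h: "continuous_on {-1..1} h"
    and I: "((\<lambda>x. (1 - x\<^sup>2) powr (real d / 2 - 1) * h x) has_integral I) {-1..1}"
  shows "integral\<^sup>L (ultraspherical_measure d) h = I"
proof -
  have "h \<in> borel_measurable (restrict_space lborel {-1..1})"
    using measurable_ultraspherical[OF h, of d] by (simp cong: measurable_cong_sets add: sets_restrict_space)
  hence "integrable (restrict_space lborel {-1..1}) (\<lambda>x. (1 - x\<^sup>2) powr (real d / 2 - 1) *\<^sub>R h x)"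
    using integrable_ultraspherical[OF d h] unfolding ultraspherical_measure_def
    by (subst (asm) integrable_density) (use ultraspherical_weight_measurable in auto)
  hence "set_integrable lborel {-1..1} (\<lambda>x. (1 - x\<^sup>2) powr (real d / 2 - 1) *\<^sub>R h x)"
    by (simp add: integrable_restrict_space set_integrable_def)
  from set_borel_integral_eq_integral(2)[OF this] show ?thesis
    using I unfolding integral_ultraspherical[OF h] by (simp add: integral_unique)
qed

section \<open>Integration by parts, orthogonality and norms\<close>

lemma continuous_on_poly_real [continuous_intros]:
  fixes p :: "real poly"
  shows "continuous_on A (poly p)"
  by (intro continuous_at_imp_continuous_on ballI poly_isCont)

text \<open>Up to the weight, the integrand is the derivative of p(x) (1 - x^2)^(d/2), which
  vanishes at both endpoints. Orthogonality, the moments of the weight and the concentration of the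
  kernels (1 + x)^m all follow from this for suitable p.\<close>

lemma ultraspherical_integration_by_parts:
  assumes d: "d \<ge> 1"
  shows "integral\<^sup>L (ultraspherical_measure d) (poly (pderiv p * [:1, 0, -1:] - smult (real d) (pCons 0 p))) = 0"
proof (rule integral_ultraspherical_eq_HK[OF d])
  define F where "F = (\<lambda>x. poly p x * (1 - x\<^sup>2) powr (real d / 2))"
  define F' where "F' = (\<lambda>x. (1 - x\<^sup>2) powr (real d / 2 - 1) * poly (pderiv p * [:1, 0, -1:] - smult (real d) (pCons 0 p)) x)"
  have pos: "1 - x\<^sup>2 > 0" if "x \<in> {-1<..<1}" for x :: real
    using that by (simp add: abs_square_less_1 abs_less_iff)
  \<comment> \<open>For d = 1 the factor (1 - x^2)^(1/2) is not differentiable at the endpoints, so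
    continuity there has to suffice.\<close>
  have "(F' has_integral (F 1 - F (-1))) {-1..1}"
  proof (rule fundamental_theorem_of_calculus_interior)
    show "continuous_on {-1..1} F" unfolding F_def
      using d by (intro continuous_intros continuous_on_powr') (auto simp: abs_square_le_1 abs_le_iff)
    fix x :: real assume x: "x \<in> {-1<..<1}"
    have "(1 - x\<^sup>2) powr (real d / 2) = (1 - x\<^sup>2) * (1 - x\<^sup>2) powr (real d / 2 - 1)"
      using pos[OF x] by (simp add: powr_diff)
    note split = this
    have "poly (pderiv p) x * (1 - x\<^sup>2) powr (real d / 2) - poly p x * (2 * x * (real d / 2) * (1 - x\<^sup>2) powr (real d / 2 - 1)) = F' x"
      unfolding F'_def split by (simp add: power2_eq_square algebra_simps)
    moreover have "(F has_real_derivative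
       (poly (pderiv p) x * (1 - x\<^sup>2) powr (real d / 2) - poly p x * (2 * x * (real d / 2) * (1 - x\<^sup>2) powr (real d / 2 - 1)))) (at x)"
      unfolding F_def using pos[OF x]
      by (auto intro!: derivative_eq_intros simp: algebra_simps powr_diff power2_eq_square divide_simps)
    ultimately show "(F has_vector_derivative F' x) (at x)"
      by (simp add: has_real_derivative_iff_has_vector_derivative)
  qed auto
  thus "((\<lambda>x. (1 - x\<^sup>2) powr (real d / 2 - 1) * poly (pderiv p * [:1, 0, -1:] - smult (real d) (pCons 0 p)) x) has_integral 0) {-1..1}"
    by (simp add: F_def F'_def)
qed (intro continuous_intros)

lemma poly_fun_simps:
  fixes p q :: "'a::comm_ring_1 poly"
  shows "poly (p + q) = (\<lambda>x. poly p x + poly q x)" "poly (p - q) = (\<lambda>x. poly p x - poly q x)"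
    "poly (smult c p) = (\<lambda>x. c * poly p x)" "poly (p * q) = (\<lambda>x. poly p x * poly q x)"
    "poly (1 :: 'a poly) = (\<lambda>x. 1)"
  by auto

lemma integrable_ultraspherical_poly [simp]:
  "d \<ge> 1 \<Longrightarrow> integrable (ultraspherical_measure d) (poly p)"
  by (intro integrable_ultraspherical continuous_intros)

text \<open>The Sturm-Liouville argument: integration by parts is applied to the Wronskian
  \<open>r\<close>, and the differential equations leave the difference of the eigenvalues n (n + d
  - 1) times p q.\<close>

lemma ultraspherical_orthogonal:
  assumes d: "d \<ge> 1" and mn: "m \<noteq> n"
  shows "(\<integral>x. poly (ultraspherical d m) x * poly (ultraspherical d n) x \<partial>ultraspherical_measure d) = 0"
proof -
  define p q where "p = ultraspherical d m" and "q = ultraspherical d n"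
  define l where "l = (\<lambda>n. real n * (real n + real d - 1))"
  define r where "r = q * pderiv p - p * pderiv q"
  have "pderiv r * [:1, 0, -1:] - smult (real d) (pCons 0 r) = smult (l n - l m) (p * q)"
  proof -
    have "poly (pderiv r * [:1, 0, -1:] - smult (real d) (pCons 0 r)) x = poly (smult (l n - l m) (p * q)) x" for x
    proof -
      have "poly (pderiv r * [:1, 0, -1:] - smult (real d) (pCons 0 r)) x =
        poly q x * ((1 - x\<^sup>2) * poly (pderiv (pderiv p)) x - real d * x * poly (pderiv p) x) -
        poly p x * ((1 - x\<^sup>2) * poly (pderiv (pderiv q)) x - real d * x * poly (pderiv q) x)"
        by (simp add: r_def pderiv_diff pderiv_mult power2_eq_square algebra_simps)
      also have "\<dots> = poly (smult (l n - l m) (p * q)) x"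
        unfolding p_def q_def ultraspherical_ODE[OF d] by (simp add: l_def algebra_simps)
      finally show ?thesis .
    qed
    thus ?thesis unfolding poly_eq_poly_eq_iff[symmetric] by auto
  qed
  with ultraspherical_integration_by_parts[OF d, of r]
  have "(l n - l m) * (\<integral>x. poly p x * poly q x \<partial>ultraspherical_measure d) = 0"
    by (simp only: poly_fun_simps integral_mult_right_zero)
  moreover have "l n \<noteq> l m"
  proof -
    have "l n - l m = (real n - real m) * (real n + real m + real d - 1)" by (simp add: l_def algebra_simps)
    moreover have "real n + real m + real d - 1 \<noteq> 0" using mn d by linarith
    ultimately show ?thesis using mn by auto
  qed
  ultimately show ?thesis by (simp add: p_def q_def)
qed

lemma ultraspherical_orthogonal_poly:
  assumes d: "d \<ge> 1" and p: "degree p < n"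
  shows "(\<integral>x. poly p x * poly (ultraspherical d n) x \<partial>ultraspherical_measure d) = 0"
proof -
  obtain b where b: "p = (\<Sum>k\<le>degree p. smult (b k) (ultraspherical d k))"
    using ultraspherical_basis[OF d, of p "degree p"] by blast
  have "(\<integral>x. poly p x * poly (ultraspherical d n) x \<partial>ultraspherical_measure d) =
    (\<integral>x. (\<Sum>k\<le>degree p. b k * (poly (ultraspherical d k) x * poly (ultraspherical d n) x)) \<partial>ultraspherical_measure d)"
    by (subst b) (simp add: poly_sum sum_distrib_right mult.assoc)
  also have "\<dots> = (\<Sum>k\<le>degree p. b k * (\<integral>x. poly (ultraspherical d k) x * poly (ultraspherical d n) x \<partial>ultraspherical_measure d))"
    using integrable_ultraspherical_poly[OF d, of "ultraspherical d _ * ultraspherical d n"]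
    by (subst Bochner_Integration.integral_sum) (auto simp: poly_fun_simps)
  also have "\<dots> = 0" using p by (intro sum.neutral) (auto simp: ultraspherical_orthogonal[OF d])
  finally show ?thesis .
qed

lemma harmonic_dim_pos: "d \<ge> 1 \<Longrightarrow> harmonic_dim d n > 0"
  by (auto simp: harmonic_dim_def pochhammer_pos)

text \<open>The closed form with \<open>pochhammer\<close> begins at index 1, hence the shift; the
  passage from 0 to 1 is made in \<open>ultraspherical_norm\<close>.\<close>

lemma harmonic_dim_Suc_Suc:
  assumes d: "d \<ge> 1"
  shows "harmonic_dim d (Suc (Suc n)) * (real n + 2) * (2 * real n + real d + 1) =
     harmonic_dim d (Suc n) * (real n + real d) * (2 * real n + real d + 3)"
proof -
  have "pochhammer (real d) (Suc n) = pochhammer (real d) n * (real d + real n)"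
    by (simp add: pochhammer_Suc)
  moreover have "fact (Suc (Suc n)) = (real n + 2) * (fact (Suc n) :: real)" by (simp add: algebra_simps)
  ultimately show ?thesis unfolding harmonic_dim_def by (simp add: divide_simps) (simp add: algebra_simps)
qed

text \<open>The integral of x c_(n+1) c_n is evaluated in two ways, by multiplying the recurrence
  with its lowest term (\<open>A\<close>) and with its highest term (\<open>B\<close>). Comparison
  gives the ratio of successive squared norms, which is the inverse of the ratio in
  \<open>harmonic_dim_Suc_Suc\<close>.\<close>

lemma ultraspherical_norm:
  assumes d: "d \<ge> 1"
  shows "(\<integral>x. poly (ultraspherical d n) x * poly (ultraspherical d n) x \<partial>ultraspherical_measure d) * harmonic_dim d n
     = sphere_area d / sphere_area (d - 1)"
proof -
  define u where "u = ultraspherical d"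
  define L where "L = (\<lambda>p. integral\<^sup>L (ultraspherical_measure d) (poly p))"
  define h where "h = (\<lambda>n. L (u n * u n))"
  have int: "integrable (ultraspherical_measure d) (poly p)" for p using d by simp
  have L_diff: "L (p - q) = L p - L q" and L_smult: "L (smult c p) = c * L p" for p q c
    using int[of p] int[of q] unfolding L_def poly_fun_simps by auto
  have L_pCons: "L (pCons 0 (smult c p)) = c * L (pCons 0 p)" for c p
    using L_smult[of c "pCons 0 p"] by simp
  have orth: "L (u m * u n) = 0" if "m \<noteq> n" for m n
    using ultraspherical_orthogonal[OF d that] by (simp only: L_def u_def poly_fun_simps)
  have rec: "smult (real n + real d) (u (Suc (Suc n))) = smult (2 * real n + real d + 1) (pCons 0 (u (Suc n))) - smult (real n + 1) (u n)" for n
    unfolding poly_eq_poly_eq_iff[symmetric] u_def using poly_ultraspherical_recurrence[OF d, of n]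
    by (intro ext) (simp add: algebra_simps del: ultraspherical.simps)
  have A: "(2 * real n + real d + 1) * L (pCons 0 (u (Suc n) * u n)) = (real n + 1) * h n" for n
  proof -
    have "smult (real n + real d) (u (Suc (Suc n)) * u n) = smult (2 * real n + real d + 1) (pCons 0 (u (Suc n) * u n)) - smult (real n + 1) (u n * u n)"
      using arg_cong[OF rec[of n], of "\<lambda>p. p * u n"] by (simp add: algebra_simps)
    from arg_cong[OF this, of L] show ?thesis by (simp add: L_diff L_smult L_pCons orth h_def)
  qed
  have B: "(real n + real d) * h (Suc (Suc n)) = (2 * real n + real d + 1) * L (pCons 0 (u (Suc (Suc n)) * u (Suc n)))" for n
  proof -
    have "smult (real n + real d) (u (Suc (Suc n)) * u (Suc (Suc n))) = smult (2 * real n + real d + 1) (pCons 0 (u (Suc (Suc n)) * u (Suc n))) - smult (real n + 1) (u n * u (Suc (Suc n)))"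
      using arg_cong[OF rec[of n], of "\<lambda>p. p * u (Suc (Suc n))"] by (simp add: algebra_simps)
    from arg_cong[OF this, of L] show ?thesis by (simp add: L_diff L_smult L_pCons orth h_def)
  qed
  have h0: "h 0 = sphere_area d / sphere_area (d - 1)"
    using measure_ultraspherical[OF d] by (simp add: h_def L_def u_def poly_fun_simps)
  have h1: "h 1 * (real d + 1) = h 0"
    using A[of 0] by (simp add: h_def u_def mult.commute)
  have "h (Suc n) * harmonic_dim d (Suc n) = h 0" for n
  proof (induction n)
    case 0
    thus ?case using h1 by (simp add: harmonic_dim_def algebra_simps)
  next
    case (Suc n)
    define D E H1 H2 where "D = 2 * real n + real d + 1" and "E = real n + real d"
      and "H1 = harmonic_dim d (Suc n)" and "H2 = harmonic_dim d (Suc (Suc n))"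
    have D: "D \<noteq> 0" "E \<noteq> 0" "D + 2 \<noteq> 0" using d by (auto simp: D_def E_def)
    define M where "M = L (pCons 0 (u (Suc (Suc n)) * u (Suc n)))"
    have 1: "(D + 2) * M = (real n + 2) * h (Suc n)" using A[of "Suc n"] by (simp add: D_def M_def algebra_simps)
    have 2: "E * h (Suc (Suc n)) = D * M" using B[of n] by (simp add: D_def E_def M_def)
    have 3: "H2 * (real n + 2) * D = H1 * E * (D + 2)"
      using harmonic_dim_Suc_Suc[OF d, of n] by (simp add: H1_def H2_def D_def E_def algebra_simps)
    have "(E * (D + 2)) * (h (Suc (Suc n)) * H2) = (E * h (Suc (Suc n))) * (D + 2) * H2" by simp
    also have "\<dots> = D * H2 * ((D + 2) * M)" unfolding 2 by simp
    also have "\<dots> = (H2 * (real n + 2) * D) * h (Suc n)" unfolding 1 by simp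
    also have "\<dots> = (E * (D + 2)) * (h (Suc n) * H1)" unfolding 3 by simp
    finally have "h (Suc (Suc n)) * H2 = h (Suc n) * H1" using D by (simp only: mult_cancel_left) auto
    thus ?case using Suc by (simp add: H1_def H2_def)
  qed
  moreover have "h 0 * harmonic_dim d 0 = h 0" by (simp add: harmonic_dim_def)
  ultimately have "h n * harmonic_dim d n = h 0" by (cases n) auto
  thus ?thesis unfolding h0 by (simp add: h_def L_def u_def poly_fun_simps)
qed

section \<open>The rotation invariant measure on the sphere\<close>

text \<open>Both sides of the identity, multiplied by the measure of the unit ball $B$, arise from
  evaluating $\int\!\int 1_A(Tx)\, 1_B(y - Tx)\,dx\,dy$ in the two orders.\<close>

lemma emeasure_lborel_orthogonal_vimage:
  fixes T :: "'a::euclidean_space \<Rightarrow> 'a"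
  assumes T: "orthogonal_transformation T" and A [measurable]: "A \<in> sets borel"
  shows "emeasure lborel (T -` A) = emeasure lborel A"
proof -
  \<comment> \<open>The ball is invariant under -T and has finite positive measure, so it cancels at
    the end.\<close>
  define B :: "'a set" where "B = ball 0 1"
  have [measurable]: "B \<in> sets borel" by (simp add: B_def)
  have lin: "linear T" using T by (rule orthogonal_transformation_linear)
  have [measurable]: "T \<in> borel_measurable borel"
    by (intro borel_measurable_continuous_onI linear_continuous_on linear_conv_bounded_linear[THEN iffD1] lin)
  have [measurable]: "T -` A \<in> sets borel" by (rule measurable_sets_borel) measurable
  obtain S where TS: "\<And>y. T (S y) = y" using orthogonal_transformation_surj[OF T] by (metis surj_def)
  have B1: "emeasure lborel ((\<lambda>y. y - c) -` B) = emeasure lborel B" for c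
  proof -
    have "emeasure lborel B = emeasure (distr lborel borel ((+) (-c))) B" by (simp add: lborel_distr_plus)
    also have "\<dots> = emeasure lborel ((\<lambda>y. y - c) -` B)" by (subst emeasure_distr) (auto intro!: arg_cong[of _ _ "emeasure lborel"])
    finally show ?thesis ..
  qed
  have "(\<integral>\<^sup>+x. (\<integral>\<^sup>+y. indicator A (T x) * indicator B (y - T x) \<partial>lborel) \<partial>lborel) =
    (\<integral>\<^sup>+x. indicator (T -` A) x * emeasure lborel B \<partial>lborel)"
  proof (rule nn_integral_cong)
    fix x
    have "(\<integral>\<^sup>+y. indicator A (T x) * indicator B (y - T x) \<partial>lborel) =
      (\<integral>\<^sup>+y. indicator A (T x) * indicator ((\<lambda>y. y - T x) -` B) y \<partial>lborel)" by (simp add: indicator_def)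
    also have "\<dots> = indicator (T -` A) x * emeasure lborel B"
      by (subst nn_integral_cmult_indicator) (auto simp: B1 indicator_def intro!: measurable_sets_borel[of _ borel])
    finally show "(\<integral>\<^sup>+y. indicator A (T x) * indicator B (y - T x) \<partial>lborel) = indicator (T -` A) x * emeasure lborel B" .
  qed
  also have "\<dots> = emeasure lborel (T -` A) * emeasure lborel B"
    by (subst nn_integral_multc) (simp_all add: nn_integral_indicator)
  finally have 1: "(\<integral>\<^sup>+x. (\<integral>\<^sup>+y. indicator A (T x) * indicator B (y - T x) \<partial>lborel) \<partial>lborel) =
    emeasure lborel (T -` A) * emeasure lborel B" .
  have "(\<integral>\<^sup>+x. (\<integral>\<^sup>+y. indicator A (T x) * indicator B (y - T x) \<partial>lborel) \<partial>lborel) =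
     (\<integral>\<^sup>+y. (\<integral>\<^sup>+x. indicator A (T x) * indicator B (y - T x) \<partial>lborel) \<partial>lborel)"
    by (rule lborel_pair.Fubini'[symmetric]) measurable
  \<comment> \<open>Translating x by a preimage of y under T moves y from the argument of the second
    indicator into that of the first.\<close>
  also have "\<dots> = (\<integral>\<^sup>+y. (\<integral>\<^sup>+x. indicator A (T x + y) * indicator B (- T x) \<partial>lborel) \<partial>lborel)"
  proof (rule nn_integral_cong)
    fix y
    have "(\<integral>\<^sup>+x. indicator A (T x) * indicator B (y - T x) \<partial>lborel) =
      (\<integral>\<^sup>+x. indicator A (T x) * indicator B (y - T x) \<partial>distr lborel borel ((+) (S y)))"
      by (simp only: lborel_distr_plus)
    also have "\<dots> = (\<integral>\<^sup>+x. indicator A (T (S y + x)) * indicator B (y - T (S y + x)) \<partial>lborel)"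
      by (subst nn_integral_distr) measurable
    finally show "(\<integral>\<^sup>+x. indicator A (T x) * indicator B (y - T x) \<partial>lborel) = (\<integral>\<^sup>+x. indicator A (T x + y) * indicator B (- T x) \<partial>lborel)"
      by (simp add: linear_add[OF lin] TS add.commute)
  qed
  also have "\<dots> = (\<integral>\<^sup>+x. (\<integral>\<^sup>+y. indicator A (T x + y) * indicator B (- T x) \<partial>lborel) \<partial>lborel)"
    by (rule lborel_pair.Fubini') measurable
  also have "\<dots> = (\<integral>\<^sup>+x. emeasure lborel A * indicator B x \<partial>lborel)"
  proof (rule nn_integral_cong)
    fix x
    have "(\<integral>\<^sup>+y. indicator A (T x + y) \<partial>lborel) = (\<integral>\<^sup>+y. indicator A y \<partial>distr lborel borel ((+) (T x)))"
      by (subst nn_integral_distr) measurable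
    hence "(\<integral>\<^sup>+y. indicator A (T x + y) \<partial>lborel) = emeasure lborel A" by (simp add: lborel_distr_plus)
    moreover have "indicator B (- T x) = (indicator B x :: ennreal)"
      using orthogonal_transformation_norm[OF T, of x] by (simp add: B_def indicator_def)
    ultimately show "(\<integral>\<^sup>+y. indicator A (T x + y) * indicator B (- T x) \<partial>lborel) = emeasure lborel A * indicator B x"
      by (subst nn_integral_multc) auto
  qed
  also have "\<dots> = emeasure lborel A * emeasure lborel B" by (subst nn_integral_cmult_indicator) auto
  finally have "emeasure lborel (T -` A) * emeasure lborel B = emeasure lborel A * emeasure lborel B" using 1 by simp
  moreover have "emeasure lborel B \<noteq> 0" "emeasure lborel B \<noteq> \<infinity>"
    using emeasure_lborel_ball_finite[of 0 1] content_ball_pos[of 1 "0 :: 'a"]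
    by (auto simp: B_def measure_def)
  ultimately show ?thesis by (metis ennreal_mult_cancel_left mult.commute infinity_ennreal_def)
qed

text \<open>The origin gets an arbitrary unit vector as value, so that the map is total with values
  in the sphere.\<close>

definition sphere_point :: "'a::euclidean_space \<Rightarrow> 'a" where
  "sphere_point x = (if x = 0 then SOME i. i \<in> Basis else sgn x)"

text \<open>A probability measure, whereas the weight on [-1,1] has total mass
  \<open>sphere_area d / sphere_area (d - 1)\<close>. This quotient, usually called \<open>T\<close>
  below, appears whenever the two are compared.\<close>

definition sphere_measure :: "'a::euclidean_space measure" where
  "sphere_measure = distr (uniform_measure lborel (ball 0 1)) (restrict_space borel (sphere 0 1)) sphere_point"

lemma norm_sphere_point: "norm (sphere_point x) = 1"
proof (cases "x = 0")
  case True
  have "(SOME i. i \<in> Basis) \<in> (Basis :: 'a set)" by (rule someI_ex) (use nonempty_Basis in blast)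
  thus ?thesis using True by (simp add: sphere_point_def norm_Basis)
qed (simp add: sphere_point_def norm_sgn)

lemma sphere_point_measurable:
  "sphere_point \<in> (uniform_measure lborel (ball 0 1) :: 'a::euclidean_space measure) \<rightarrow>\<^sub>M restrict_space borel (sphere 0 1)"
proof (rule measurable_restrict_space2)
  have "(sphere_point :: 'a \<Rightarrow> 'a) = (\<lambda>x. if x = 0 then SOME i. i \<in> Basis else inverse (norm x) *\<^sub>R x)"
    by (auto simp: sphere_point_def sgn_div_norm)
  also have "\<dots> \<in> borel_measurable borel" by measurable
  finally show "(sphere_point :: 'a \<Rightarrow> 'a) \<in> uniform_measure lborel (ball 0 1) \<rightarrow>\<^sub>M borel"
    by (simp cong: measurable_cong_sets)
qed (auto simp: norm_sphere_point)

lemma space_sphere_measure [simp]: "space sphere_measure = sphere 0 1"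
  by (simp add: sphere_measure_def)

lemma sets_sphere_measure [simp, measurable_cong]:
  "sets sphere_measure = sets (restrict_space borel (sphere 0 1))"
  by (simp add: sphere_measure_def)

lemma emeasure_sphere_measure: "emeasure sphere_measure (sphere (0 :: 'a::euclidean_space) 1) = 1"
proof -
  let ?B = "ball (0 :: 'a) 1"
  have "emeasure sphere_measure (sphere (0 :: 'a) 1) = emeasure (uniform_measure lborel ?B) UNIV"
    unfolding sphere_measure_def
    by (subst emeasure_distr[OF sphere_point_measurable])
       (auto simp: sets_restrict_space vimage_def norm_sphere_point)
  also have "\<dots> = emeasure lborel ?B / emeasure lborel ?B"
    by (subst emeasure_uniform_measure) auto
  also have "\<dots> = 1"
    using emeasure_lborel_ball_finite[of "0 :: 'a" 1] content_ball_pos[of 1 "0 :: 'a"]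
    by (intro ennreal_divide_self) (auto simp: measure_def)
  finally show ?thesis .
qed

lemma finite_measure_sphere: "finite_measure sphere_measure"
  by (intro finite_measureI) (simp add: emeasure_sphere_measure)

lemma measure_sphere_measure [simp]: "measure sphere_measure (sphere 0 1) = 1"
  by (simp add: measure_def emeasure_sphere_measure)

text \<open>Some orthogonal T carries w to v. It preserves the uniform measure on the ball and
  commutes with normalization, so T can be moved across the inner product.\<close>

lemma integral_sphere_inner_invariant:
  fixes v w :: "real ^ 'n" and g :: "real \<Rightarrow> real"
  assumes vw: "norm v = norm w" and g [measurable]: "g \<in> borel_measurable borel"
  shows "(\<integral>x. g (v \<bullet> x) \<partial>sphere_measure) = (\<integral>x. g (w \<bullet> x) \<partial>sphere_measure)"
proof -
  let ?U = "uniform_measure lborel (ball (0 :: real ^ 'n) 1)"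
  obtain T where T: "orthogonal_transformation T" "T w = v"
    using orthogonal_transformation_exists[OF vw[symmetric]] by blast
  have lin: "linear T" using T(1) by (rule orthogonal_transformation_linear)
  have [measurable]: "T \<in> borel_measurable borel"
    by (intro borel_measurable_continuous_onI linear_continuous_on linear_conv_bounded_linear[THEN iffD1] lin)
  have inv: "distr ?U borel T = ?U"
  proof (rule measure_eqI)
    fix A assume "A \<in> sets (distr ?U borel T)"
    hence A [measurable]: "A \<in> sets borel" by simp
    have "emeasure (distr ?U borel T) A = emeasure ?U (T -` A)"
      by (subst emeasure_distr) (auto cong: measurable_cong_sets)
    also have "\<dots> = emeasure lborel (ball 0 1 \<inter> T -` A) / emeasure lborel (ball (0 :: real ^ 'n) 1)"
      by (subst emeasure_uniform_measure) (auto intro!: measurable_sets_borel[of _ borel])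
    also have "ball 0 1 \<inter> T -` A = T -` (ball 0 1 \<inter> A)"
      using orthogonal_transformation_norm[OF T(1)] by auto
    also have "emeasure lborel \<dots> = emeasure lborel (ball 0 1 \<inter> A)"
      by (intro emeasure_lborel_orthogonal_vimage T) auto
    also have "\<dots> / emeasure lborel (ball (0 :: real ^ 'n) 1) = emeasure ?U A"
      by (subst emeasure_uniform_measure) auto
    finally show "emeasure (distr ?U borel T) A = emeasure ?U A" .
  qed simp
  have sm: "sphere_point \<in> borel_measurable ?U"
    using measurable_restrict_space2_iff sphere_point_measurable by blast
  have [measurable]: "(sphere_point :: real ^ 'n \<Rightarrow> _) \<in> borel_measurable borel"
    using sm by (simp cong: measurable_cong_sets)
  have eq: "(\<integral>x. g (u \<bullet> x) \<partial>sphere_measure) = (\<integral>x. g (u \<bullet> sphere_point x) \<partial>?U)" for u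
    unfolding sphere_measure_def by (intro integral_distr sphere_point_measurable measurable_restrict_space1) measurable
  have "(\<integral>x. g (v \<bullet> sphere_point x) \<partial>?U) = (\<integral>x. g (v \<bullet> sphere_point x) \<partial>distr ?U borel T)"
    by (simp only: inv)
  also have "\<dots> = (\<integral>x. g (v \<bullet> sphere_point (T x)) \<partial>?U)"
    by (intro integral_distr) (auto cong: measurable_cong_sets)
  also have "\<dots> = (\<integral>x. g (w \<bullet> sphere_point x) \<partial>?U)"
  proof (rule integral_cong_AE)
    \<comment> \<open>At the origin \<open>sphere_point\<close> need not commute with T, but the
      origin is a null set.\<close>
    have "AE x in ?U. x \<noteq> 0"
      by (intro AE_uniform_measureI) (auto intro: AE_mp[OF AE_lborel_singleton[of 0]])
    thus "AE x in ?U. g (v \<bullet> sphere_point (T x)) = g (w \<bullet> sphere_point x)"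
    proof eventually_elim
      case (elim x)
      have "T x \<noteq> 0" using elim orthogonal_transformation_norm[OF T(1), of x] by auto
      hence "sphere_point (T x) = T (sphere_point x)"
        using elim orthogonal_transformation_norm[OF T(1), of x]
        by (simp add: sphere_point_def sgn_div_norm linear_scale[OF lin])
      moreover have "v \<bullet> T (sphere_point x) = w \<bullet> sphere_point x"
        using T unfolding orthogonal_transformation_def by metis
      ultimately show ?case by simp
    qed
  qed (auto cong: measurable_cong_sets)
  finally show ?thesis unfolding eq .
qed

lemma measurable_sphere:
  fixes h :: "'a::euclidean_space \<Rightarrow> 'b::topological_space"
  assumes "continuous_on (sphere 0 1) h"
  shows "h \<in> borel_measurable sphere_measure"
  using borel_measurable_continuous_on_restrict[OF assms]
  by (simp cong: measurable_cong_sets)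

lemma integrable_sphere:
  fixes h :: "'a::euclidean_space \<Rightarrow> 'b::{banach, second_countable_topology}"
  assumes h: "continuous_on (sphere 0 1) h"
  shows "integrable sphere_measure h"
proof -
  interpret finite_measure "sphere_measure :: 'a measure" by (rule finite_measure_sphere)
  have "bounded (h ` sphere 0 1)" using h by (intro compact_imp_bounded compact_continuous_image) auto
  then obtain B where "\<And>x. x \<in> sphere 0 1 \<Longrightarrow> norm (h x) \<le> B" unfolding bounded_iff by blast
  thus ?thesis using measurable_sphere[OF h] by (intro integrable_const_bound[of _ B] AE_I2) auto
qed

lemma inner_unit_vectors:
  fixes v w :: "'a::real_inner"
  assumes "norm v = 1" "norm w = 1"
  shows "v \<bullet> w \<in> {-1..1}"
  using Cauchy_Schwarz_ineq2[of v w] assms by (auto simp: abs_le_iff)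

lemma continuous_on_zonal:
  fixes v :: "'a::euclidean_space"
  assumes h: "continuous_on {-1..1} h" and v: "norm v = 1"
  shows "continuous_on (sphere 0 1) (\<lambda>x. h (v \<bullet> x))"
  by (rule continuous_on_compose2[OF h]) (use v in \<open>auto intro!: continuous_intros inner_unit_vectors simp del: atLeastAtMost_iff\<close>)

section \<open>Moments, convolution of zonal polynomials, and zonal marginals\<close>

definition sphere_moment :: "'n::finite itself \<Rightarrow> nat \<Rightarrow> real" where
  "sphere_moment _ m = (\<integral>x. ((axis (SOME i. True) 1 :: real ^ 'n) \<bullet> x) ^ m \<partial>sphere_measure)"

lemma integral_sphere_power:
  fixes v :: "real ^ 'n"
  shows "(\<integral>x. (v \<bullet> x) ^ m \<partial>sphere_measure) = norm v ^ m * sphere_moment TYPE('n) m"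
proof -
  define e :: "real ^ 'n" where "e = axis (SOME i. True) 1"
  have "norm v = norm (norm v *\<^sub>R e)" by (simp add: e_def)
  from integral_sphere_inner_invariant[OF this, of "\<lambda>t. t ^ m"]
  have "(\<integral>x. (v \<bullet> x) ^ m \<partial>sphere_measure) = (\<integral>x. norm v ^ m * (e \<bullet> x) ^ m \<partial>sphere_measure)"
    by (simp add: power_mult_distrib)
  thus ?thesis by (simp add: sphere_moment_def e_def)
qed

lemma sphere_moment_odd:
  assumes "odd m"
  shows "sphere_moment TYPE('n::finite) m = 0"
proof -
  define e :: "real ^ 'n" where "e = axis (SOME i. True) 1"
  have "(\<integral>x. ((-e) \<bullet> x) ^ m \<partial>sphere_measure) = (\<integral>x. (e \<bullet> x) ^ m \<partial>sphere_measure)"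
    unfolding integral_sphere_power by simp
  moreover have "((-e) \<bullet> x) ^ m = - ((e \<bullet> x) ^ m)" for x using assms by simp
  ultimately have "(\<integral>x. (e \<bullet> x) ^ m \<partial>sphere_measure) = 0" by simp
  thus ?thesis unfolding integral_sphere_power by (simp add: e_def)
qed

text \<open>Comparison of the coefficients of $t^b$ in
  $\int ((v + t w) \cdot x)^m\,dx = \mu_m (1 + 2 \rho t + t^2)^{m/2}$, where $\rho = v \cdot w$.\<close>

lemma sphere_mixed_moment:
  fixes v w :: "real ^ 'n"
  assumes v: "norm v = 1" and w: "norm w = 1" and b: "b \<le> m"
  shows "real (m choose b) * (\<integral>x. (v \<bullet> x) ^ (m - b) * (w \<bullet> x) ^ b \<partial>sphere_measure) =
    sphere_moment TYPE('n) m * coeff ([:1, 2 * (v \<bullet> w), 1:] ^ (m div 2)) b"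
proof -
  define E where "E = (\<lambda>b. \<integral>x. (v \<bullet> x) ^ (m - b) * (w \<bullet> x) ^ b \<partial>sphere_measure)"
  define \<mu> where "\<mu> = sphere_moment TYPE('n) m"
  have "(\<Sum>b\<le>m. monom (real (m choose b) * E b) b) = smult \<mu> ([:1, 2 * (v \<bullet> w), 1:] ^ (m div 2))"
  proof -
    have "poly (\<Sum>b\<le>m. monom (real (m choose b) * E b) b) t = poly (smult \<mu> ([:1, 2 * (v \<bullet> w), 1:] ^ (m div 2))) t" for t
    proof -
      have int: "integrable sphere_measure (\<lambda>x. (v \<bullet> x) ^ (m - b) * (w \<bullet> x) ^ b)" for b
        by (intro integrable_sphere continuous_intros)
      have "poly (\<Sum>b\<le>m. monom (real (m choose b) * E b) b) t = (\<Sum>b\<le>m. (real (m choose b) * t ^ b) * E b)"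
        by (simp add: poly_sum poly_monom mult_ac)
      also have "\<dots> = (\<integral>x. (\<Sum>b\<le>m. (real (m choose b) * t ^ b) * ((v \<bullet> x) ^ (m - b) * (w \<bullet> x) ^ b)) \<partial>sphere_measure)"
        unfolding E_def using int by (subst Bochner_Integration.integral_sum) auto
      also have "\<dots> = (\<integral>x. ((v + t *\<^sub>R w) \<bullet> x) ^ m \<partial>sphere_measure)"
      proof (rule Bochner_Integration.integral_cong[OF refl])
        fix x
        have "((v + t *\<^sub>R w) \<bullet> x) ^ m = (t * (w \<bullet> x) + v \<bullet> x) ^ m" by (simp add: inner_add_left add.commute)
        also have "\<dots> = (\<Sum>b\<le>m. (real (m choose b) * t ^ b) * ((v \<bullet> x) ^ (m - b) * (w \<bullet> x) ^ b))"
          unfolding binomial_ring by (intro sum.cong) (auto simp: power_mult_distrib)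
        finally show "(\<Sum>b\<le>m. (real (m choose b) * t ^ b) * ((v \<bullet> x) ^ (m - b) * (w \<bullet> x) ^ b)) = ((v + t *\<^sub>R w) \<bullet> x) ^ m" ..
      qed
      also have "\<dots> = norm (v + t *\<^sub>R w) ^ m * \<mu>" unfolding integral_sphere_power \<mu>_def ..
      also have "\<dots> = poly (smult \<mu> ([:1, 2 * (v \<bullet> w), 1:] ^ (m div 2))) t"
      proof (cases "even m")
        case True
        have "v \<bullet> v = 1" "w \<bullet> w = 1" using v w by (simp_all add: norm_eq_1)
        hence "norm (v + t *\<^sub>R w) ^ 2 = 1 + 2 * t * (v \<bullet> w) + t ^ 2"
          unfolding power2_norm_eq_inner
          by (simp add: inner_add_left inner_add_right inner_commute power2_eq_square algebra_simps)
        moreover have "norm (v + t *\<^sub>R w) ^ m = (norm (v + t *\<^sub>R w) ^ 2) ^ (m div 2)"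
          using True by (simp flip: power_mult)
        ultimately show ?thesis by (simp add: power2_eq_square algebra_simps)
      next
        \<comment> \<open>For odd m the exponent m div 2 is not m/2, but then the moment is 0 on
          both sides.\<close>
        case False
        thus ?thesis by (simp add: \<mu>_def sphere_moment_odd)
      qed
      finally show ?thesis .
    qed
    thus ?thesis unfolding poly_eq_poly_eq_iff[symmetric] by auto
  qed
  from arg_cong[OF this, of "\<lambda>p. coeff p b"] show ?thesis
    using b by (simp add: coeff_sum \<mu>_def E_def)
qed

lemma coeff_quadratic_mult:
  fixes p :: "'a::comm_ring_1 poly"
  shows "coeff ([:1, r, 1:] * p) 0 = coeff p 0"
    "coeff ([:1, r, 1:] * p) (Suc 0) = coeff p (Suc 0) + r * coeff p 0"
    "coeff ([:1, r, 1:] * p) (Suc (Suc b)) = coeff p (Suc (Suc b)) + r * coeff p (Suc b) + coeff p b"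
  by (simp_all add: algebra_simps)

text \<open>Every r comes with a factor t, so the coefficient of t^b can contain at most b of them.
  This is the origin of the degree bound for convolutions.\<close>

lemma coeff_quadratic_power_poly:
  "\<exists>Q. degree Q \<le> b \<and> (\<forall>r :: real. coeff ([:1, 2 * r, 1:] ^ M) b = poly Q r)"
proof (induction M arbitrary: b)
  case 0
  show ?case by (intro exI[of _ "if b = 0 then 1 else 0"]) auto
next
  case (Suc M)
  from Suc obtain Q where Q: "\<And>b. degree (Q b) \<le> b" "\<And>b r. coeff ([:1, 2 * r, 1:] ^ M) b = poly (Q b) (r :: real)"
    by metis
  have deg: "degree (pCons 0 (Q b)) \<le> Suc b" for b
    using Q(1)[of b] degree_pCons_le[of 0 "Q b"] by linarith
  consider "b = 0" | "b = Suc 0" | c where "b = Suc (Suc c)" by (metis nat.exhaust)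
  thus ?case
  proof cases
    case 1
    thus ?thesis unfolding 1 power_Suc coeff_quadratic_mult Q(2) using Q(1)[of 0] by blast
  next
    case 2
    have "degree (Q (Suc 0) + smult 2 (pCons 0 (Q 0))) \<le> Suc 0"
      using Q(1)[of "Suc 0"] deg[of 0] by (intro degree_add_le order.trans[OF degree_smult_le])
    thus ?thesis unfolding 2 power_Suc coeff_quadratic_mult Q(2)
      by (intro exI[of _ "Q (Suc 0) + smult 2 (pCons 0 (Q 0))"]) simp
  next
    case 3
    have "degree (Q (Suc (Suc c)) + smult 2 (pCons 0 (Q (Suc c))) + Q c) \<le> Suc (Suc c)"
      using Q(1)[of c] Q(1)[of "Suc (Suc c)"] deg[of "Suc c"]
      by (intro degree_add_le order.trans[OF degree_smult_le]) auto
    thus ?thesis unfolding 3 power_Suc coeff_quadratic_mult Q(2)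
      by (intro exI[of _ "Q (Suc (Suc c)) + smult 2 (pCons 0 (Q (Suc c))) + Q c"]) simp
  qed
qed

lemma coeff_one_plus_square_power:
  "coeff ([:1, 0, 1 :: real:] ^ M) 2 = real M"
proof -
  have "coeff ([:1, 0, 1 :: real:] ^ M) 0 = 1 \<and> coeff ([:1, 0, 1 :: real:] ^ M) (Suc (Suc 0)) = real M"
    by (induction M) (simp_all only: power_Suc coeff_quadratic_mult, simp_all)
  thus ?thesis by (simp add: numeral_2_eq_2)
qed

lemma sphere_convolution_powers:
  "\<exists>Q. degree Q \<le> b \<and> (\<forall>v w :: real ^ 'n. norm v = 1 \<longrightarrow> norm w = 1 \<longrightarrow>
     (\<integral>x. (v \<bullet> x) ^ a * (w \<bullet> x) ^ b \<partial>sphere_measure) = poly Q (v \<bullet> w))"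
proof -
  obtain Q where Q: "degree Q \<le> b" "\<And>r :: real. coeff ([:1, 2 * r, 1:] ^ ((a + b) div 2)) b = poly Q r"
    using coeff_quadratic_power_poly by metis
  define c where "c = sphere_moment TYPE('n) (a + b) / real ((a + b) choose b)"
  have "(\<integral>x. (v \<bullet> x) ^ a * (w \<bullet> x) ^ b \<partial>sphere_measure) = poly (smult c Q) (v \<bullet> w)"
    if "norm v = 1" "norm w = 1" for v w :: "real ^ 'n"
    using sphere_mixed_moment[OF that, of b "a + b"] unfolding Q c_def by (simp add: field_simps)
  thus ?thesis using Q(1) degree_smult_le[of c Q] by (intro exI[of _ "smult c Q"]) auto
qed

text \<open>The bound involves the second factor only. With c_n as first factor and a polynomial of
  degree below n as second, the convolution therefore stays below degree n, which is how it enters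
  \<open>ultraspherical_convolution\<close>.\<close>

lemma sphere_convolution_poly:
  "\<exists>Q. degree Q \<le> degree q \<and> (\<forall>v w :: real ^ 'n. norm v = 1 \<longrightarrow> norm w = 1 \<longrightarrow>
     (\<integral>x. poly p (v \<bullet> x) * poly q (w \<bullet> x) \<partial>sphere_measure) = poly Q (v \<bullet> w))"
proof -
  define P where "P = (\<lambda>a b Q. degree Q \<le> b \<and> (\<forall>v w :: real ^ 'n. norm v = 1 \<longrightarrow> norm w = 1 \<longrightarrow>
     (\<integral>x. (v \<bullet> x) ^ a * (w \<bullet> x) ^ b \<partial>sphere_measure) = poly Q (v \<bullet> w)))"
  define Q where "Q = (\<lambda>a b. SOME Q. P a b Q)"
  have "P a b (Q a b)" for a b
    unfolding Q_def by (rule someI_ex) (unfold P_def, rule sphere_convolution_powers)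
  hence Q: "degree (Q a b) \<le> b" "norm v = 1 \<Longrightarrow> norm w = 1 \<Longrightarrow>
     (\<integral>x. (v \<bullet> x) ^ a * (w \<bullet> x) ^ b \<partial>sphere_measure) = poly (Q a b) (v \<bullet> w)" for a b and v w :: "real ^ 'n"
    unfolding P_def by blast+
  define R where "R = (\<Sum>a\<le>degree p. \<Sum>b\<le>degree q. smult (coeff p a * coeff q b) (Q a b))"
  have "degree R \<le> degree q" unfolding R_def
    by (intro degree_sum_le) (auto intro!: order.trans[OF degree_smult_le] order.trans[OF Q(1)])
  moreover have "(\<integral>x. poly p (v \<bullet> x) * poly q (w \<bullet> x) \<partial>sphere_measure) = poly R (v \<bullet> w)"
    if vw: "norm v = 1" "norm w = 1" for v w :: "real ^ 'n"
  proof -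
    have int: "integrable sphere_measure (\<lambda>x. (v \<bullet> x) ^ a * (w \<bullet> x) ^ b)" for a b
      by (intro integrable_sphere continuous_intros)
    have "poly p (v \<bullet> x) * poly q (w \<bullet> x) = (\<Sum>a\<le>degree p. \<Sum>b\<le>degree q. (coeff p a * coeff q b) * ((v \<bullet> x) ^ a * (w \<bullet> x) ^ b))" for x
      by (simp add: poly_altdef sum_product mult_ac)
    hence "(\<integral>x. poly p (v \<bullet> x) * poly q (w \<bullet> x) \<partial>sphere_measure) =
      (\<Sum>a\<le>degree p. \<Sum>b\<le>degree q. (coeff p a * coeff q b) * (\<integral>x. (v \<bullet> x) ^ a * (w \<bullet> x) ^ b \<partial>sphere_measure))"
      using int by (simp add: Bochner_Integration.integral_sum)
    also have "\<dots> = poly R (v \<bullet> w)" by (simp add: Q(2)[OF vw] R_def poly_sum)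
    finally show ?thesis .
  qed
  ultimately show ?thesis by blast
qed

text \<open>The squares of the coordinates sum to 1 on the sphere; this sum is inserted into the
  k-th moment. The coordinate of the moment itself contributes the moment of order k + 2, and each
  of the d others contributes that moment divided by k + 1.\<close>

lemma sphere_moment_recurrence:
  assumes d: "CARD('n::finite) = d + 1"
  shows "(real k + 1 + real d) * sphere_moment TYPE('n) (k + 2) = (real k + 1) * sphere_moment TYPE('n) k"
proof (cases "even k")
  case False
  thus ?thesis by (simp add: sphere_moment_odd)
next
  case True
  define j :: 'n where "j = (SOME i. True)"
  define e :: "'n \<Rightarrow> real ^ 'n" where "e = (\<lambda>i. axis i 1)"
  define \<mu> where "\<mu> = sphere_moment TYPE('n)"
  have ne: "norm (e i) = 1" for i by (simp add: e_def)
  have m: "(\<integral>x. (e j \<bullet> x) ^ m \<partial>sphere_measure) = \<mu> m" for m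
    unfolding integral_sphere_power by (simp add: ne \<mu>_def)
  have other: "(real k + 1) * (\<integral>x. (e j \<bullet> x) ^ k * (e i \<bullet> x) ^ 2 \<partial>sphere_measure) = \<mu> (k + 2)" if "i \<noteq> j" for i
  proof -
    have "e j \<bullet> e i = 0" using that by (simp add: e_def inner_axis_axis)
    moreover have "real ((k + 2) choose 2) * (\<integral>x. (e j \<bullet> x) ^ (k + 2 - 2) * (e i \<bullet> x) ^ 2 \<partial>sphere_measure) =
      sphere_moment TYPE('n) (k + 2) * coeff ([:1, 2 * (e j \<bullet> e i), 1:] ^ ((k + 2) div 2)) 2"
      by (rule sphere_mixed_moment[OF ne ne]) simp
    \<comment> \<open>For orthogonal vectors the quadratic is 1 + t^2, whose power with exponent (k
      + 2)/2 has the coefficient (k + 2)/2 at t^2.\<close>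
    ultimately have 1: "real ((k + 2) choose 2) * (\<integral>x. (e j \<bullet> x) ^ k * (e i \<bullet> x) ^ 2 \<partial>sphere_measure) = \<mu> (k + 2) * real ((k + 2) div 2)"
      by (simp only: \<mu>_def coeff_one_plus_square_power mult_zero_right diff_add_inverse2)
    have 2: "real ((k + 2) div 2) = (real k + 2) / 2" using True by (simp add: real_of_nat_div)
    have 3: "real ((k + 2) choose 2) = (real k + 2) / 2 * (real k + 1)"
      by (simp add: choose_two real_of_nat_div algebra_simps)
    have "(real k + 2) / 2 * ((real k + 1) * (\<integral>x. (e j \<bullet> x) ^ k * (e i \<bullet> x) ^ 2 \<partial>sphere_measure)) = (real k + 2) / 2 * \<mu> (k + 2)"
      using 1 unfolding 2 3 by (simp only: mult_ac)
    thus ?thesis by (subst (asm) mult_cancel_left) auto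
  qed
  have int: "integrable sphere_measure (\<lambda>x. (e j \<bullet> x) ^ k * (e i \<bullet> x) ^ 2)" for i
    by (intro integrable_sphere continuous_intros)
  have "\<mu> k = (\<integral>x. (\<Sum>i\<in>UNIV. (e j \<bullet> x) ^ k * (e i \<bullet> x) ^ 2) \<partial>sphere_measure)"
    unfolding m[symmetric]
  proof (rule Bochner_Integration.integral_cong[OF refl])
    fix x :: "real ^ 'n" assume "x \<in> space sphere_measure"
    hence "x \<bullet> x = 1" by (simp add: norm_eq_1)
    hence "(\<Sum>i\<in>UNIV. (e i \<bullet> x) ^ 2) = 1"
    proof -
      have "e i \<bullet> x = x $ i" for i by (simp add: e_def inner_axis')
      thus ?thesis using \<open>x \<bullet> x = 1\<close> by (simp add: inner_vec_def power2_eq_square)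
    qed
    thus "(e j \<bullet> x) ^ k = (\<Sum>i\<in>UNIV. (e j \<bullet> x) ^ k * (e i \<bullet> x) ^ 2)" by (simp flip: sum_distrib_left)
  qed
  also have "\<dots> = (\<Sum>i\<in>UNIV. \<integral>x. (e j \<bullet> x) ^ k * (e i \<bullet> x) ^ 2 \<partial>sphere_measure)"
    using int by (intro Bochner_Integration.integral_sum) auto
  also have "\<dots> = (\<integral>x. (e j \<bullet> x) ^ (k + 2) \<partial>sphere_measure) + (\<Sum>i\<in>UNIV - {j}. \<integral>x. (e j \<bullet> x) ^ k * (e i \<bullet> x) ^ 2 \<partial>sphere_measure)"
    by (subst sum.remove[of UNIV j]) (simp_all flip: power_add)
  also have "(\<Sum>i\<in>UNIV - {j}. \<integral>x. (e j \<bullet> x) ^ k * (e i \<bullet> x) ^ 2 \<partial>sphere_measure) = (\<Sum>i\<in>UNIV - {j}. \<mu> (k + 2) / (real k + 1))"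
    using other by (intro sum.cong) (auto simp: field_simps)
  also have "\<dots> = real d * (\<mu> (k + 2) / (real k + 1))" using d by simp
  finally have "\<mu> k = \<mu> (k + 2) + real d * (\<mu> (k + 2) / (real k + 1))" by (simp only: m)
  hence "(real k + 1) * \<mu> k = (real k + 1) * \<mu> (k + 2) + real d * \<mu> (k + 2)" by (simp add: field_simps)
  thus ?thesis by (simp add: \<mu>_def algebra_simps)
qed

text \<open>Integration by parts with p = x^(k+1) gives the moments of the weight the recurrence of
  \<open>sphere_moment_recurrence\<close>. The moments of order 0 differ by the factor of total
  masses, those of order 1 vanish.\<close>

lemma sphere_moment_eq_ultraspherical:
  assumes d: "CARD('n::finite) = d + 1" "d \<ge> 1"
  shows "(\<integral>x. x ^ m \<partial>ultraspherical_measure d) = sphere_area d / sphere_area (d - 1) * sphere_moment TYPE('n) m"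
proof (induction m rule: nat_induct2)
  case 0
  have "sphere_moment TYPE('n) 0 = 1" by (simp add: sphere_moment_def)
  thus ?case using measure_ultraspherical[OF d(2)] by simp
next
  case 1
  have "poly (pderiv 1 * [:1, 0, -1:] - smult (real d) (pCons 0 1)) = (\<lambda>x. - real d * x)" by auto
  thus ?case using ultraspherical_integration_by_parts[OF d(2), of 1] d by (simp add: sphere_moment_odd)
next
  case (step k)
  define L where "L = (\<lambda>k. \<integral>x. x ^ k \<partial>ultraspherical_measure d)"
  have int: "integrable (ultraspherical_measure d) (\<lambda>x. x ^ k)" for k
    using d by (intro integrable_ultraspherical continuous_intros)
  have "poly (pderiv (monom 1 (k + 1)) * [:1, 0, -1:] - smult (real d) (pCons 0 (monom 1 (k + 1)))) =
     (\<lambda>x. (real k + 1) * x ^ k - (real k + 1 + real d) * x ^ (k + 2))"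
    by (intro ext) (simp add: pderiv_monom poly_monom algebra_simps power2_eq_square)
  with ultraspherical_integration_by_parts[OF d(2), of "monom 1 (k + 1)"]
  have "(\<integral>x. (real k + 1) * x ^ k - (real k + 1 + real d) * x ^ (k + 2) \<partial>ultraspherical_measure d) = 0" by simp
  hence "(real k + 1 + real d) * L (k + 2) = (real k + 1) * L k"
    using int[of k] int[of "k + 2"] unfolding L_def by (subst (asm) Bochner_Integration.integral_diff) auto
  also have "\<dots> = sphere_area d / sphere_area (d - 1) * ((real k + 1) * sphere_moment TYPE('n) k)"
    using step by (simp add: L_def)
  also have "\<dots> = (real k + 1 + real d) * (sphere_area d / sphere_area (d - 1) * sphere_moment TYPE('n) (k + 2))"
    unfolding sphere_moment_recurrence[OF d(1), symmetric] by simp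
  finally show ?case unfolding L_def by (subst (asm) mult_cancel_left) auto
qed

lemma integral_zonal_poly:
  fixes v :: "real ^ 'n"
  assumes d: "CARD('n::finite) = d + 1" "d \<ge> 1" and v: "norm v = 1"
  shows "sphere_area d / sphere_area (d - 1) * (\<integral>x. poly p (v \<bullet> x) \<partial>sphere_measure) = (\<integral>x. poly p x \<partial>ultraspherical_measure d)"
proof -
  have int: "integrable (ultraspherical_measure d) (\<lambda>x. x ^ k)" for k
    using d by (intro integrable_ultraspherical continuous_intros)
  have int': "integrable sphere_measure (\<lambda>x. (v \<bullet> x) ^ k)" for k
    by (intro integrable_sphere continuous_intros)
  show ?thesis unfolding poly_altdef using int int'
    by (simp add: Bochner_Integration.integral_sum sphere_moment_eq_ultraspherical[OF d] integral_sphere_power v sum_distrib_left mult_ac)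
qed

lemma poly_approximation:
  fixes h :: "real \<Rightarrow> real"
  assumes "continuous_on {-1..1} h" "e > 0"
  obtains p where "\<And>x. x \<in> {-1..1} \<Longrightarrow> \<bar>h x - poly p x\<bar> < e"
proof -
  obtain g where g: "real_polynomial_function g" "\<And>x. x \<in> {-1..1} \<Longrightarrow> \<bar>h x - g x\<bar> < e"
    using Stone_Weierstrass_real_polynomial_function[OF compact_Icc assms] by metis
  then obtain a n where "g = (\<lambda>x. \<Sum>i\<le>n. a i * x ^ i)" unfolding real_polynomial_function_iff_sum by auto
  hence "g = poly (\<Sum>i\<le>n. monom (a i) i)" by (auto simp: poly_sum poly_monom)
  thus ?thesis using g that by blast
qed

lemma integral_zonal_real:
  fixes v :: "real ^ 'n" and h :: "real \<Rightarrow> real"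
  assumes d: "CARD('n::finite) = d + 1" "d \<ge> 1" and v: "norm v = 1" and h: "continuous_on {-1..1} h"
  shows "sphere_area d / sphere_area (d - 1) * (\<integral>x. h (v \<bullet> x) \<partial>sphere_measure) = (\<integral>x. h x \<partial>ultraspherical_measure d)"
proof (rule ccontr)
  define T where "T = sphere_area d / sphere_area (d - 1)"
  have T: "T > 0" by (simp add: T_def sphere_area_pos)
  define D where "D = T * (\<integral>x. h (v \<bullet> x) \<partial>sphere_measure) - (\<integral>x. h x \<partial>ultraspherical_measure d)"
  assume "\<not> ?thesis"
  hence D: "\<bar>D\<bar> > 0" by (simp add: D_def T_def)
  \<comment> \<open>Each of the two approximation errors is at most T e, so together they account
    for at most half of |D|.\<close>
  define e where "e = \<bar>D\<bar> / (4 * T)"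
  have e: "e > 0" using D T by (simp add: e_def)
  obtain p where p: "\<And>x. x \<in> {-1..1} \<Longrightarrow> \<bar>h x - poly p x\<bar> < e" using poly_approximation[OF h e] by blast
  interpret S: finite_measure "sphere_measure :: (real ^ 'n) measure" by (rule finite_measure_sphere)
  interpret U: finite_measure "ultraspherical_measure d" by (rule finite_measure_ultraspherical[OF d(2)])
  have c: "continuous_on {-1..1} (\<lambda>x. h x - poly p x)" by (intro continuous_intros h)
  have "\<bar>\<integral>x. h (v \<bullet> x) - poly p (v \<bullet> x) \<partial>sphere_measure\<bar> \<le> (\<integral>x. \<bar>h (v \<bullet> x) - poly p (v \<bullet> x)\<bar> \<partial>sphere_measure)"
    by (rule integral_abs_bound)
  also have "\<dots> \<le> (\<integral>x. e \<partial>(sphere_measure :: (real ^ 'n) measure))"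
    using v by (intro integral_mono integrable_abs integrable_sphere continuous_on_zonal[OF c v])
      (auto intro!: less_imp_le[OF p] inner_unit_vectors simp del: atLeastAtMost_iff)
  finally have 1: "\<bar>(\<integral>x. h (v \<bullet> x) \<partial>sphere_measure) - (\<integral>x. poly p (v \<bullet> x) \<partial>sphere_measure)\<bar> \<le> e"
    using v by (subst (asm) Bochner_Integration.integral_diff) (auto intro!: integrable_sphere continuous_on_zonal h continuous_intros)
  have "\<bar>\<integral>x. h x - poly p x \<partial>ultraspherical_measure d\<bar> \<le> (\<integral>x. \<bar>h x - poly p x\<bar> \<partial>ultraspherical_measure d)"
    by (rule integral_abs_bound)
  also have "\<dots> \<le> (\<integral>x. e \<partial>ultraspherical_measure d)"
    by (intro integral_mono integrable_abs integrable_ultraspherical c d) (auto intro!: less_imp_le[OF p])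
  also have "\<dots> = T * e" using measure_ultraspherical[OF d(2)] by (simp add: T_def)
  finally have 2: "\<bar>(\<integral>x. h x \<partial>ultraspherical_measure d) - (\<integral>x. poly p x \<partial>ultraspherical_measure d)\<bar> \<le> T * e"
    using d by (subst (asm) Bochner_Integration.integral_diff) (auto intro!: integrable_ultraspherical h)
  define H P where "H = (\<integral>x. h (v \<bullet> x) \<partial>sphere_measure)" and "P = (\<integral>x. poly p (v \<bullet> x) \<partial>sphere_measure)"
  have "D = T * (H - P) - ((\<integral>x. h x \<partial>ultraspherical_measure d) - (\<integral>x. poly p x \<partial>ultraspherical_measure d))"
    unfolding D_def H_def P_def integral_zonal_poly[OF d v, of p, folded T_def, symmetric] by (simp add: algebra_simps)
  hence "\<bar>D\<bar> \<le> \<bar>T * (H - P)\<bar> + T * e" using 2 by linarith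
  also have "\<bar>T * (H - P)\<bar> \<le> T * e" using 1 T by (simp add: abs_mult H_def P_def)
  finally have "\<bar>D\<bar> \<le> 2 * T * e" by simp
  also have "\<dots> = \<bar>D\<bar> / 2" using T by (simp add: e_def)
  finally show False using D by simp
qed

section \<open>Positive definiteness on the sphere\<close>

lemma bounded_poly_Icc:
  fixes p :: "real poly"
  obtains B where "\<And>x. x \<in> {-1..1} \<Longrightarrow> \<bar>poly p x\<bar> \<le> B"
proof -
  have "bounded (poly p ` {-1..1})"
    by (intro compact_imp_bounded compact_continuous_image continuous_intros compact_Icc)
  then obtain B where "\<forall>x\<in>{-1..1}. \<bar>poly p x\<bar> \<le> B" unfolding bounded_iff by auto
  thus ?thesis using that by blast
qed

lemma sphere_Fubini:
  fixes v :: "'a::euclidean_space" and p q r :: "real poly"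
  assumes v: "norm v = 1"
  shows "(\<integral>y. (\<integral>x. poly p (v \<bullet> x) * (poly q (x \<bullet> y) * poly r (v \<bullet> y)) \<partial>sphere_measure) \<partial>sphere_measure) =
    (\<integral>x. (\<integral>y. poly p (v \<bullet> x) * (poly q (x \<bullet> y) * poly r (v \<bullet> y)) \<partial>sphere_measure) \<partial>sphere_measure)"
proof -
  let ?S = "sphere_measure :: 'a measure"
  interpret S: finite_measure ?S by (rule finite_measure_sphere)
  interpret pair_sigma_finite ?S ?S by unfold_locales
  interpret SS: finite_measure "?S \<Otimes>\<^sub>M ?S" by (intro finite_measure_pair_measure finite_measure_sphere)
  obtain A B C where ABC: "\<And>x. x \<in> {-1..1} \<Longrightarrow> \<bar>poly p x\<bar> \<le> A" "\<And>x. x \<in> {-1..1} \<Longrightarrow> \<bar>poly q x\<bar> \<le> B"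
    "\<And>x. x \<in> {-1..1} \<Longrightarrow> \<bar>poly r x\<bar> \<le> C"
    using bounded_poly_Icc[of p] bounded_poly_Icc[of q] bounded_poly_Icc[of r] by metis
  have id: "(\<lambda>x. x) \<in> borel_measurable ?S" by (intro measurable_sphere continuous_intros)
  have [measurable]: "fst \<in> borel_measurable (?S \<Otimes>\<^sub>M ?S)"
    by (rule measurable_compose[OF measurable_fst id])
  have [measurable]: "snd \<in> borel_measurable (?S \<Otimes>\<^sub>M ?S)"
    by (rule measurable_compose[OF measurable_snd id])
  have [measurable]: "poly s \<in> borel_measurable borel" for s :: "real poly"
    by (intro borel_measurable_continuous_onI continuous_intros)
  have "integrable (?S \<Otimes>\<^sub>M ?S) (\<lambda>z. poly p (v \<bullet> fst z) * (poly q (fst z \<bullet> snd z) * poly r (v \<bullet> snd z)))"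
  proof (rule SS.integrable_const_bound[of _ "A * (B * C)"])
    show "AE z in ?S \<Otimes>\<^sub>M ?S. norm (poly p (v \<bullet> fst z) * (poly q (fst z \<bullet> snd z) * poly r (v \<bullet> snd z))) \<le> A * (B * C)"
    proof (rule AE_I2)
      fix z assume "z \<in> space (?S \<Otimes>\<^sub>M ?S)"
      hence z: "norm (fst z) = 1" "norm (snd z) = 1" by (auto simp: space_pair_measure)
      hence b: "\<bar>poly p (v \<bullet> fst z)\<bar> \<le> A" "\<bar>poly q (fst z \<bullet> snd z)\<bar> \<le> B" "\<bar>poly r (v \<bullet> snd z)\<bar> \<le> C"
        using ABC inner_unit_vectors v by blast+
      have "\<bar>poly p (v \<bullet> fst z)\<bar> * (\<bar>poly q (fst z \<bullet> snd z)\<bar> * \<bar>poly r (v \<bullet> snd z)\<bar>) \<le> A * (B * C)"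
      proof -
        have "0 \<le> A" "0 \<le> B" using b by linarith+
        thus ?thesis using b by (intro mult_mono) auto
      qed
      thus "norm (poly p (v \<bullet> fst z) * (poly q (fst z \<bullet> snd z) * poly r (v \<bullet> snd z))) \<le> A * (B * C)"
        by (simp add: abs_mult)
    qed
  qed measurable
  thus ?thesis by (intro Fubini_integral) (simp add: case_prod_beta')
qed

text \<open>Let G be the convolution of c_n with itself, of degree at most n. For p of lower degree,
  Fubini turns the integral of G p into that of (c_n * p) c_n, which is 0 because c_n * p also has
  degree below n. Hence G is a multiple of c_n, and its value at v = w, a squared norm, fixes the
  factor 1/N_n.\<close>

lemma ultraspherical_convolution:
  fixes v w :: "real ^ 'n"
  assumes d: "CARD('n) = d + 1" "d \<ge> 1" and v: "norm v = 1" and w: "norm w = 1"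
  shows "harmonic_dim d n * (\<integral>x. poly (ultraspherical d n) (v \<bullet> x) * poly (ultraspherical d n) (w \<bullet> x) \<partial>sphere_measure) =
    poly (ultraspherical d n) (v \<bullet> w)"
proof -
  let ?U = "ultraspherical_measure d" and ?S = "sphere_measure :: (real ^ 'n) measure"
  define c where "c = ultraspherical d"
  define T where "T = sphere_area d / sphere_area (d - 1)"
  have T: "T \<noteq> 0" using sphere_area_pos[of d] sphere_area_pos[of "d - 1"] by (simp add: T_def)
  obtain G where G: "degree G \<le> n" "\<And>v w :: real ^ 'n. norm v = 1 \<Longrightarrow> norm w = 1 \<Longrightarrow>
     (\<integral>x. poly (c n) (v \<bullet> x) * poly (c n) (w \<bullet> x) \<partial>?S) = poly G (v \<bullet> w)"
    using sphere_convolution_poly[where ?'n = 'n, of "c n" "c n"] unfolding c_def degree_ultraspherical[OF d(2)] by metis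
  have zon: "T * (\<integral>x. poly p (v \<bullet> x) \<partial>?S) = (\<integral>x. poly p x \<partial>?U)" for p
    unfolding T_def by (rule integral_zonal_poly[OF d v])
  have orth: "(\<integral>x. poly (G * p) x \<partial>?U) = 0" if p: "degree p < n" for p
  proof -
    obtain Q where Q: "degree Q \<le> degree p" "\<And>v w :: real ^ 'n. norm v = 1 \<Longrightarrow> norm w = 1 \<Longrightarrow>
       (\<integral>x. poly (c n) (v \<bullet> x) * poly p (w \<bullet> x) \<partial>?S) = poly Q (v \<bullet> w)"
      using sphere_convolution_poly[where ?'n = 'n, of p "c n"] by metis
    have "(\<integral>y. poly (G * p) (v \<bullet> y) \<partial>?S) =
      (\<integral>y. (\<integral>x. poly (c n) (v \<bullet> x) * (poly (c n) (x \<bullet> y) * poly p (v \<bullet> y)) \<partial>?S) \<partial>?S)"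
    proof (rule Bochner_Integration.integral_cong[OF refl])
      fix y assume "y \<in> space ?S"
      hence "poly G (v \<bullet> y) = (\<integral>x. poly (c n) (v \<bullet> x) * poly (c n) (x \<bullet> y) \<partial>?S)"
        using v by (simp add: G(2)[symmetric] inner_commute)
      hence "poly (G * p) (v \<bullet> y) = (\<integral>x. poly (c n) (v \<bullet> x) * poly (c n) (x \<bullet> y) \<partial>?S) * poly p (v \<bullet> y)" by simp
      thus "poly (G * p) (v \<bullet> y) = (\<integral>x. poly (c n) (v \<bullet> x) * (poly (c n) (x \<bullet> y) * poly p (v \<bullet> y)) \<partial>?S)"
        by (simp flip: integral_mult_left_zero add: mult.assoc)
    qed
    also have "\<dots> = (\<integral>x. (\<integral>y. poly (c n) (v \<bullet> x) * (poly (c n) (x \<bullet> y) * poly p (v \<bullet> y)) \<partial>?S) \<partial>?S)"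
      by (rule sphere_Fubini[OF v])
    also have "\<dots> = (\<integral>x. poly (Q * c n) (v \<bullet> x) \<partial>?S)"
    proof (rule Bochner_Integration.integral_cong[OF refl])
      fix x assume "x \<in> space ?S"
      thus "(\<integral>y. poly (c n) (v \<bullet> x) * (poly (c n) (x \<bullet> y) * poly p (v \<bullet> y)) \<partial>?S) = poly (Q * c n) (v \<bullet> x)"
        using v Q(2)[of x v] by (simp add: inner_commute)
    qed
    finally have "(\<integral>x. poly (G * p) x \<partial>?U) = (\<integral>x. poly (Q * c n) x \<partial>?U)"
      unfolding zon[symmetric] by (simp only:)
    also have "\<dots> = 0" using ultraspherical_orthogonal_poly[OF d(2), of Q n] Q(1) p by (simp add: c_def)
    finally show ?thesis .
  qed
  define h where "h = (\<lambda>k. \<integral>x. poly (c k) x * poly (c k) x \<partial>?U)"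
  have hn: "h k * harmonic_dim d k = T" for k
    using ultraspherical_norm[OF d(2), of k] by (simp add: h_def c_def T_def)
  obtain b where b: "G = (\<Sum>k\<le>n. smult (b k) (c k))"
    using ultraspherical_basis[OF d(2) G(1)] unfolding c_def by blast
  have "b k = 0" if "k < n" for k
  proof -
    have "(\<integral>x. poly (G * c k) x \<partial>?U) = (\<integral>x. (\<Sum>j\<le>n. b j * poly (c j * c k) x) \<partial>?U)"
      unfolding b by (simp add: poly_sum sum_distrib_right mult.assoc)
    also have "\<dots> = (\<Sum>j\<le>n. b j * (\<integral>x. poly (c j * c k) x \<partial>?U))"
      using d by (simp add: Bochner_Integration.integral_sum del: poly_mult)
    also have "\<dots> = (\<Sum>j\<le>n. if j = k then b k * h k else 0)"
      by (intro sum.cong) (auto simp: h_def c_def ultraspherical_orthogonal[OF d(2)])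
    also have "\<dots> = b k * h k" using that by simp
    finally have "b k * h k = 0" using orth[of "c k"] that by (simp add: c_def degree_ultraspherical[OF d(2)])
    thus ?thesis using hn[of k] T by auto
  qed
  hence "G = smult (b n) (c n)" unfolding b by (simp flip: lessThan_Suc_atMost)
  hence Gn: "poly G t = b n * poly (c n) t" for t by simp
  have "b n * harmonic_dim d n = 1"
  proof -
    have vv: "v \<bullet> v = 1" using v by (simp add: norm_eq_1)
    have "b n = poly G (v \<bullet> v)" unfolding Gn vv c_def poly_ultraspherical_1[OF d(2)] by simp
    also have "T * \<dots> = h n" using zon[of "c n * c n"] v by (simp add: G(2)[symmetric] h_def)
    finally have "T * (b n * harmonic_dim d n) = T" using hn[of n] by (simp only: mult.assoc[symmetric])
    thus ?thesis using T by simp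
  qed
  moreover have "(\<integral>x. poly (c n) (v \<bullet> x) * poly (c n) (w \<bullet> x) \<partial>?S) = b n * poly (c n) (v \<bullet> w)"
    using G(2)[OF v w] Gn by simp
  ultimately show ?thesis unfolding c_def[symmetric] by (simp add: mult.commute mult.left_commute)
qed

section \<open>Products and means of positive definite kernels\<close>

lemma nonneg_Reals_sum: "(\<And>x. x \<in> A \<Longrightarrow> f x \<in> \<real>\<^sub>\<ge>\<^sub>0) \<Longrightarrow> sum f A \<in> (\<real>\<^sub>\<ge>\<^sub>0 :: complex set)"
  by (induction A rule: infinite_finite_induct) (auto intro: nonneg_Reals_add_I)

lemma integral_in_nonneg_Reals:
  fixes f :: "'a \<Rightarrow> complex"
  assumes "\<And>x. x \<in> space M \<Longrightarrow> f x \<in> \<real>\<^sub>\<ge>\<^sub>0"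
  shows "integral\<^sup>L M f \<in> \<real>\<^sub>\<ge>\<^sub>0"
proof -
  have "integral\<^sup>L M f = (\<integral>x. complex_of_real (Re (f x)) \<partial>M)"
    using assms by (intro Bochner_Integration.integral_cong) (auto simp: complex_nonneg_Reals_iff complex_eq_iff)
  also have "\<dots> = of_real (\<integral>x. Re (f x) \<partial>M)" by (rule integral_complex_of_real)
  also have "\<dots> \<in> \<real>\<^sub>\<ge>\<^sub>0"
    using assms by (simp add: Bochner_Integration.integral_nonneg complex_nonneg_Reals_iff)
  finally show ?thesis .
qed

text \<open>A form of the Schur product theorem: the convolution identity makes the second factor a
  Gram matrix of functions on the sphere.\<close>

lemma pos_semidef_mult_ultraspherical:
  fixes \<xi> :: "nat \<Rightarrow> real ^ 'n"
  assumes d: "CARD('n) = d + 1" "d \<ge> 1" and \<xi>: "\<And>k. k < m \<Longrightarrow> norm (\<xi> k) = 1" and A: "pos_semidef m A"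
  shows "pos_semidef m (\<lambda>k l. A k l * of_real (poly (ultraspherical d n) (\<xi> k \<bullet> \<xi> l)))"
  unfolding pos_semidef_def
proof
  fix a :: "nat \<Rightarrow> complex"
  define c where "c = poly (ultraspherical d n)"
  define N where "N = harmonic_dim d n"
  let ?S = "sphere_measure :: (real ^ 'n) measure"
  have int: "integrable ?S (\<lambda>x. complex_of_real (c (v \<bullet> x) * c (w \<bullet> x)))" for v w
    unfolding c_def by (intro integrable_sphere continuous_intros continuous_on_compose2[OF continuous_on_poly_real]) auto
  have "(\<Sum>k<m. \<Sum>l<m. A k l * of_real (c (\<xi> k \<bullet> \<xi> l)) * a k * cnj (a l)) =
    (\<Sum>k<m. \<Sum>l<m. (of_real N * (A k l * a k * cnj (a l))) * (\<integral>x. complex_of_real (c (\<xi> k \<bullet> x) * c (\<xi> l \<bullet> x)) \<partial>?S))"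
  proof (intro sum.cong refl)
    fix k l assume "k \<in> {..<m}" "l \<in> {..<m}"
    hence "c (\<xi> k \<bullet> \<xi> l) = N * (\<integral>x. c (\<xi> k \<bullet> x) * c (\<xi> l \<bullet> x) \<partial>?S)"
      unfolding c_def N_def using \<xi> by (intro ultraspherical_convolution[OF d, symmetric]) auto
    note this [simp]
    show "A k l * of_real (c (\<xi> k \<bullet> \<xi> l)) * a k * cnj (a l) =
      (of_real N * (A k l * a k * cnj (a l))) * (\<integral>x. complex_of_real (c (\<xi> k \<bullet> x) * c (\<xi> l \<bullet> x)) \<partial>?S)"
      unfolding integral_complex_of_real by simp
  qed
  also have "\<dots> = (\<integral>x. (\<Sum>k<m. \<Sum>l<m. (of_real N * (A k l * a k * cnj (a l))) * complex_of_real (c (\<xi> k \<bullet> x) * c (\<xi> l \<bullet> x))) \<partial>?S)"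
    using int by (simp add: Bochner_Integration.integral_sum del: of_real_mult)
  also have "\<dots> \<in> \<real>\<^sub>\<ge>\<^sub>0"
  proof (rule integral_in_nonneg_Reals)
    fix x
    \<comment> \<open>For fixed x the Gram factors are real numbers attached to k and l separately,
      so they can be absorbed into the test vector.\<close>
    define b where "b = (\<lambda>k. a k * of_real (c (\<xi> k \<bullet> x)))"
    have "(\<Sum>k<m. \<Sum>l<m. (of_real N * (A k l * a k * cnj (a l))) * complex_of_real (c (\<xi> k \<bullet> x) * c (\<xi> l \<bullet> x))) =
      of_real N * (\<Sum>k<m. \<Sum>l<m. A k l * b k * cnj (b l))"
      by (simp add: b_def sum_distrib_left mult_ac)
    also have "\<dots> \<in> \<real>\<^sub>\<ge>\<^sub>0"
      using A harmonic_dim_pos[OF d(2), of n] unfolding pos_semidef_def N_def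
      by (intro nonneg_Reals_mult_I) auto
    finally show "(\<Sum>k<m. \<Sum>l<m. (of_real N * (A k l * a k * cnj (a l))) * complex_of_real (c (\<xi> k \<bullet> x) * c (\<xi> l \<bullet> x))) \<in> \<real>\<^sub>\<ge>\<^sub>0" .
  qed
  finally show "(\<Sum>k<m. \<Sum>l<m. A k l * of_real (poly (ultraspherical d n) (\<xi> k \<bullet> \<xi> l)) * a k * cnj (a l)) \<in> \<real>\<^sub>\<ge>\<^sub>0"
    by (simp only: c_def)
qed

text \<open>Freed from initial segments of the natural numbers, the index set can be a product, as
  in \<open>integral_pos_def_sphere_funs\<close>.\<close>

lemma pos_def_sphere_funs_sum:
  fixes f :: "real \<times> 'g::topological_group_add \<Rightarrow> complex" and \<xi> :: "'i \<Rightarrow> real ^ 'n"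
  assumes f: "f \<in> pos_def_sphere_funs TYPE('n::finite)" and I: "finite I" and \<xi>: "\<And>i. i \<in> I \<Longrightarrow> norm (\<xi> i) = 1"
  shows "(\<Sum>i\<in>I. \<Sum>j\<in>I. f (\<xi> i \<bullet> \<xi> j, - u i + u j) * a i * cnj (a j)) \<in> \<real>\<^sub>\<ge>\<^sub>0"
proof (cases "I = {}")
  case False
  obtain b where b: "bij_betw b {..<card I} I"
    using ex_bij_betw_nat_finite[OF I] by (auto simp: lessThan_atLeast0)
  have "card I \<ge> 1" using False I by (simp add: card_gt_0_iff Suc_le_eq)
  moreover have "\<forall>k<card I. (\<xi> \<circ> b) k \<in> sphere 0 1" using b \<xi> by (auto simp: bij_betw_def)
  ultimately have "pos_semidef (card I) (\<lambda>k l. f ((\<xi> \<circ> b) k \<bullet> (\<xi> \<circ> b) l, - (u \<circ> b) k + (u \<circ> b) l))"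
    using f unfolding pos_def_sphere_funs_def mem_Collect_eq by blast
  hence "(\<Sum>k<card I. \<Sum>l<card I. f (\<xi> (b k) \<bullet> \<xi> (b l), - u (b k) + u (b l)) * a (b k) * cnj (a (b l))) \<in> \<real>\<^sub>\<ge>\<^sub>0"
    unfolding pos_semidef_def o_def by (rule spec[of _ "\<lambda>k. a (b k)"])
  thus ?thesis by (simp add: sum.reindex_bij_betw[OF b, symmetric])
qed auto

text \<open>Reduces every coefficient function of f to the plain integral of another function of the
  same class.\<close>

lemma pos_def_sphere_funs_mult_ultraspherical:
  fixes f :: "real \<times> 'g::topological_group_add \<Rightarrow> complex"
  assumes d: "CARD('n) = d + 1" "d \<ge> 1" and f: "f \<in> pos_def_sphere_funs TYPE('n::finite)"
  shows "(\<lambda>(t, u). f (t, u) * of_real (poly (ultraspherical d n) t)) \<in> pos_def_sphere_funs TYPE('n)"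
  unfolding pos_def_sphere_funs_def mem_Collect_eq
proof (intro conjI allI impI)
  have "continuous_on ({-1..1} \<times> UNIV) f" using f by (simp add: pos_def_sphere_funs_def)
  thus "continuous_on ({-1..1} \<times> UNIV) (\<lambda>(t, u). f (t, u) * of_real (poly (ultraspherical d n) t))"
    unfolding case_prod_beta' prod.collapse
    by (intro continuous_intros continuous_on_compose2[OF continuous_on_poly_real]) auto
next
  fix m :: nat and \<xi> :: "nat \<Rightarrow> real ^ 'n" and u :: "nat \<Rightarrow> 'g"
  assume "m \<ge> 1" "\<forall>k<m. \<xi> k \<in> sphere 0 1"
  thus "pos_semidef m (\<lambda>k l. case (\<xi> k \<bullet> \<xi> l, - u k + u l) of (t, u) \<Rightarrow> f (t, u) * of_real (poly (ultraspherical d n) t))"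
    using f unfolding prod.case pos_def_sphere_funs_def by (intro pos_semidef_mult_ultraspherical[OF d]) auto
qed

text \<open>The points are chosen greedily: the average of $\sum_{i<n} k(\xi_i \cdot y)$ over the sphere is
  $n \kappa$, so some $y$ does not exceed it. As the double sum is nonnegative for every $n$, this
  forces $\kappa \ge 0$.\<close>

lemma zonal_mean_nonneg:
  fixes k :: "real \<Rightarrow> real"
  assumes k: "continuous_on {-1..1} k"
    and pos: "\<And>n (\<xi> :: nat \<Rightarrow> real ^ 'n). (\<And>i. i < n \<Longrightarrow> norm (\<xi> i) = 1) \<Longrightarrow> (\<Sum>i<n. \<Sum>j<n. k (\<xi> i \<bullet> \<xi> j)) \<ge> 0"
    and mean: "\<And>v :: real ^ 'n. norm v = 1 \<Longrightarrow> (\<integral>x. k (v \<bullet> x) \<partial>sphere_measure) = \<kappa>"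
  shows "\<kappa> \<ge> 0"
proof (rule ccontr)
  let ?S = "sphere_measure :: (real ^ 'n) measure"
  interpret S: finite_measure ?S by (rule finite_measure_sphere)
  \<comment> \<open>The bound is the value for points that behave like the average: n diagonal terms
    k 1 and n (n - 1) off-diagonal terms \<kappa>. For \<kappa> < 0 it is eventually
    negative.\<close>
  have ex: "\<exists>\<xi> :: nat \<Rightarrow> real ^ 'n. (\<forall>i<n. norm (\<xi> i) = 1) \<and>
    (\<Sum>i<n. \<Sum>j<n. k (\<xi> i \<bullet> \<xi> j)) \<le> real n * k 1 + real n * (real n - 1) * \<kappa>" for n
  proof (induction n)
    case (Suc n)
    from Suc.IH obtain \<xi> :: "nat \<Rightarrow> real ^ 'n" where \<xi>: "\<And>i. i < n \<Longrightarrow> norm (\<xi> i) = 1"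
      "(\<Sum>i<n. \<Sum>j<n. k (\<xi> i \<bullet> \<xi> j)) \<le> real n * k 1 + real n * (real n - 1) * \<kappa>" by auto
    have int: "integrable ?S (\<lambda>y. k (\<xi> i \<bullet> y))" if "i < n" for i
      using \<xi>(1)[OF that] by (intro integrable_sphere continuous_on_zonal k)
    have "\<exists>y. norm y = 1 \<and> (\<Sum>i<n. k (\<xi> i \<bullet> y)) \<le> real n * \<kappa>"
    proof (rule ccontr)
      assume "\<not> ?thesis"
      hence "AE y in ?S. real n * \<kappa> < (\<Sum>i<n. k (\<xi> i \<bullet> y))" by (intro AE_I2) (auto simp: not_le)
      hence "(\<integral>y. real n * \<kappa> \<partial>?S) < (\<integral>y. (\<Sum>i<n. k (\<xi> i \<bullet> y)) \<partial>?S)"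
        using int by (intro S.integral_less_AE_space) (auto simp: emeasure_sphere_measure)
      moreover have "(\<integral>y. (\<Sum>i<n. k (\<xi> i \<bullet> y)) \<partial>?S) = real n * \<kappa>"
        using int \<xi>(1) mean by (simp add: Bochner_Integration.integral_sum)
      ultimately show False by simp
    qed
    then obtain y where y: "norm y = 1" "(\<Sum>i<n. k (\<xi> i \<bullet> y)) \<le> real n * \<kappa>" by blast
    have yy: "y \<bullet> y = 1" using y(1) by (simp add: norm_eq_1)
    have "(\<Sum>i<Suc n. \<Sum>j<Suc n. k ((\<xi>(n := y)) i \<bullet> (\<xi>(n := y)) j)) =
      (\<Sum>i<n. \<Sum>j<n. k (\<xi> i \<bullet> \<xi> j)) + 2 * (\<Sum>i<n. k (\<xi> i \<bullet> y)) + k 1"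
    proof -
      have "y \<bullet> \<xi> i = \<xi> i \<bullet> y" for i by (rule inner_commute)
      thus ?thesis by (simp add: sum.distrib yy)
    qed
    also have "\<dots> \<le> real n * k 1 + real n * (real n - 1) * \<kappa> + 2 * (real n * \<kappa>) + k 1"
      using \<xi>(2) y(2) by linarith
    also have "\<dots> = real (Suc n) * k 1 + real (Suc n) * (real (Suc n) - 1) * \<kappa>" by (simp add: algebra_simps)
    finally have le: "(\<Sum>i<Suc n. \<Sum>j<Suc n. k ((\<xi>(n := y)) i \<bullet> (\<xi>(n := y)) j)) \<le> real (Suc n) * k 1 + real (Suc n) * (real (Suc n) - 1) * \<kappa>" .
    have "\<forall>i<Suc n. norm ((\<xi>(n := y)) i) = 1" using \<xi>(1) y(1) by (auto simp: less_Suc_eq)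
    with le show ?case by (intro exI[of _ "\<xi>(n := y)"] conjI)
  qed simp
  assume "\<not> \<kappa> \<ge> 0"
  then obtain n where n: "k 1 < real n * (- \<kappa>)" using reals_Archimedean3[of "- \<kappa>"] by auto
  obtain \<xi> :: "nat \<Rightarrow> real ^ 'n" where \<xi>: "\<And>i. i < Suc n \<Longrightarrow> norm (\<xi> i) = 1"
    "(\<Sum>i<Suc n. \<Sum>j<Suc n. k (\<xi> i \<bullet> \<xi> j)) \<le> real (Suc n) * k 1 + real (Suc n) * (real (Suc n) - 1) * \<kappa>"
    using ex[of "Suc n"] by (elim exE conjE) (rule that, blast+)
  have "0 \<le> real (Suc n) * k 1 + real (Suc n) * (real (Suc n) - 1) * \<kappa>"
    using pos[OF \<xi>(1)] \<xi>(2) by (rule order.trans)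
  also have "\<dots> = real (Suc n) * (k 1 + real n * \<kappa>)" by (simp add: algebra_simps)
  also have "\<dots> < 0" using n by (intro mult_pos_neg) auto
  finally show False by simp
qed

lemma unit_vectors_with_inner:
  assumes "CARD('n::finite) \<ge> 2" and t: "t \<in> {-1..1}"
  obtains v w :: "real ^ 'n" where "norm v = 1" "norm w = 1" "v \<bullet> w = t"
proof -
  have "\<not> card (UNIV :: 'n set) \<le> Suc 0" using assms by simp
  then obtain i j :: 'n where ij: "i \<noteq> j" using card_le_Suc0_iff_eq[of "UNIV :: 'n set"] by auto
  define v w where "v = (axis i 1 :: real ^ 'n)" and "w = t *\<^sub>R axis i 1 + sqrt (1 - t\<^sup>2) *\<^sub>R (axis j 1 :: real ^ 'n)"
  have "t\<^sup>2 \<le> 1" using t by (simp add: abs_square_le_1 abs_le_iff)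
  hence "norm v = 1" "norm w = 1" "v \<bullet> w = t"
    using ij by (auto simp: v_def w_def norm_eq_1 inner_add_left inner_add_right inner_axis_axis power2_eq_square)
  thus ?thesis by (rule that)
qed

lemma integral_zonal_pos_def:
  fixes K :: "real \<Rightarrow> complex"
  assumes d: "CARD('n::finite) = d + 1" "d \<ge> 1" and K: "continuous_on {-1..1} K"
    and pos: "\<And>n (\<xi> :: nat \<Rightarrow> real ^ 'n). (\<And>i. i < n \<Longrightarrow> norm (\<xi> i) = 1) \<Longrightarrow> (\<Sum>i<n. \<Sum>j<n. K (\<xi> i \<bullet> \<xi> j)) \<in> \<real>\<^sub>\<ge>\<^sub>0"
  shows "(\<integral>x. K x \<partial>ultraspherical_measure d) \<in> \<real>\<^sub>\<ge>\<^sub>0"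
proof -
  \<comment> \<open>Symmetry of the inner product makes the two-point sum equal to 2 K(1) + 2 K(t).
    It is real, and so is K(1); as d \<ge> 1, every t in [-1,1] is such an inner product.\<close>
  have real: "Im (K t) = 0" if t: "t \<in> {-1..1}" for t
  proof -
    obtain v w :: "real ^ 'n" where n: "norm v = 1" "norm w = 1" and vw: "v \<bullet> w = t"
      using unit_vectors_with_inner[where ?'n = 'n, OF _ t] d by auto
    have "K (v \<bullet> v) \<in> \<real>\<^sub>\<ge>\<^sub>0" using pos[of 1 "\<lambda>_. v"] n by simp
    moreover have "v \<bullet> v = 1" "w \<bullet> w = 1" "w \<bullet> v = t" using n vw by (simp_all add: norm_eq_1 inner_commute)
    moreover have "(\<Sum>i<2::nat. \<Sum>j<2::nat. K ((if i = 0 then v else w) \<bullet> (if j = 0 then v else w))) \<in> \<real>\<^sub>\<ge>\<^sub>0"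
      using pos[of 2 "\<lambda>i. if i = 0 then v else w"] n by simp
    ultimately show ?thesis by (simp add: numeral_2_eq_2 vw complex_nonneg_Reals_iff)
  qed
  define k where "k = (\<lambda>x. Re (K x))"
  have k: "continuous_on {-1..1} k" unfolding k_def by (intro continuous_intros K)
  define T where "T = sphere_area d / sphere_area (d - 1)"
  have T: "T > 0" by (simp add: T_def sphere_area_pos)
  have "(\<integral>x. k x \<partial>ultraspherical_measure d) / T \<ge> 0"
  proof (rule zonal_mean_nonneg[OF k, where ?'n = 'n])
    show "(\<integral>x. k (v \<bullet> x) \<partial>sphere_measure) = (\<integral>x. k x \<partial>ultraspherical_measure d) / T" if "norm v = 1" for v :: "real ^ 'n"
      using integral_zonal_real[OF d that k, folded T_def] T by (simp add: field_simps)
    show "(\<Sum>i<n. \<Sum>j<n. k (\<xi> i \<bullet> \<xi> j)) \<ge> 0" if "\<And>i. i < n \<Longrightarrow> norm (\<xi> i) = 1" for n and \<xi> :: "nat \<Rightarrow> real ^ 'n"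
      using pos[OF that] by (simp add: k_def complex_nonneg_Reals_iff)
  qed
  hence "(\<integral>x. k x \<partial>ultraspherical_measure d) \<ge> 0" using T by (simp add: zero_le_divide_iff)
  moreover have "(\<integral>x. K x \<partial>ultraspherical_measure d) = (\<integral>x. of_real (k x) \<partial>ultraspherical_measure d)"
    using real by (intro Bochner_Integration.integral_cong) (auto simp: k_def complex_eq_iff)
  ultimately show ?thesis by simp
qed

text \<open>The second variable ranges over an arbitrary topological space, where sequences do not
  detect continuity. Instead of dominated convergence, compactness of [-1,1] supplies a
  neighbourhood of u0 on which f is close to its values at u0 uniformly in t.\<close>

lemma continuous_on_integral_ultraspherical:
  fixes f :: "real \<times> 'g::topological_space \<Rightarrow> complex"
  assumes d: "d \<ge> 1" and f: "continuous_on ({-1..1} \<times> UNIV) f"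
  shows "continuous_on UNIV (\<lambda>u. \<integral>t. f (t, u) \<partial>ultraspherical_measure d)"
proof -
  let ?U = "ultraspherical_measure d"
  interpret finite_measure ?U by (rule finite_measure_ultraspherical[OF d])
  define T where "T = measure ?U {-1..1}"
  have int: "integrable ?U (\<lambda>t. f (t, u))" for u
    by (intro integrable_ultraspherical[OF d] continuous_on_compose2[OF f]) (auto intro!: continuous_intros)
  have swap: "continuous_on (UNIV \<times> {-1..1}) (\<lambda>z. f (snd z, fst z))"
    by (intro continuous_on_compose2[OF f]) (auto intro!: continuous_intros)
  have "((\<lambda>u. \<integral>t. f (t, u) \<partial>?U) \<longlongrightarrow> (\<integral>t. f (t, u0) \<partial>?U)) (at u0)" for u0
  proof (rule tendstoI)
    fix e :: real assume e: "e > 0"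
    \<comment> \<open>The summand 1 makes T e' < e strict, as the pointwise estimate is only a weak
      inequality.\<close>
    define e' where "e' = e / (T + 1)"
    have T: "T \<ge> 0" by (simp add: T_def)
    hence e': "e' > 0" "T * e' < e" using e by (auto simp: e'_def field_simps)
    obtain X where X: "u0 \<in> X" "open X" "\<forall>u\<in>X \<inter> UNIV. \<forall>t\<in>{-1..1}. dist (f (snd (u, t), fst (u, t))) (f (snd (u0, t), fst (u0, t))) \<le> e'"
      using continuous_on_prod_compactE[OF swap compact_Icc UNIV_I e'(1), of u0] by metis
    have "eventually (\<lambda>u. u \<in> X) (at u0)"
      using X by (auto simp: eventually_at_topological)
    thus "eventually (\<lambda>u. dist (\<integral>t. f (t, u) \<partial>?U) (\<integral>t. f (t, u0) \<partial>?U) < e) (at u0)"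
    proof eventually_elim
      case (elim u)
      have "dist (\<integral>t. f (t, u) \<partial>?U) (\<integral>t. f (t, u0) \<partial>?U) = norm (\<integral>t. f (t, u) - f (t, u0) \<partial>?U)"
        using int by (simp add: dist_norm)
      also have "\<dots> \<le> (\<integral>t. norm (f (t, u) - f (t, u0)) \<partial>?U)" by (rule integral_norm_bound)
      also have "\<dots> \<le> (\<integral>t. e' \<partial>?U)"
        using int X(3) elim by (intro integral_mono) (auto simp: dist_norm)
      also have "\<dots> = T * e'" by (simp add: T_def)
      finally show ?case using e'(2) by simp
    qed
  qed
  thus ?thesis by (simp add: continuous_on_def)
qed

text \<open>For fixed group points and weights, the quadratic form is a function of t to which
  \<open>integral_zonal_pos_def\<close> applies: its double sums over sphere points are forms of f
  at all pairs of a sphere point and a group point, with weights that depend on the group point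
  only.\<close>

lemma integral_pos_def_sphere_funs:
  fixes f :: "real \<times> 'g::topological_group_add \<Rightarrow> complex"
  assumes d: "CARD('n) = d + 1" "d \<ge> 1" and f: "f \<in> pos_def_sphere_funs TYPE('n::finite)"
  shows "(\<lambda>u. \<integral>t. f (t, u) \<partial>ultraspherical_measure d) \<in> pos_def_funs"
  unfolding pos_def_funs_def mem_Collect_eq pos_semidef_def
proof (intro conjI allI impI)
  have c: "continuous_on ({-1..1} \<times> UNIV) f" using f by (simp add: pos_def_sphere_funs_def)
  thus "continuous_on UNIV (\<lambda>u. \<integral>t. f (t, u) \<partial>ultraspherical_measure d)"
    by (rule continuous_on_integral_ultraspherical[OF d(2)])
  have cu: "continuous_on {-1..1} (\<lambda>t. f (t, u))" for u
    by (intro continuous_on_compose2[OF c]) (auto intro!: continuous_intros)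
  fix m :: nat and u :: "nat \<Rightarrow> 'g" and a :: "nat \<Rightarrow> complex"
  have "(\<Sum>k<m. \<Sum>l<m. (\<integral>t. f (t, - u k + u l) \<partial>ultraspherical_measure d) * a k * cnj (a l)) =
    (\<integral>t. (\<Sum>k<m. \<Sum>l<m. f (t, - u k + u l) * a k * cnj (a l)) \<partial>ultraspherical_measure d)"
    using integrable_ultraspherical[OF d(2) cu] by (simp add: Bochner_Integration.integral_sum)
  also have "\<dots> \<in> \<real>\<^sub>\<ge>\<^sub>0"
  proof (rule integral_zonal_pos_def[OF d])
    show "continuous_on {-1..1} (\<lambda>t. \<Sum>k<m. \<Sum>l<m. f (t, - u k + u l) * a k * cnj (a l))"
      by (intro continuous_intros cu)
    fix n and \<xi> :: "nat \<Rightarrow> real ^ 'n" assume \<xi>: "\<And>i. i < n \<Longrightarrow> norm (\<xi> i) = 1"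
    have "(\<Sum>i<n. \<Sum>j<n. \<Sum>k<m. \<Sum>l<m. f (\<xi> i \<bullet> \<xi> j, - u k + u l) * a k * cnj (a l)) =
      (\<Sum>p\<in>{..<n} \<times> {..<m}. \<Sum>q\<in>{..<n} \<times> {..<m}. f (\<xi> (fst p) \<bullet> \<xi> (fst q), - u (snd p) + u (snd q)) * a (snd p) * cnj (a (snd q)))"
      unfolding sum.cartesian_product' fst_conv snd_conv by (rule sum.cong[OF refl], rule sum.swap)
    also have "\<dots> \<in> \<real>\<^sub>\<ge>\<^sub>0"
      using \<xi> by (intro pos_def_sphere_funs_sum[OF f, of "{..<n} \<times> {..<m}" "\<lambda>p. \<xi> (fst p)" "\<lambda>p. u (snd p)" "\<lambda>p. a (snd p)"]) auto
    finally show "(\<Sum>i<n. \<Sum>j<n. \<Sum>k<m. \<Sum>l<m. f (\<xi> i \<bullet> \<xi> j, - u k + u l) * a k * cnj (a l)) \<in> \<real>\<^sub>\<ge>\<^sub>0" .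
  qed
  finally show "(\<Sum>k<m. \<Sum>l<m. (\<integral>t. f (t, - u k + u l) \<partial>ultraspherical_measure d) * a k * cnj (a l)) \<in> \<real>\<^sub>\<ge>\<^sub>0" .
qed

section \<open>Positive definite functions on the group\<close>

lemma pos_def_funsD:
  assumes "\<phi> \<in> pos_def_funs" "(n :: nat) \<ge> 1"
  shows "(\<Sum>k<n. \<Sum>l<n. \<phi> (- u k + u l) * a k * cnj (a l)) \<in> \<real>\<^sub>\<ge>\<^sub>0"
proof -
  have "pos_semidef n (\<lambda>k l. \<phi> (- u k + u l))" using assms by (simp add: pos_def_funs_def)
  thus ?thesis unfolding pos_semidef_def by (rule spec)
qed

lemma pos_def_funs_scale:
  assumes "\<phi> \<in> pos_def_funs" "c \<ge> 0"
  shows "(\<lambda>u. of_real c * \<phi> u) \<in> pos_def_funs"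
  unfolding pos_def_funs_def mem_Collect_eq pos_semidef_def
proof (intro conjI allI impI)
  show "continuous_on UNIV (\<lambda>u. of_real c * \<phi> u)"
    using assms by (auto simp: pos_def_funs_def intro!: continuous_intros)
  fix n and u :: "nat \<Rightarrow> 'a" and a :: "nat \<Rightarrow> complex" assume "(1::nat) \<le> n"
  hence "of_real c * (\<Sum>k<n. \<Sum>l<n. \<phi> (- u k + u l) * a k * cnj (a l)) \<in> \<real>\<^sub>\<ge>\<^sub>0"
    using assms by (intro nonneg_Reals_mult_I pos_def_funsD) auto
  thus "(\<Sum>k<n. \<Sum>l<n. of_real c * \<phi> (- u k + u l) * a k * cnj (a l)) \<in> \<real>\<^sub>\<ge>\<^sub>0"
    by (simp add: sum_distrib_left mult.assoc)
qed

lemma pos_def_funs_at_0: "\<phi> \<in> pos_def_funs \<Longrightarrow> \<phi> 0 \<in> \<real>\<^sub>\<ge>\<^sub>0"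
  using pos_def_funsD[of \<phi> "Suc 0" "\<lambda>_. 0" "\<lambda>_. 1"] by simp

text \<open>The form is tested at the two points 0 and u with the vector (1, z). The choices z = 1
  and z = \<i> show that \<phi> is hermitian; z = -sgn (\<phi> u) then gives the bound.\<close>

lemma pos_def_funs_bound:
  assumes \<phi>: "\<phi> \<in> pos_def_funs"
  shows "norm (\<phi> u) \<le> Re (\<phi> 0)"
proof -
  define v where "v = (\<lambda>k::nat. if k = 0 then 0 else u)"
  have key: "\<phi> 0 + \<phi> u * cnj z + \<phi> (- u) * z + \<phi> 0 * z * cnj z \<in> \<real>\<^sub>\<ge>\<^sub>0" for z
    using pos_def_funsD[OF \<phi>, of 2 v "\<lambda>k. if k = 0 then 1 else z"]
    by (simp add: v_def numeral_2_eq_2 add.assoc)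
  have Im0: "Im (\<phi> 0) = 0" using pos_def_funs_at_0[OF \<phi>] by (simp add: complex_nonneg_Reals_iff)
  have "Im (\<phi> u) + Im (\<phi> (- u)) = 0" using key[of 1] Im0 by (simp add: complex_nonneg_Reals_iff)
  moreover have "Re (\<phi> (- u)) = Re (\<phi> u)" using key[of \<i>] Im0 by (simp add: complex_nonneg_Reals_iff)
  ultimately have sym: "\<phi> (- u) = cnj (\<phi> u)" by (simp add: complex_eq_iff)
  show ?thesis
  proof (cases "\<phi> u = 0")
    case True
    thus ?thesis using pos_def_funs_at_0[OF \<phi>] by (simp add: complex_nonneg_Reals_iff)
  next
    case False
    define z where "z = - sgn (\<phi> u)"
    have zz: "z * cnj z = 1" using False by (simp add: z_def complex_norm_square[symmetric] norm_sgn)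
    have "\<phi> u * cnj (sgn (\<phi> u)) = of_real (norm (\<phi> u))"
      using False by (simp add: sgn_eq complex_norm_square[symmetric] power2_eq_square)
    hence 1: "\<phi> u * cnj z = - of_real (norm (\<phi> u))" by (simp add: z_def)
    have "\<phi> (- u) * z = cnj (\<phi> u * cnj z)" by (simp add: sym)
    hence 2: "\<phi> (- u) * z = - of_real (norm (\<phi> u))" unfolding 1 by simp
    show ?thesis using key[of z] unfolding 1 2 mult.assoc[of "\<phi> 0"] zz by (simp add: complex_nonneg_Reals_iff)
  qed
qed

section \<open>Ultraspherical expansions\<close>

text \<open>By the convolution identity c_n(v \<bullet> w) is an inner product of two functions
  which, after scaling by N_n, have norm 1. Cauchy-Schwarz enters through |a b| \<le> (a^2 +
  b^2)/2.\<close>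

lemma abs_ultraspherical_le_1:
  assumes d: "CARD('n::finite) = d + 1" "d \<ge> 1" and t: "t \<in> {-1..1}"
  shows "\<bar>poly (ultraspherical d n) t\<bar> \<le> 1"
proof -
  obtain v w :: "real ^ 'n" where vw: "norm v = 1" "norm w = 1" "v \<bullet> w = t"
    using unit_vectors_with_inner[where ?'n = 'n, OF _ t] d by auto
  define c where "c = poly (ultraspherical d n)"
  define N where "N = harmonic_dim d n"
  have N: "N \<ge> 0" using harmonic_dim_pos[OF d(2), of n] by (simp add: N_def)
  have conv: "N * (\<integral>x. c (v \<bullet> x) * c (w \<bullet> x) \<partial>sphere_measure) = c (v \<bullet> w)" if "norm v = 1" "norm w = 1" for v w :: "real ^ 'n"
    unfolding c_def N_def using that by (intro ultraspherical_convolution[OF d])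
  have int: "integrable sphere_measure (\<lambda>x. c (v \<bullet> x) * c (w \<bullet> x))" for v w :: "real ^ 'n"
    unfolding c_def by (intro integrable_sphere continuous_intros continuous_on_compose2[OF continuous_on_poly_real]) auto
  have sq: "N * (\<integral>x. c (v \<bullet> x) * c (v \<bullet> x) \<partial>sphere_measure) = 1" if "norm v = 1" for v :: "real ^ 'n"
    using conv[OF that that] that by (simp add: norm_eq_1 c_def poly_ultraspherical_1[OF d(2)])
  have "\<bar>\<integral>x. c (v \<bullet> x) * c (w \<bullet> x) \<partial>sphere_measure\<bar> \<le> (\<integral>x. \<bar>c (v \<bullet> x) * c (w \<bullet> x)\<bar> \<partial>sphere_measure)"
    by (rule integral_abs_bound)
  also have "\<dots> \<le> (\<integral>x. (c (v \<bullet> x) * c (v \<bullet> x) + c (w \<bullet> x) * c (w \<bullet> x)) / 2 \<partial>sphere_measure)"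
  proof (rule integral_mono)
    fix x
    show "\<bar>c (v \<bullet> x) * c (w \<bullet> x)\<bar> \<le> (c (v \<bullet> x) * c (v \<bullet> x) + c (w \<bullet> x) * c (w \<bullet> x)) / 2"
      using sum_squares_bound[of "\<bar>c (v \<bullet> x)\<bar>" "\<bar>c (w \<bullet> x)\<bar>"] by (simp add: abs_mult power2_eq_square)
  qed (use int in auto)
  also have "\<dots> = ((\<integral>x. c (v \<bullet> x) * c (v \<bullet> x) \<partial>sphere_measure) + (\<integral>x. c (w \<bullet> x) * c (w \<bullet> x) \<partial>sphere_measure)) / 2"
    using int by simp
  finally have "N * \<bar>\<integral>x. c (v \<bullet> x) * c (w \<bullet> x) \<partial>sphere_measure\<bar> \<le>
    N * (((\<integral>x. c (v \<bullet> x) * c (v \<bullet> x) \<partial>sphere_measure) + (\<integral>x. c (w \<bullet> x) * c (w \<bullet> x) \<partial>sphere_measure)) / 2)"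
    using N by (rule mult_left_mono)
  also have "\<dots> = 1" using sq[OF vw(1)] sq[OF vw(2)] by (simp add: algebra_simps)
  also have "N * \<bar>\<integral>x. c (v \<bullet> x) * c (w \<bullet> x) \<partial>sphere_measure\<bar> = \<bar>c t\<bar>"
    using conv[OF vw(1,2)] N vw(3) by (metis abs_mult abs_of_nonneg)
  finally show ?thesis by (simp add: c_def)
qed

text \<open>Integration by parts with p = (1 + x)^m. The mean of 1 - x under the normalized kernel
  is d/(m + d), which tends to 0; this is the concentration at 1.\<close>

lemma ultraspherical_integral_one_plus_x_power:
  fixes d :: nat
  assumes d: "d \<ge> 1"
  shows "(real m + real d) * (\<integral>x. (1 + x) ^ m * (1 - x) \<partial>ultraspherical_measure d) =
      real d * (\<integral>x. (1 + x) ^ m \<partial>ultraspherical_measure d)"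
    and "(\<integral>x. (1 + x) ^ m \<partial>ultraspherical_measure d) > 0"
proof -
  let ?U = "ultraspherical_measure d"
  have int: "integrable ?U (\<lambda>x. (1 + x) ^ m * (1 - x))" "integrable ?U (\<lambda>x. (1 + x) ^ m)" for m
    using d by (auto intro!: integrable_ultraspherical continuous_intros)
  have 1: "(real m + real d) * (\<integral>x. (1 + x) ^ m * (1 - x) \<partial>?U) = real d * (\<integral>x. (1 + x) ^ m \<partial>?U)" for m
  proof -
    define p where "p = [:1, 1 :: real:] ^ m"
    have "poly (pderiv p * [:1, 0, -1:] - smult (real d) (pCons 0 p)) x =
      (real m + real d) * ((1 + x) ^ m * (1 - x)) - real d * (1 + x) ^ m" for x
    proof (cases m)
      case 0
      thus ?thesis by (simp add: p_def algebra_simps)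
    next
      case (Suc k)
      have "poly (pderiv p) x = (real m) * (1 + x) ^ k"
        unfolding p_def Suc pderiv_power_Suc by (simp add: pderiv_pCons algebra_simps)
      moreover have "poly p x = (1 + x) * (1 + x) ^ k" by (simp only: p_def Suc power_Suc poly_mult poly_power) simp
      ultimately show ?thesis unfolding Suc by (simp add: algebra_simps)
    qed
    hence "poly (pderiv p * [:1, 0, -1:] - smult (real d) (pCons 0 p)) =
      (\<lambda>x. (real m + real d) * ((1 + x) ^ m * (1 - x)) - real d * (1 + x) ^ m)" by blast
    hence "(\<integral>x. (real m + real d) * ((1 + x) ^ m * (1 - x)) - real d * (1 + x) ^ m \<partial>?U) = 0"
      using ultraspherical_integration_by_parts[OF d, of p] by (simp only:)
    thus ?thesis using int[of m] by simp
  qed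
  thus "(real m + real d) * (\<integral>x. (1 + x) ^ m * (1 - x) \<partial>?U) = real d * (\<integral>x. (1 + x) ^ m \<partial>?U)" .
  show "(\<integral>x. (1 + x) ^ m \<partial>?U) > 0"
  proof (induction m)
    case 0
    thus ?case using measure_ultraspherical[OF d] by (simp add: sphere_area_pos)
  next
    case (Suc m)
    define L J where "L = (\<integral>x. (1 + x) ^ m \<partial>?U)" and "J = (\<integral>x. (1 + x) ^ m * (1 - x) \<partial>?U)"
    \<comment> \<open>Since that mean is at most 1, the integral of the next power is at least as
      large as the present one.\<close>
    have "(1 + x) ^ Suc m = 2 * (1 + x) ^ m - (1 + x) ^ m * (1 - x)" for x :: real by (simp add: algebra_simps)
    hence "(\<integral>x. (1 + x) ^ Suc m \<partial>?U) = 2 * L - J"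
      using int[of m] by (simp add: L_def J_def)
    moreover have "J \<le> L"
    proof -
      have "(real m + real d) * J \<le> (real m + real d) * L"
        using 1[of m] Suc by (simp add: L_def J_def mult_right_mono)
      thus ?thesis using d by (simp add: mult_le_cancel_left)
    qed
    ultimately show ?case using Suc by (simp add: L_def)
  qed
qed

text \<open>1 - p is divisible by x - 1, and the quotient is bounded on [-1,1]. With a bound linear
  in 1 - x, control of the mean of 1 - x is enough for the approximate identity.\<close>

lemma poly_eq_1_Lipschitz:
  fixes p :: "real poly"
  assumes "poly p 1 = 1"
  obtains K where "\<And>x. x \<in> {-1..1} \<Longrightarrow> \<bar>1 - poly p x\<bar> \<le> K * (1 - x)"
proof -
  have "poly (1 - p) 1 = 0" using assms by simp
  then obtain q where q: "1 - p = [:-1, 1:] * q" unfolding poly_eq_0_iff_dvd by (auto elim: dvdE)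
  obtain K where K: "\<And>x. x \<in> {-1..1} \<Longrightarrow> \<bar>poly q x\<bar> \<le> K" using bounded_poly_Icc by blast
  have "\<bar>1 - poly p x\<bar> \<le> K * (1 - x)" if x: "x \<in> {-1..1}" for x
  proof -
    have "1 - poly p x = (x - 1) * poly q x" using arg_cong[OF q, of "\<lambda>r. poly r x"] by (simp add: algebra_simps)
    hence "\<bar>1 - poly p x\<bar> = \<bar>poly q x\<bar> * (1 - x)" using x by (simp add: abs_mult)
    also have "\<dots> \<le> K * (1 - x)" using x K[OF x] by (intro mult_right_mono) auto
    finally show ?thesis .
  qed
  thus ?thesis using that by blast
qed

text \<open>The kernels $(1 + x)^m / \int (1 + y)^m\,dy$ are an approximate identity at $1$ and have
  nonnegative coefficients, so integrating $F$ against them bounds the partial sums.\<close>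

lemma ultraspherical_nonneg_coeffs_summable:
  fixes F :: "real \<Rightarrow> real"
  assumes d: "d \<ge> 1" and F: "continuous_on {-1..1} F"
    and pos: "\<And>n. (\<integral>x. F x * poly (ultraspherical d n) x \<partial>ultraspherical_measure d) \<ge> 0"
  shows "summable (\<lambda>n. harmonic_dim d n * (\<integral>x. F x * poly (ultraspherical d n) x \<partial>ultraspherical_measure d))"
proof -
  let ?U = "ultraspherical_measure d"
  define c where "c = (\<lambda>n. poly (ultraspherical d n))"
  define A where "A = (\<lambda>n. \<integral>x. F x * c n x \<partial>?U)"
  define T where "T = sphere_area d / sphere_area (d - 1)"
  have T: "T > 0" by (simp add: T_def sphere_area_pos)
  define h where "h = (\<lambda>n. \<integral>x. c n x * c n x \<partial>?U)"
  have hT: "h n * harmonic_dim d n = T" for n using ultraspherical_norm[OF d, of n] by (simp add: h_def c_def T_def)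
  have A0: "A n \<ge> 0" for n using pos by (simp add: A_def c_def)
  have cont: "continuous_on {-1..1} (c n)" for n unfolding c_def by (rule continuous_on_poly_real)
  have "bounded (F ` {-1..1})" by (intro compact_imp_bounded compact_continuous_image F compact_Icc)
  then obtain B where "\<forall>x\<in>{-1..1}. \<bar>F x\<bar> \<le> B" unfolding bounded_iff by auto
  hence B: "\<bar>F x\<bar> \<le> B" if "x \<in> {-1..1}" for x using that by blast
  define L where "L = (\<lambda>m. \<integral>x. (1 + x) ^ m \<partial>?U)"
  have Lpos: "L m > 0" for m unfolding L_def by (rule ultraspherical_integral_one_plus_x_power[OF d])
  obtain K where K: "\<And>n x. x \<in> {-1..1} \<Longrightarrow> \<bar>1 - c n x\<bar> \<le> K n * (1 - x)"
  proof -
    have "\<forall>n. \<exists>K. \<forall>x\<in>{-1..1}. \<bar>1 - c n x\<bar> \<le> K * (1 - x)"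
    proof
      fix n
      obtain K where "\<And>x. x \<in> {-1..1} \<Longrightarrow> \<bar>1 - c n x\<bar> \<le> K * (1 - x)"
        using poly_eq_1_Lipschitz[OF poly_ultraspherical_1[OF d, of n]] unfolding c_def by blast
      thus "\<exists>K. \<forall>x\<in>{-1..1}. \<bar>1 - c n x\<bar> \<le> K * (1 - x)" by (intro exI ballI)
    qed
    hence "\<exists>K. \<forall>n. \<forall>x\<in>{-1..1}. \<bar>1 - c n x\<bar> \<le> K n * (1 - x)" by (rule choice)
    thus ?thesis using that by blast
  qed
  \<comment> \<open>For fixed k, integrating the kernel against c_k loses at most the fraction K k
    d/(m + d) of its mass \<open>L m\<close>.\<close>
  have lower: "(1 - K k * real d / (real m + real d)) * L m \<le> (\<integral>x. (1 + x) ^ m * c k x \<partial>?U)" for m k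
  proof -
    have md: "real m + real d > 0" using d by simp
    have "(\<integral>x. (1 + x) ^ m - K k * ((1 + x) ^ m * (1 - x)) \<partial>?U) \<le> (\<integral>x. (1 + x) ^ m * c k x \<partial>?U)"
    proof (rule integral_mono)
      fix x assume "x \<in> space ?U"
      hence x: "x \<in> {-1..1}" by simp
      have "(1 + x) ^ m * (1 - K k * (1 - x)) \<le> (1 + x) ^ m * c k x"
        using K[OF x, of k] x by (intro mult_left_mono) auto
      thus "(1 + x) ^ m - K k * ((1 + x) ^ m * (1 - x)) \<le> (1 + x) ^ m * c k x" by (simp add: algebra_simps)
    qed (auto intro!: integrable_ultraspherical[OF d] continuous_intros cont)
    also have "(\<integral>x. (1 + x) ^ m - K k * ((1 + x) ^ m * (1 - x)) \<partial>?U) = L m - K k * (\<integral>x. (1 + x) ^ m * (1 - x) \<partial>?U)"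
      unfolding L_def using d by (subst Bochner_Integration.integral_diff) (auto intro!: integrable_ultraspherical continuous_intros)
    also have "(\<integral>x. (1 + x) ^ m * (1 - x) \<partial>?U) = real d * L m / (real m + real d)"
      using ultraspherical_integral_one_plus_x_power(1)[OF d, of m] md by (simp add: L_def field_simps)
    finally show ?thesis by (simp add: algebra_simps)
  qed
  \<comment> \<open>N_k times the integral of (1 + x)^m c_k is T b_k. As b_k and A_k are
    nonnegative, the sum may be extended to all k \<le> m, where it becomes T times the integral of
    F (1 + x)^m.\<close>
  have upper: "(\<Sum>k<n. harmonic_dim d k * A k * (\<integral>x. (1 + x) ^ m * c k x \<partial>?U)) \<le> T * B * L m" if "n \<le> m" for n m
  proof -
    obtain b where b: "\<And>k. b k \<ge> 0" "[:1, 1:] ^ m = (\<Sum>k\<le>m. smult (b k) (ultraspherical d k))"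
      using ultraspherical_one_plus_x_power[OF d] by blast
    have exp: "(1 + x) ^ m = (\<Sum>k\<le>m. b k * c k x)" for x
      using arg_cong[OF b(2), of "\<lambda>p. poly p x"] by (simp add: poly_sum c_def)
    have coeff: "(\<integral>x. (1 + x) ^ m * c k x \<partial>?U) = b k * h k" if "k \<le> m" for k
    proof -
      have "(\<integral>x. (1 + x) ^ m * c k x \<partial>?U) = (\<integral>x. (\<Sum>j\<le>m. b j * (c j x * c k x)) \<partial>?U)"
        unfolding exp by (simp add: sum_distrib_right mult.assoc)
      also have "\<dots> = (\<Sum>j\<le>m. b j * (\<integral>x. c j x * c k x \<partial>?U))"
        using d cont by (subst Bochner_Integration.integral_sum) (auto intro!: integrable_ultraspherical continuous_intros)
      also have "\<dots> = (\<Sum>j\<le>m. if j = k then b k * h k else 0)"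
        by (intro sum.cong) (auto simp: h_def c_def ultraspherical_orthogonal[OF d])
      finally show ?thesis using that by simp
    qed
    have "(\<Sum>k<n. harmonic_dim d k * A k * (\<integral>x. (1 + x) ^ m * c k x \<partial>?U)) = (\<Sum>k<n. T * (b k * A k))"
    proof (intro sum.cong refl)
      fix k assume "k \<in> {..<n}"
      hence "harmonic_dim d k * A k * (\<integral>x. (1 + x) ^ m * c k x \<partial>?U) = (h k * harmonic_dim d k) * (b k * A k)"
        using coeff[of k] that by (simp add: mult_ac)
      thus "harmonic_dim d k * A k * (\<integral>x. (1 + x) ^ m * c k x \<partial>?U) = T * (b k * A k)" by (simp only: hT)
    qed
    also have "\<dots> \<le> (\<Sum>k\<le>m. T * (b k * A k))"
      using that T b(1) A0 by (intro sum_mono2) auto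
    also have "\<dots> = T * (\<integral>x. (\<Sum>k\<le>m. b k * (F x * c k x)) \<partial>?U)"
      unfolding A_def using d cont F
      by (subst Bochner_Integration.integral_sum) (auto intro!: integrable_ultraspherical continuous_intros simp: sum_distrib_left)
    also have "(\<lambda>x. (\<Sum>k\<le>m. b k * (F x * c k x))) = (\<lambda>x. F x * (1 + x) ^ m)"
      unfolding exp by (auto simp: sum_distrib_left mult_ac)
    also have "(\<integral>x. F x * (1 + x) ^ m \<partial>?U) \<le> (\<integral>x. B * (1 + x) ^ m \<partial>?U)"
    proof (rule integral_mono)
      fix x assume "x \<in> space ?U"
      hence x: "x \<in> {-1..1}" by simp
      thus "F x * (1 + x) ^ m \<le> B * (1 + x) ^ m" using B[OF x] by (intro mult_right_mono) auto
    qed (auto intro!: integrable_ultraspherical[OF d] continuous_intros F)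
    finally show ?thesis using T by (simp add: L_def mult_left_mono mult.assoc)
  qed
  \<comment> \<open>With n fixed, \<open>lower\<close> and \<open>upper\<close> are divided by
    \<open>L m\<close>, and m tends to infinity.\<close>
  have "(\<Sum>k<n. harmonic_dim d k * A k) \<le> T * B" for n
  proof (rule LIMSEQ_le_const2)
    have "(\<lambda>m. real d / (real m + real d)) \<longlonglongrightarrow> 0" by real_asymp
    hence "(\<lambda>m. \<Sum>k<n. harmonic_dim d k * A k * (1 - K k * (real d / (real m + real d)))) \<longlonglongrightarrow>
      (\<Sum>k<n. harmonic_dim d k * A k * (1 - K k * 0))"
      by (intro tendsto_intros)
    thus "(\<lambda>m. \<Sum>k<n. harmonic_dim d k * A k * (1 - K k * (real d / (real m + real d)))) \<longlonglongrightarrow> (\<Sum>k<n. harmonic_dim d k * A k)"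
      by simp
    have "(\<Sum>k<n. harmonic_dim d k * A k * (1 - K k * (real d / (real m + real d)))) \<le> T * B" if "n \<le> m" for m
    proof -
      have "(\<Sum>k<n. harmonic_dim d k * A k * (1 - K k * (real d / (real m + real d)))) * L m =
        (\<Sum>k<n. harmonic_dim d k * A k * ((1 - K k * real d / (real m + real d)) * L m))"
        by (simp add: sum_distrib_right mult.assoc)
      also have "\<dots> \<le> (\<Sum>k<n. harmonic_dim d k * A k * (\<integral>x. (1 + x) ^ m * c k x \<partial>?U))"
        using lower A0 less_imp_le[OF harmonic_dim_pos[OF d]] by (intro sum_mono mult_left_mono) auto
      also have "\<dots> \<le> T * B * L m" by (rule upper[OF that])
      finally show ?thesis using Lpos[of m] by (simp add: mult_le_cancel_right)
    qed
    thus "\<exists>N. \<forall>m\<ge>N. (\<Sum>k<n. harmonic_dim d k * A k * (1 - K k * (real d / (real m + real d)))) \<le> T * B" by blast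
  qed
  hence "summable (\<lambda>n. harmonic_dim d n * A n)"
    using A0 less_imp_le[OF harmonic_dim_pos[OF d]] by (intro summableI_nonneg_bounded) auto
  thus ?thesis by (simp add: A_def c_def)
qed

text \<open>D is orthogonal to all polynomials, hence to their uniform limits, in particular to (1 -
  x^2) D.\<close>

lemma ultraspherical_complete:
  fixes D :: "real \<Rightarrow> real"
  assumes d: "d \<ge> 1" and D: "continuous_on {-1..1} D"
    and zero: "\<And>n. (\<integral>x. D x * poly (ultraspherical d n) x \<partial>ultraspherical_measure d) = 0"
    and x: "x \<in> {-1..1}"
  shows "D x = 0"
proof -
  let ?U = "ultraspherical_measure d"
  have poly0: "(\<integral>x. D x * poly p x \<partial>?U) = 0" for p
  proof -
    obtain b where b: "p = (\<Sum>k\<le>degree p. smult (b k) (ultraspherical d k))"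
      using ultraspherical_basis[OF d] by blast
    have "(\<integral>x. D x * poly p x \<partial>?U) = (\<integral>x. (\<Sum>k\<le>degree p. b k * (D x * poly (ultraspherical d k) x)) \<partial>?U)"
      by (subst b) (simp add: poly_sum sum_distrib_left mult_ac)
    also have "\<dots> = (\<Sum>k\<le>degree p. b k * (\<integral>x. D x * poly (ultraspherical d k) x \<partial>?U))"
      using d D by (subst Bochner_Integration.integral_sum) (auto intro!: integrable_ultraspherical continuous_intros)
    also have "\<dots> = 0" using zero by simp
    finally show ?thesis .
  qed
  \<comment> \<open>The factor 1 - x^2 raises the exponent of the weight from d/2 - 1 to d/2 > 0.
    The integrand \<open>G\<close> below is then continuous on the closed interval also for d =
    1.\<close>
  define g where "g = (\<lambda>x. (1 - x\<^sup>2) * D x)"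
  have g: "continuous_on {-1..1} g" unfolding g_def by (intro continuous_intros D)
  define I where "I = (\<integral>x. D x * g x \<partial>?U)"
  define M where "M = (\<integral>x. \<bar>D x\<bar> \<partial>?U)"
  have M: "M \<ge> 0" by (simp add: M_def)
  have small: "\<bar>I\<bar> \<le> e * M" if e: "e > 0" for e
  proof -
    obtain p where p: "\<And>x. x \<in> {-1..1} \<Longrightarrow> \<bar>g x - poly p x\<bar> < e" using poly_approximation[OF g e] by blast
    have "I = (\<integral>x. D x * g x \<partial>?U) - (\<integral>x. D x * poly p x \<partial>?U)" by (simp add: poly0 I_def)
    also have "\<dots> = (\<integral>x. D x * (g x - poly p x) \<partial>?U)"
      using d D g by (subst Bochner_Integration.integral_diff[symmetric]) (auto intro!: integrable_ultraspherical continuous_intros simp: algebra_simps)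
    finally have "\<bar>I\<bar> \<le> (\<integral>x. \<bar>D x * (g x - poly p x)\<bar> \<partial>?U)" by (simp add: integral_abs_bound)
    also have "\<dots> \<le> (\<integral>x. e * \<bar>D x\<bar> \<partial>?U)"
    proof (rule integral_mono)
      fix x assume "x \<in> space ?U"
      hence "\<bar>g x - poly p x\<bar> \<le> e" using p[of x] by auto
      thus "\<bar>D x * (g x - poly p x)\<bar> \<le> e * \<bar>D x\<bar>" 
        using mult_left_mono[of "\<bar>g x - poly p x\<bar>" e "\<bar>D x\<bar>"] by (simp add: abs_mult mult.commute[of e])
    qed (use d D g in \<open>auto intro!: integrable_ultraspherical continuous_intros\<close>)
    finally show ?thesis by (simp add: M_def)
  qed
  have I0: "I = 0"
  proof (rule ccontr)
    assume "I \<noteq> 0"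
    \<comment> \<open>A choice of e with e M < |I|; M + 1 avoids division by 0 when M = 0.\<close>
    hence pos: "\<bar>I\<bar> / (2 * (M + 1)) > 0" using M by simp
    have "\<bar>I\<bar> \<le> \<bar>I\<bar> / (2 * (M + 1)) * M" by (rule small[OF pos])
    also have "\<dots> = \<bar>I\<bar> * (M / (2 * (M + 1)))" by simp
    also have "\<dots> < \<bar>I\<bar> * 1" using M \<open>I \<noteq> 0\<close> by (intro mult_strict_left_mono) (auto simp: field_simps)
    finally show False by simp
  qed
  define G where "G = (\<lambda>x. (1 - x\<^sup>2) powr (real d / 2) * (D x)\<^sup>2)"
  have G: "continuous_on {-1..1} G" unfolding G_def
    using d by (intro continuous_intros continuous_on_powr' D) (auto simp: abs_square_le_1 abs_le_iff)
  have Gw: "G x = (1 - x\<^sup>2) powr (real d / 2 - 1) * (D x * g x)" if "x \<in> {-1..1}" for x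
  proof (cases "1 - x\<^sup>2 = 0")
    case True
    thus ?thesis by (simp add: G_def g_def)
  next
    case False
    have "x\<^sup>2 \<le> 1" using that by (simp add: abs_square_le_1 abs_le_iff)
    hence "1 - x\<^sup>2 > 0" using False by linarith
    hence "(1 - x\<^sup>2) powr (real d / 2) = (1 - x\<^sup>2) powr (real d / 2 - 1) * (1 - x\<^sup>2)"
      by (simp add: powr_diff)
    thus ?thesis by (simp add: G_def g_def power2_eq_square mult_ac)
  qed
  have Gint: "(G has_integral integral {-1..1} G) {-1..1}"
    using integrable_continuous_real[OF G] by (simp add: has_integral_integral)
  have "I = integral {-1..1} G" unfolding I_def
  proof (rule integral_ultraspherical_eq_HK[OF d])
    show "((\<lambda>x. (1 - x\<^sup>2) powr (real d / 2 - 1) * (D x * g x)) has_integral integral {-1..1} G) {-1..1}"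
      using Gint by (rule has_integral_eq[rotated]) (rule Gw)
  qed (intro continuous_intros D g)
  hence "(G has_integral 0) (cbox (-1) 1)" using Gint I0 by simp
  moreover have "continuous_on (cbox (-1) 1) G" using G by simp
  ultimately have G0: "G x = 0" if "x \<in> {-1..1}" for x
    using has_integral_0_cbox_imp_0[of "-1" 1 G x] that by (auto simp: G_def)
  \<comment> \<open>\<open>G\<close> carries no information at the endpoints, which are reached by
    continuity of D.\<close>
  have "D x = 0" if "x \<in> {-1<..<1}" for x
  proof -
    have "1 - x\<^sup>2 \<noteq> 0" using that by (simp add: power2_eq_1_iff)
    thus ?thesis using G0[of x] that by (simp add: G_def)
  qed
  thus ?thesis using continuous_constant_on_closure[of "{-1<..<1}" D 0 x] D x by simp
qed

text \<open>The bound |c_n| \<le> 1 permits the Weierstrass test and termwise integration, after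
  which orthogonality leaves a single term. This serves twice: it identifies the sum of the
  constructed series, and it determines the coefficients of any given expansion.\<close>

lemma ultraspherical_series:
  fixes a :: "nat \<Rightarrow> complex"
  assumes d: "CARD('n::finite) = d + 1" "d \<ge> 1" and a: "summable (\<lambda>n. norm (a n))"
    and g: "\<And>t. t \<in> {-1..1} \<Longrightarrow> (\<lambda>n. a n * of_real (poly (ultraspherical d n) t)) sums g t"
  shows "continuous_on {-1..1} g"
    and "of_real (harmonic_dim d n) * (\<integral>t. g t * of_real (poly (ultraspherical d n) t) \<partial>ultraspherical_measure d) =
      of_real (sphere_area d / sphere_area (d - 1)) * a n"
proof -
  let ?U = "ultraspherical_measure d"
  define c where "c = (\<lambda>n. poly (ultraspherical d n))"
  have c1: "\<bar>c n t\<bar> \<le> 1" if "t \<in> {-1..1}" for n t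
    unfolding c_def by (rule abs_ultraspherical_le_1[OF d that])
  have cont: "continuous_on {-1..1} (\<lambda>t. complex_of_real (c n t))" for n
    unfolding c_def by (intro continuous_intros)
  have bound: "norm (a m * of_real (c m t)) \<le> norm (a m)" if "t \<in> {-1..1}" for m t
    using c1[OF that, of m] by (simp add: norm_mult mult_left_le)
  have "uniform_limit {-1..1} (\<lambda>n t. \<Sum>i<n. a i * of_real (c i t)) (\<lambda>t. \<Sum>i. a i * of_real (c i t)) sequentially"
    by (rule Weierstrass_m_test[OF bound a])
  hence "continuous_on {-1..1} (\<lambda>t. \<Sum>i. a i * of_real (c i t))"
    by (rule uniform_limit_theorem[rotated]) (auto intro!: always_eventually continuous_intros cont)
  moreover have gsum: "g t = (\<Sum>i. a i * of_real (c i t))" if "t \<in> {-1..1}" for t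
    using g[OF that] by (simp add: sums_iff c_def)
  ultimately show "continuous_on {-1..1} g" by (subst continuous_on_cong[OF refl gsum])
  define f where "f = (\<lambda>m t. a m * of_real (c m t) * of_real (c n t))"
  have int: "integrable ?U (f m)" for m unfolding f_def by (intro integrable_ultraspherical[OF d(2)] continuous_intros cont)
  have fb: "norm (f m t) \<le> norm (a m)" if "t \<in> {-1..1}" for m t
  proof -
    have "norm (f m t) = norm (a m * of_real (c m t)) * \<bar>c n t\<bar>" by (simp add: f_def norm_mult)
    also have "\<dots> \<le> norm (a m * of_real (c m t)) * 1" using c1[OF that] by (intro mult_left_mono) auto
    finally show ?thesis using bound[OF that, of m] by simp
  qed
  interpret finite_measure ?U by (rule finite_measure_ultraspherical[OF d(2)])
  have "(\<lambda>m. integral\<^sup>L ?U (f m)) sums (\<integral>t. (\<Sum>m. f m t) \<partial>?U)"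
  proof (rule sums_integral[OF int])
    show "AE t in ?U. summable (\<lambda>m. norm (f m t))"
      using fb by (intro AE_I2 summable_comparison_test'[OF a, of 0]) auto
    have "(\<integral>t. norm (f m t) \<partial>?U) \<le> measure ?U {-1..1} * norm (a m)" for m
    proof -
      have "(\<integral>t. norm (f m t) \<partial>?U) \<le> (\<integral>t. norm (a m) \<partial>?U)" using int fb by (intro integral_mono) auto
      thus ?thesis by simp
    qed
    thus "summable (\<lambda>m. \<integral>t. norm (f m t) \<partial>?U)"
      by (intro summable_comparison_test'[OF summable_mult[OF a, of "measure ?U {-1..1}"], of 0]) auto
  qed
  moreover have "(\<integral>t. (\<Sum>m. f m t) \<partial>?U) = (\<integral>t. g t * of_real (c n t) \<partial>?U)"
  proof (rule Bochner_Integration.integral_cong[OF refl])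
    fix t assume "t \<in> space ?U"
    hence "(\<lambda>m. a m * of_real (c m t)) sums g t" using g[of t] by (simp add: c_def)
    from sums_mult2[OF this, of "of_real (c n t)"] show "(\<Sum>m. f m t) = g t * of_real (c n t)"
      by (simp add: f_def sums_iff)
  qed
  moreover have "integral\<^sup>L ?U (f m) = (if m = n then a n * of_real (\<integral>t. c n t * c n t \<partial>?U) else 0)" for m
  proof -
    have "integral\<^sup>L ?U (f m) = (\<integral>t. a m * complex_of_real (c m t * c n t) \<partial>?U)"
      by (simp add: f_def mult.assoc)
    also have "\<dots> = a m * of_real (\<integral>t. c m t * c n t \<partial>?U)"
      by (simp only: integral_mult_right_zero integral_complex_of_real)
    finally show ?thesis by (auto simp: c_def ultraspherical_orthogonal[OF d(2)])
  qed
  ultimately have "(\<lambda>m. if m = n then a n * of_real (\<integral>t. c n t * c n t \<partial>?U) else 0) sums (\<integral>t. g t * of_real (c n t) \<partial>?U)"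
    by simp
  moreover have "(\<lambda>m. if m = n then a n * of_real (\<integral>t. c n t * c n t \<partial>?U) else 0) sums (a n * of_real (\<integral>t. c n t * c n t \<partial>?U))"
    using sums_single[of n "\<lambda>_. a n * of_real (\<integral>t. c n t * c n t \<partial>?U)"] by simp
  ultimately have "(\<integral>t. g t * of_real (c n t) \<partial>?U) = a n * of_real (\<integral>t. c n t * c n t \<partial>?U)"
    by (rule sums_unique2)
  thus "of_real (harmonic_dim d n) * (\<integral>t. g t * of_real (poly (ultraspherical d n) t) \<partial>?U) =
      of_real (sphere_area d / sphere_area (d - 1)) * a n"
    unfolding ultraspherical_norm[OF d(2), of n, symmetric] by (simp add: c_def mult_ac)
qed

section \<open>The two implications and the theorem\<close>

lemma schoenberg_expansion_imp_pos_def: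
  fixes f :: "real \<times> 'g::topological_group_add \<Rightarrow> complex"
  assumes d: "CARD('n::finite) = d + 1" "d \<ge> 1" and f: "continuous_on ({-1..1} \<times> UNIV) f"
    and \<phi>: "\<And>n. \<phi> n \<in> pos_def_funs"
    and sums: "\<And>t u. t \<in> {-1..1} \<Longrightarrow> (\<lambda>n. \<phi> n u * of_real (poly (ultraspherical d n) t)) sums f (t, u)"
  shows "f \<in> pos_def_sphere_funs TYPE('n)"
  unfolding pos_def_sphere_funs_def mem_Collect_eq pos_semidef_def
proof (intro conjI allI impI f)
  fix m and \<xi> :: "nat \<Rightarrow> real ^ 'n" and u :: "nat \<Rightarrow> 'g" and a :: "nat \<Rightarrow> complex"
  assume m: "(1::nat) \<le> m" and \<xi>: "\<forall>k<m. \<xi> k \<in> sphere 0 1"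
  define F where "F = (\<lambda>n. \<Sum>k<m. \<Sum>l<m. (\<phi> n (- u k + u l) * of_real (poly (ultraspherical d n) (\<xi> k \<bullet> \<xi> l))) * a k * cnj (a l))"
  have "F sums (\<Sum>k<m. \<Sum>l<m. f (\<xi> k \<bullet> \<xi> l, - u k + u l) * a k * cnj (a l))"
    unfolding F_def using \<xi>
    by (intro sums_sum sums_mult2 sums) (auto intro!: inner_unit_vectors simp del: atLeastAtMost_iff)
  moreover have "F n \<in> \<real>\<^sub>\<ge>\<^sub>0" for n
  proof -
    have "pos_semidef m (\<lambda>k l. \<phi> n (- u k + u l))" using \<phi> m by (simp add: pos_def_funs_def)
    hence "pos_semidef m (\<lambda>k l. \<phi> n (- u k + u l) * of_real (poly (ultraspherical d n) (\<xi> k \<bullet> \<xi> l)))"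
      using \<xi> by (intro pos_semidef_mult_ultraspherical[OF d]) auto
    thus ?thesis unfolding F_def pos_semidef_def by (rule spec)
  qed
  \<comment> \<open>Each term is nonnegative by the Schur product lemma, and the nonnegative reals
    are closed in the complex plane.\<close>
  hence partial: "(\<Sum>n<N. F n) \<in> \<real>\<^sub>\<ge>\<^sub>0" for N by (rule nonneg_Reals_sum)
  ultimately show "(\<Sum>k<m. \<Sum>l<m. f (\<xi> k \<bullet> \<xi> l, - u k + u l) * a k * cnj (a l)) \<in> \<real>\<^sub>\<ge>\<^sub>0"
    unfolding sums_def by (intro Lim_in_closed_set[OF closed_nonneg_Reals_complex always_eventually[OF allI[OF partial]] sequentially_bot])
qed

lemma pos_def_funs_norm_summable:
  assumes "\<And>n. \<phi> n \<in> pos_def_funs" "summable (\<lambda>n. \<phi> n 0)"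
  shows "summable (\<lambda>n. norm (\<phi> n u))"
proof (rule summable_comparison_test'[of "\<lambda>n. Re (\<phi> n 0)" 0])
  show "summable (\<lambda>n. Re (\<phi> n 0))" using assms(2) by (rule summable_Re)
qed (simp add: pos_def_funs_bound[OF assms(1)])

lemma schoenberg_expansion_iff_poly:
  assumes d: "d \<ge> 1"
  shows "schoenberg_expansion d f \<phi> \<longleftrightarrow> (\<forall>n. \<phi> n \<in> pos_def_funs) \<and> summable (\<lambda>n. \<phi> n 0) \<and>
     (\<forall>t\<in>{-1..1}. \<forall>u. (\<lambda>n. \<phi> n u * of_real (poly (ultraspherical d n) t)) sums f (t, u))"
proof -
  define P where "P = (\<lambda>t. \<forall>u. (\<lambda>n. \<phi> n u * of_real (poly (ultraspherical d n) t)) sums f (t, u))"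
  have "cos ` {0..pi} = {-1..1}"
  proof (intro equalityI subsetI)
    fix t :: real assume "t \<in> {-1..1}"
    hence "t = cos (arccos t)" "arccos t \<in> {0..pi}" by (auto simp: arccos_lbound arccos_ubound)
    thus "t \<in> cos ` {0..pi}" by (rule image_eqI)
  qed auto
  hence "(\<forall>t\<in>{-1..1}. P t) \<longleftrightarrow> (\<forall>t\<in>cos ` {0..pi}. P t)" by simp
  hence "(\<forall>t\<in>{-1..1}. P t) \<longleftrightarrow> (\<forall>\<theta>\<in>{0..pi}. P (cos \<theta>))" by blast
  thus ?thesis unfolding schoenberg_expansion_def P_def
    by (simp add: normalized_gegenbauer_eq_poly[OF d])
qed

lemma pos_def_sphere_imp_expansion:
  fixes f :: "real \<times> 'g::topological_group_add \<Rightarrow> complex"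
  assumes d: "CARD('n::finite) = d + 1" "d \<ge> 1" and f: "f \<in> pos_def_sphere_funs TYPE('n)"
  shows "\<exists>\<phi>. schoenberg_expansion d f \<phi>"
proof -
  let ?U = "ultraspherical_measure d"
  define c where "c = (\<lambda>n. poly (ultraspherical d n))"
  define T where "T = sphere_area d / sphere_area (d - 1)"
  have T: "T > 0" by (simp add: T_def sphere_area_pos)
  have N: "harmonic_dim d n > 0" for n using d harmonic_dim_pos by simp
  define A where "A = (\<lambda>n u. \<integral>t. f (t, u) * of_real (c n t) \<partial>?U)"
  \<comment> \<open>The factor is the reciprocal of the integral of c_n^2 by
    \<open>ultraspherical_norm\<close>.\<close>
  define \<phi> where "\<phi> = (\<lambda>n u. of_real (harmonic_dim d n / T) * A n u)"
  have cf: "continuous_on ({-1..1} \<times> UNIV) f" using f by (simp add: pos_def_sphere_funs_def)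
  have cu: "continuous_on {-1..1} (\<lambda>t. f (t, u))" for u
    by (intro continuous_on_compose2[OF cf]) (auto intro!: continuous_intros)
  have cc: "continuous_on {-1..1} (c n)" for n unfolding c_def by (rule continuous_on_poly_real)
  have A: "A n \<in> pos_def_funs" for n
    using integral_pos_def_sphere_funs[OF d pos_def_sphere_funs_mult_ultraspherical[OF d f, of n]]
    by (simp add: A_def c_def)
  have \<phi>: "\<phi> n \<in> pos_def_funs" for n
    unfolding \<phi>_def using T N[of n] by (intro pos_def_funs_scale A) auto
  \<comment> \<open>Summability and completeness were proved for real functions, so complex
    coefficients are split into their parts.\<close>
  have parts: "Re (\<integral>t. h t * of_real (c n t) \<partial>?U) = (\<integral>t. Re (h t) * c n t \<partial>?U)"
    "Im (\<integral>t. h t * of_real (c n t) \<partial>?U) = (\<integral>t. Im (h t) * c n t \<partial>?U)"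
    if "continuous_on {-1..1} h" for h :: "real \<Rightarrow> complex" and n
  proof -
    have "integrable ?U (\<lambda>t. h t * of_real (c n t))"
      by (intro integrable_ultraspherical[OF d(2)] continuous_intros that cc)
    from integral_Re[OF this] integral_Im[OF this]
    show "Re (\<integral>t. h t * of_real (c n t) \<partial>?U) = (\<integral>t. Re (h t) * c n t \<partial>?U)"
      "Im (\<integral>t. h t * of_real (c n t) \<partial>?U) = (\<integral>t. Im (h t) * c n t \<partial>?U)" by simp_all
  qed
  \<comment> \<open>At the neutral element all coefficients are nonnegative, as the kernel argument
    requires; \<open>pos_def_funs_norm_summable\<close> then carries the summability to every
    u.\<close>
  have sm: "summable (\<lambda>n. \<phi> n 0)"
  proof -
    have ReA: "Re (A n 0) = (\<integral>x. Re (f (x, 0)) * poly (ultraspherical d n) x \<partial>?U)" for n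
      unfolding A_def using parts(1)[OF cu] by (simp only: c_def)
    have "summable (\<lambda>n. harmonic_dim d n * (\<integral>x. Re (f (x, 0)) * poly (ultraspherical d n) x \<partial>?U))"
    proof (rule ultraspherical_nonneg_coeffs_summable[OF d(2)])
      fix n
      have "Re (A n 0) \<ge> 0" using pos_def_funs_at_0[OF A] by (simp add: complex_nonneg_Reals_iff)
      thus "(\<integral>x. Re (f (x, 0)) * poly (ultraspherical d n) x \<partial>?U) \<ge> 0"
        by (simp only: ReA)
    qed (intro continuous_intros cu)
    hence "summable (\<lambda>n. complex_of_real (harmonic_dim d n * Re (A n 0) * (1 / T)))"
      by (intro summable_of_real summable_mult2) (simp only: ReA)
    moreover have "complex_of_real (harmonic_dim d n * Re (A n 0) * (1 / T)) = \<phi> n 0" for n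
      using pos_def_funs_at_0[OF A, of n] by (simp add: \<phi>_def complex_nonneg_Reals_iff complex_eq_iff)
    ultimately show ?thesis by (simp only:)
  qed
  have nsm: "summable (\<lambda>n. norm (\<phi> n u))" for u using \<phi> sm by (rule pos_def_funs_norm_summable)
  have expansion: "(\<lambda>n. \<phi> n u * of_real (c n t)) sums f (t, u)" if t: "t \<in> {-1..1}" for t u
  proof -
    \<comment> \<open>The series converges to some continuous function; that it is f( . , u) follows
      from equality of all coefficients.\<close>
    define g where "g = (\<lambda>t. \<Sum>n. \<phi> n u * of_real (c n t))"
    have gs: "(\<lambda>n. \<phi> n u * of_real (c n t)) sums g t" if t: "t \<in> {-1..1}" for t
      unfolding g_def
    proof (intro summable_sums summable_comparison_test'[OF nsm[of u], of 0])
      fix n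
      show "norm (\<phi> n u * of_real (c n t)) \<le> norm (\<phi> n u)"
        using abs_ultraspherical_le_1[OF d t, of n] by (simp add: norm_mult c_def mult_left_le)
    qed
    note series = ultraspherical_series[OF d nsm[of u] gs[unfolded c_def]]
    have g: "continuous_on {-1..1} g" by (rule series(1))
    have coeff: "(\<integral>t. g t * of_real (c n t) \<partial>?U) = A n u" for n
    proof -
      have "of_real (harmonic_dim d n) * (\<integral>t. g t * of_real (c n t) \<partial>?U) = of_real T * \<phi> n u"
        unfolding T_def c_def by (rule series(2))
      also have "\<dots> = of_real (harmonic_dim d n) * A n u" using T by (simp add: \<phi>_def)
      finally show ?thesis using N[of n] by simp
    qed
    define h where "h = (\<lambda>t. f (t, u) - g t)"
    have h: "continuous_on {-1..1} h" unfolding h_def by (intro continuous_intros cu g)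
    have "(\<integral>t. h t * of_real (c n t) \<partial>?U) = 0" for n
    proof -
      have "(\<integral>t. h t * of_real (c n t) \<partial>?U) = A n u - (\<integral>t. g t * of_real (c n t) \<partial>?U)"
        unfolding A_def h_def left_diff_distrib
        by (intro Bochner_Integration.integral_diff integrable_ultraspherical[OF d(2)] continuous_intros cu g cc)
      thus ?thesis by (simp add: coeff)
    qed
    hence "(\<integral>t. Re (h t) * c n t \<partial>?U) = 0" "(\<integral>t. Im (h t) * c n t \<partial>?U) = 0" for n
      using parts[OF h, of n] by simp_all
    hence "Re (h t) = 0" "Im (h t) = 0"
      using ultraspherical_complete[OF d(2) continuous_on_Re[OF h] _ t]
        ultraspherical_complete[OF d(2) continuous_on_Im[OF h] _ t] by (simp_all add: c_def)
    hence "h t = 0" by (simp add: complex_eq_iff)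
    hence "g t = f (t, u)" by (simp add: h_def)
    thus ?thesis using gs[OF t] by simp
  qed
  have "schoenberg_expansion d f \<phi>"
    unfolding schoenberg_expansion_iff_poly[OF d(2)] using \<phi> sm expansion[unfolded c_def] by blast
  thus ?thesis by blast
qed

theorem theorem3p3:
  fixes f :: "real \<times> 'g::topological_group_add \<Rightarrow> complex" and d :: nat
  assumes "locally_compact_space (euclidean :: 'g topology)"
    and "d \<ge> 1" and "CARD('n::finite) = d + 1"
    and "continuous_on ({-1..1} \<times> UNIV) f"
  shows "(f \<in> pos_def_sphere_funs TYPE('n) \<longleftrightarrow> (\<exists>\<phi>. schoenberg_expansion d f \<phi>)) \<and>
    (\<forall>\<phi>. schoenberg_expansion d f \<phi> \<longrightarrow>
       uniform_limit ({0..pi} \<times> UNIV)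
         (\<lambda>N (\<theta>, u). \<Sum>n<N. \<phi> n u * of_real (normalized_gegenbauer d n (cos \<theta>)))
         (\<lambda>(\<theta>, u). f (cos \<theta>, u)) sequentially \<and>
       (\<forall>n u. \<phi> n u = of_real (harmonic_dim d n * sphere_area (d - 1) / sphere_area d) *
          (LINT x:{-1..1}|lborel.
             f (x, u) * of_real (normalized_gegenbauer d n x * (1 - x\<^sup>2) powr (real d / 2 - 1)))))"
proof (intro conjI iffI allI impI)
  note d = assms(3,2)
  show "\<exists>\<phi>. schoenberg_expansion d f \<phi>" if f: "f \<in> pos_def_sphere_funs TYPE('n)"
    by (rule pos_def_sphere_imp_expansion[OF d f])
  show "f \<in> pos_def_sphere_funs TYPE('n)" if "\<exists>\<phi>. schoenberg_expansion d f \<phi>"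
  proof -
    from that obtain \<phi> where "schoenberg_expansion d f \<phi>" ..
    hence "\<And>n. \<phi> n \<in> pos_def_funs"
      "\<And>t u. t \<in> {-1..1} \<Longrightarrow> (\<lambda>n. \<phi> n u * of_real (poly (ultraspherical d n) t)) sums f (t, u)"
      unfolding schoenberg_expansion_iff_poly[OF d(2)] by blast+
    thus ?thesis by (rule schoenberg_expansion_imp_pos_def[OF d assms(4), of \<phi>])
  qed
  fix \<phi> assume "schoenberg_expansion d f \<phi>"
  hence \<phi>: "\<And>n. \<phi> n \<in> pos_def_funs" and sm: "summable (\<lambda>n. \<phi> n 0)"
    and sums: "\<And>t u. t \<in> {-1..1} \<Longrightarrow> (\<lambda>n. \<phi> n u * of_real (poly (ultraspherical d n) t)) sums f (t, u)"
    unfolding schoenberg_expansion_iff_poly[OF d(2)] by blast+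
  define F where "F = (\<lambda>n z. \<phi> n (snd z) * complex_of_real (normalized_gegenbauer d n (cos (fst z))))"
  \<comment> \<open>The majorant depends on neither \<theta> nor u, so one Weierstrass test gives
    uniformity in both variables.\<close>
  have bound: "norm (F n z) \<le> Re (\<phi> n 0)" for n z
  proof -
    have "\<bar>normalized_gegenbauer d n (cos (fst z))\<bar> \<le> 1"
      using abs_ultraspherical_le_1[OF d, of "cos (fst z)" n] by (simp add: normalized_gegenbauer_eq_poly[OF d(2)])
    hence "norm (F n z) \<le> norm (\<phi> n (snd z))" by (simp add: F_def norm_mult mult_left_le)
    thus ?thesis using pos_def_funs_bound[OF \<phi>, of n "snd z"] by linarith
  qed
  have "uniform_limit ({0..pi} \<times> UNIV) (\<lambda>N z. \<Sum>n<N. F n z) (\<lambda>z. \<Sum>n. F n z) sequentially"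
    by (rule Weierstrass_m_test[OF bound summable_Re[OF sm]])
  moreover have "(\<Sum>n. F n z) = f (cos (fst z), snd z)" if "z \<in> {0..pi} \<times> UNIV" for z
    using sums[of "cos (fst z)" "snd z"]
    by (simp add: F_def sums_iff normalized_gegenbauer_eq_poly[OF d(2)])
  ultimately have "uniform_limit ({0..pi} \<times> UNIV) (\<lambda>N z. \<Sum>n<N. F n z) (\<lambda>z. f (cos (fst z), snd z)) sequentially"
    by (simp cong: uniform_limit_cong')
  thus "uniform_limit ({0..pi} \<times> UNIV)
         (\<lambda>N (\<theta>, u). \<Sum>n<N. \<phi> n u * of_real (normalized_gegenbauer d n (cos \<theta>)))
         (\<lambda>(\<theta>, u). f (cos \<theta>, u)) sequentially"
    by (simp add: F_def case_prod_beta')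
  fix n u
  have cu: "continuous_on {-1..1} (\<lambda>t. f (t, u))"
    by (intro continuous_on_compose2[OF assms(4)]) (auto intro!: continuous_intros)
  \<comment> \<open>Here \<phi> is an arbitrary expansion of f, so the coefficient formula also
    shows that the expansion is unique.\<close>
  have "of_real (harmonic_dim d n) * (\<integral>t. f (t, u) * of_real (poly (ultraspherical d n) t) \<partial>ultraspherical_measure d) =
      of_real (sphere_area d / sphere_area (d - 1)) * \<phi> n u"
    by (rule ultraspherical_series(2)[OF d pos_def_funs_norm_summable[OF \<phi> sm] sums])
  also have "(\<integral>t. f (t, u) * of_real (poly (ultraspherical d n) t) \<partial>ultraspherical_measure d) =
    (LINT x:{-1..1}|lborel. (1 - x\<^sup>2) powr (real d / 2 - 1) *\<^sub>R (f (x, u) * of_real (poly (ultraspherical d n) x)))"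
    by (intro integral_ultraspherical continuous_intros cu)
  also have "\<dots> = (LINT x:{-1..1}|lborel. f (x, u) * of_real (normalized_gegenbauer d n x * (1 - x\<^sup>2) powr (real d / 2 - 1)))"
    by (rule set_lebesgue_integral_cong)
      (auto simp: normalized_gegenbauer_eq_poly[OF d(2)] scaleR_conv_of_real mult_ac)
  finally show "\<phi> n u = of_real (harmonic_dim d n * sphere_area (d - 1) / sphere_area d) *
          (LINT x:{-1..1}|lborel. f (x, u) * of_real (normalized_gegenbauer d n x * (1 - x\<^sup>2) powr (real d / 2 - 1)))"
    using sphere_area_pos[of d] sphere_area_pos[of "d - 1"] by (simp add: field_simps)
qed

end
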